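(* Assume $G$ is weakly amenable. Then $\Sigma$ has the bounded Fejér property.
   Context: Standing setup. All C*-algebras are unital. A twisted (unital, discrete) C*-dynamical system is a quadruple $\Sigma=(A,G,\alpha,\sigma)$, where $A$ is a unital C*-algebra, $G$ a discrete group with identity $e$, $\alpha:G\to\mathrm{Aut}(A)$ and $\sigma:G\times G\to\mathcal U(A)$ satisfy $\alpha_g\alpha_h=\mathrm{Ad}(\sigma(g,h))\alpha_{gh}$, $\sigma(g,h)\sigma(gh,k)=\alpha_g(\sigma(h,k))\sigma(g,hk)$, $\sigma(g,e)=\sigma(e,g)=1$. Series converge unconditionally. Let $A^\Sigma$ be the set of $\xi:G\to A$ such that $\sum_g\alpha_g^{-1}(\xi(g)^*\xi(g))$ converges in norm; a right Hilbert $A$-module with $(\xi\times a)(g)=\xi(g)\alpha_g(a)$, $\langle\xi,\eta\rangle_\alpha=\sum_g\alpha_g^{-1}(\xi(g)^*\eta(g))$. $A$ acts by $(a\xi)(h)=a\xi(h)$, and $(\lambda_\Sigma(g)\xi)(h)=\alpha_g(\xi(g^{-1}h))\sigma(g,g^{-1}h)$. $C_r^*(\Sigma)$ is the C*-subalgebra of $\mathcal L(A^\Sigma)$ generated by $A$ and $\lambda_\Sigma(G)$, operator norm $\|\cdot\|$. $C_c(\Sigma)$: finitely supported $G\to A$, $\Lambda_\Sigma(f)=\sum_g f(g)\lambda_\Sigma(g)$. For $x\in C_r^*(\Sigma)$, $\hat x=x\xi_0$ with $\xi_0(e)=1$, $\xi_0(g)=0$ otherwise; its Fourier series is $\sum_g\hat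 x(g)\lambda_\Sigma(g)$. Multipliers and summation: for $T:G\times A\to A$ linear in the second variable write $T_g(a)=T(g,a)$, $(T\cdot f)(g)=T_g(f(g))$. $T\in MA(\Sigma)$ if there is a bounded linear $M_T:C_r^*(\Sigma)\to C_r^*(\Sigma)$ with $M_T(\Lambda_\Sigma(f))=\Lambda_\Sigma(T\cdot f)$ for all $f\in C_c(\Sigma)$; $|||T|||:=\|M_T\|$. $CF(\Sigma)$ is the set of $x$ whose Fourier series converges in operator norm; $MCF(\Sigma)=\{T\in MA(\Sigma)\mid M_T(x)\in CF(\Sigma)\ \forall x\}$. A Fourier summing net is a net $\{T^i\}$ in $MCF(\Sigma)$ with $\|M_{T^i}(x)-x\|\to0$ for all $x$; bounded if $\sup_i|||T^i|||<\infty$. $T$ has finite $G$-support if $T_g=0$ for all but finitely many $g$. $\Sigma$ has the bounded Fejér property if there is a bounded Fourier summing net consisting of multipliers with finite $G$-support. Weak amenability: a function $\varphi:G\to\mathbb C$ is a cb-multiplier of $G$ if there is a completely bounded map $M_\varphi:C_r^*(G)\to C_r^*(G)$ with $M_\varphi(\lambda(g))=\varphi(g)\lambda(g)$ ($\lambda$ the left regular representation). $G$ is weakly amenable if there is a net $\{\varphi_i\}$ of finitely supported cb-multipliers of $G$ converging pointwise to $1$ with $\sup_i\|M_{\varphi_i}\|_{cb}<\infty$. *)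

theory Defs
  imports "HOL-Analysis.Analysis"
begin

class discrete_group = monoid_mult +
  fixes ginv :: "'a \<Rightarrow> 'a"
  assumes ginv_left: "ginv x * x = 1"
    and ginv_right: "x * ginv x = 1"

class cstar_alg = real_normed_algebra_1 + banach +
  fixes cstar :: "'a \<Rightarrow> 'a"
    and scaleC :: "complex \<Rightarrow> 'a \<Rightarrow> 'a"
  assumes scaleC_add_right: "scaleC c (x + y) = scaleC c x + scaleC c y"
    and scaleC_add_left: "scaleC (c + d) x = scaleC c x + scaleC d x"
    and scaleC_scaleC: "scaleC c (scaleC d x) = scaleC (c * d) x"
    and scaleC_of_real: "scaleC (complex_of_real r) x = scaleR r x"
    and scaleC_mult_left: "scaleC c x * y = scaleC c (x * y)"
    and scaleC_mult_right: "x * scaleC c y = scaleC c (x * y)"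
    and norm_scaleC: "norm (scaleC c x) = cmod c * norm x"
    and cstar_add: "cstar (x + y) = cstar x + cstar y"
    and cstar_scaleC: "cstar (scaleC c x) = scaleC (cnj c) (cstar x)"
    and cstar_mult: "cstar (x * y) = cstar y * cstar x"
    and cstar_cstar: "cstar (cstar x) = x"
    and cstar_identity: "norm (cstar x * x) = (norm x)\<^sup>2"

instantiation complex :: cstar_alg
begin
definition cstar_complex :: "complex \<Rightarrow> complex" where "cstar_complex = cnj"
definition scaleC_complex :: "complex \<Rightarrow> complex \<Rightarrow> complex" where "scaleC_complex c z = c * z"
instance
  by standard (auto simp: cstar_complex_def scaleC_complex_def algebra_simps norm_mult
      power2_eq_square scaleR_conv_of_real)
end

definition unitary_el :: "'a::cstar_alg \<Rightarrow> bool" where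
  "unitary_el u \<longleftrightarrow> cstar u * u = 1 \<and> u * cstar u = 1"

definition star_automorphism :: "('a::cstar_alg \<Rightarrow> 'a) \<Rightarrow> bool" where
  "star_automorphism \<phi> \<longleftrightarrow> bij \<phi>
     \<and> (\<forall>x y. \<phi> (x + y) = \<phi> x + \<phi> y)
     \<and> (\<forall>c x. \<phi> (scaleC c x) = scaleC c (\<phi> x))
     \<and> (\<forall>x y. \<phi> (x * y) = \<phi> x * \<phi> y)
     \<and> (\<forall>x. \<phi> (cstar x) = cstar (\<phi> x))
     \<and> \<phi> 1 = 1"

definition twisted :: "('g::discrete_group \<Rightarrow> 'a::cstar_alg \<Rightarrow> 'a) \<Rightarrow> ('g \<Rightarrow> 'g \<Rightarrow> 'a) \<Rightarrow> bool" where
  "twisted \<alpha> \<sigma> \<longleftrightarrow>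
     (\<forall>g. star_automorphism (\<alpha> g))
   \<and> (\<forall>g h. unitary_el (\<sigma> g h))
   \<and> (\<forall>g h x. \<alpha> g (\<alpha> h x) = \<sigma> g h * \<alpha> (g * h) x * cstar (\<sigma> g h))
   \<and> (\<forall>g h k. \<sigma> g h * \<sigma> (g * h) k = \<alpha> g (\<sigma> h k) * \<sigma> g (h * k))
   \<and> (\<forall>g. \<sigma> g 1 = 1 \<and> \<sigma> 1 g = 1)"

type_synonym ('g, 'a) op = "('g \<Rightarrow> 'a) \<Rightarrow> ('g \<Rightarrow> 'a)"

definition AS :: "('g \<Rightarrow> 'a \<Rightarrow> 'a) \<Rightarrow> ('g \<Rightarrow> 'a::cstar_alg) set" where
  "AS \<alpha> = {\<xi>. (\<lambda>g. inv (\<alpha> g) (cstar (\<xi> g) * \<xi> g)) summable_on UNIV}"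

definition ip :: "('g \<Rightarrow> 'a \<Rightarrow> 'a) \<Rightarrow> ('g \<Rightarrow> 'a::cstar_alg) \<Rightarrow> ('g \<Rightarrow> 'a) \<Rightarrow> 'a" where
  "ip \<alpha> \<xi> \<eta> = infsum (\<lambda>g. inv (\<alpha> g) (cstar (\<xi> g) * \<eta> g)) UNIV"

text \<open>Operators are identified with their restriction to \<open>A^\<Sigma>\<close> (value 0 outside).\<close>
definition restr :: "('g \<Rightarrow> 'a \<Rightarrow> 'a) \<Rightarrow> ('g, 'a::cstar_alg) op \<Rightarrow> ('g, 'a) op" where
  "restr \<alpha> T = (\<lambda>\<xi>. if \<xi> \<in> AS \<alpha> then T \<xi> else (\<lambda>_. 0))"

definition opnorm :: "('g \<Rightarrow> 'a \<Rightarrow> 'a) \<Rightarrow> ('g, 'a::cstar_alg) op \<Rightarrow> real" where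
  "opnorm \<alpha> T = Sup {sqrt (norm (ip \<alpha> (T \<xi>) (T \<xi>))) | \<xi>. \<xi> \<in> AS \<alpha> \<and> sqrt (norm (ip \<alpha> \<xi> \<xi>)) \<le> 1}"

definition is_adjoint :: "('g \<Rightarrow> 'a \<Rightarrow> 'a) \<Rightarrow> ('g, 'a::cstar_alg) op \<Rightarrow> ('g, 'a) op \<Rightarrow> bool" where
  "is_adjoint \<alpha> T S \<longleftrightarrow> (\<forall>\<xi>\<in>AS \<alpha>. \<forall>\<eta>\<in>AS \<alpha>. ip \<alpha> (T \<xi>) \<eta> = ip \<alpha> \<xi> (S \<eta>))"

definition Lmod :: "('g \<Rightarrow> 'a \<Rightarrow> 'a) \<Rightarrow> ('g, 'a::cstar_alg) op set" where
  "Lmod \<alpha> = {T. T = restr \<alpha> T \<and> (\<forall>\<xi>\<in>AS \<alpha>. T \<xi> \<in> AS \<alpha>)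
      \<and> (\<exists>S. (\<forall>\<xi>\<in>AS \<alpha>. S \<xi> \<in> AS \<alpha>) \<and> is_adjoint \<alpha> T S)}"

definition op_add :: "('g, 'a::cstar_alg) op \<Rightarrow> ('g, 'a) op \<Rightarrow> ('g, 'a) op" where
  "op_add T S = (\<lambda>\<xi> h. T \<xi> h + S \<xi> h)"

definition op_diff :: "('g, 'a::cstar_alg) op \<Rightarrow> ('g, 'a) op \<Rightarrow> ('g, 'a) op" where
  "op_diff T S = (\<lambda>\<xi> h. T \<xi> h - S \<xi> h)"

definition op_scale :: "complex \<Rightarrow> ('g, 'a::cstar_alg) op \<Rightarrow> ('g, 'a) op" where
  "op_scale c T = (\<lambda>\<xi> h. scaleC c (T \<xi> h))"

definition lmul :: "('g \<Rightarrow> 'a \<Rightarrow> 'a) \<Rightarrow> 'a::cstar_alg \<Rightarrow> ('g, 'a) op" where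
  "lmul \<alpha> a = restr \<alpha> (\<lambda>\<xi> h. a * \<xi> h)"

definition lam :: "('g::discrete_group \<Rightarrow> 'a \<Rightarrow> 'a) \<Rightarrow> ('g \<Rightarrow> 'g \<Rightarrow> 'a::cstar_alg) \<Rightarrow> 'g \<Rightarrow> ('g, 'a) op" where
  "lam \<alpha> \<sigma> g = restr \<alpha> (\<lambda>\<xi> h. \<alpha> g (\<xi> (ginv g * h)) * \<sigma> g (ginv g * h))"

inductive_set Cr :: "('g::discrete_group \<Rightarrow> 'a \<Rightarrow> 'a) \<Rightarrow> ('g \<Rightarrow> 'g \<Rightarrow> 'a::cstar_alg) \<Rightarrow> ('g, 'a) op set"
  for \<alpha> \<sigma> where
  gen_A: "lmul \<alpha> a \<in> Cr \<alpha> \<sigma>"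
| gen_lam: "lam \<alpha> \<sigma> g \<in> Cr \<alpha> \<sigma>"
| add: "T \<in> Cr \<alpha> \<sigma> \<Longrightarrow> S \<in> Cr \<alpha> \<sigma> \<Longrightarrow> op_add T S \<in> Cr \<alpha> \<sigma>"
| scale: "T \<in> Cr \<alpha> \<sigma> \<Longrightarrow> op_scale c T \<in> Cr \<alpha> \<sigma>"
| comp: "T \<in> Cr \<alpha> \<sigma> \<Longrightarrow> S \<in> Cr \<alpha> \<sigma> \<Longrightarrow> restr \<alpha> (T \<circ> S) \<in> Cr \<alpha> \<sigma>"
| adj: "T \<in> Cr \<alpha> \<sigma> \<Longrightarrow> S \<in> Lmod \<alpha> \<Longrightarrow> is_adjoint \<alpha> T S \<Longrightarrow> S \<in> Cr \<alpha> \<sigma>"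
| lim: "(\<And>n::nat. Tn n \<in> Cr \<alpha> \<sigma>) \<Longrightarrow> T \<in> Lmod \<alpha>
        \<Longrightarrow> (\<lambda>n. opnorm \<alpha> (op_diff (Tn n) T)) \<longlonglongrightarrow> 0 \<Longrightarrow> T \<in> Cr \<alpha> \<sigma>"

definition Cc :: "('g \<Rightarrow> 'a::cstar_alg) set" where
  "Cc = {f. finite {g. f g \<noteq> 0}}"

definition Lam :: "('g::discrete_group \<Rightarrow> 'a \<Rightarrow> 'a) \<Rightarrow> ('g \<Rightarrow> 'g \<Rightarrow> 'a::cstar_alg) \<Rightarrow> ('g \<Rightarrow> 'a) \<Rightarrow> ('g, 'a) op" where
  "Lam \<alpha> \<sigma> f = restr \<alpha> (\<lambda>\<xi> h. \<Sum>g\<in>{g. f g \<noteq> 0}. f g * lam \<alpha> \<sigma> g \<xi> h)"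

definition xi0 :: "'g::discrete_group \<Rightarrow> 'a::cstar_alg" where
  "xi0 = (\<lambda>g. if g = 1 then 1 else 0)"

definition hat :: "('g::discrete_group, 'a::cstar_alg) op \<Rightarrow> 'g \<Rightarrow> 'a" where
  "hat x = x xi0"

definition fourier_partial :: "('g::discrete_group \<Rightarrow> 'a \<Rightarrow> 'a) \<Rightarrow> ('g \<Rightarrow> 'g \<Rightarrow> 'a::cstar_alg) \<Rightarrow> ('g, 'a) op \<Rightarrow> 'g set \<Rightarrow> ('g, 'a) op" where
  "fourier_partial \<alpha> \<sigma> x F = restr \<alpha> (\<lambda>\<xi> h. \<Sum>g\<in>F. hat x g * lam \<alpha> \<sigma> g \<xi> h)"

definition CF :: "('g::discrete_group \<Rightarrow> 'a \<Rightarrow> 'a) \<Rightarrow> ('g \<Rightarrow> 'g \<Rightarrow> 'a::cstar_alg) \<Rightarrow> ('g, 'a) op set" where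
  "CF \<alpha> \<sigma> = {x \<in> Cr \<alpha> \<sigma>. \<forall>\<epsilon>>0. \<exists>F0. finite F0 \<and>
      (\<forall>F. finite F \<and> F0 \<subseteq> F \<longrightarrow> opnorm \<alpha> (op_diff (fourier_partial \<alpha> \<sigma> x F) x) < \<epsilon>)}"

definition mult_fun :: "('g \<Rightarrow> 'a \<Rightarrow> 'a) \<Rightarrow> ('g \<Rightarrow> 'a) \<Rightarrow> ('g \<Rightarrow> 'a)" where
  "mult_fun T f = (\<lambda>g. T g (f g))"

definition MA_map :: "('g::discrete_group \<Rightarrow> 'a \<Rightarrow> 'a) \<Rightarrow> ('g \<Rightarrow> 'g \<Rightarrow> 'a::cstar_alg)
    \<Rightarrow> ('g \<Rightarrow> 'a \<Rightarrow> 'a) \<Rightarrow> (('g, 'a) op \<Rightarrow> ('g, 'a) op) \<Rightarrow> bool" where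
  "MA_map \<alpha> \<sigma> T M \<longleftrightarrow>
     (\<forall>g x y. T g (x + y) = T g x + T g y) \<and> (\<forall>g c x. T g (scaleC c x) = scaleC c (T g x))
   \<and> (\<forall>x\<in>Cr \<alpha> \<sigma>. M x \<in> Cr \<alpha> \<sigma>)
   \<and> (\<forall>x\<in>Cr \<alpha> \<sigma>. \<forall>y\<in>Cr \<alpha> \<sigma>. M (op_add x y) = op_add (M x) (M y))
   \<and> (\<forall>c. \<forall>x\<in>Cr \<alpha> \<sigma>. M (op_scale c x) = op_scale c (M x))
   \<and> (\<exists>K. \<forall>x\<in>Cr \<alpha> \<sigma>. opnorm \<alpha> (M x) \<le> K * opnorm \<alpha> x)
   \<and> (\<forall>f\<in>Cc. M (Lam \<alpha> \<sigma> f) = Lam \<alpha> \<sigma> (mult_fun T f))"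

definition MA :: "('g::discrete_group \<Rightarrow> 'a \<Rightarrow> 'a) \<Rightarrow> ('g \<Rightarrow> 'g \<Rightarrow> 'a::cstar_alg) \<Rightarrow> ('g \<Rightarrow> 'a \<Rightarrow> 'a) set" where
  "MA \<alpha> \<sigma> = {T. \<exists>M. MA_map \<alpha> \<sigma> T M}"

text \<open>\<open>M_T\<close> (unique, since \<open>\<Lambda>(C_c(\<Sigma>))\<close> is dense in \<open>C_r^*(\<Sigma>)\<close>).\<close>
definition Mop :: "('g::discrete_group \<Rightarrow> 'a \<Rightarrow> 'a) \<Rightarrow> ('g \<Rightarrow> 'g \<Rightarrow> 'a::cstar_alg) \<Rightarrow> ('g \<Rightarrow> 'a \<Rightarrow> 'a) \<Rightarrow> ('g, 'a) op \<Rightarrow> ('g, 'a) op" where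
  "Mop \<alpha> \<sigma> T = (SOME M. MA_map \<alpha> \<sigma> T M)"

definition tnorm :: "('g::discrete_group \<Rightarrow> 'a \<Rightarrow> 'a) \<Rightarrow> ('g \<Rightarrow> 'g \<Rightarrow> 'a::cstar_alg) \<Rightarrow> ('g \<Rightarrow> 'a \<Rightarrow> 'a) \<Rightarrow> real" where
  "tnorm \<alpha> \<sigma> T = Sup {opnorm \<alpha> (Mop \<alpha> \<sigma> T x) | x. x \<in> Cr \<alpha> \<sigma> \<and> opnorm \<alpha> x \<le> 1}"

definition MCF :: "('g::discrete_group \<Rightarrow> 'a \<Rightarrow> 'a) \<Rightarrow> ('g \<Rightarrow> 'g \<Rightarrow> 'a::cstar_alg) \<Rightarrow> ('g \<Rightarrow> 'a \<Rightarrow> 'a) set" where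
  "MCF \<alpha> \<sigma> = {T \<in> MA \<alpha> \<sigma>. \<forall>x\<in>Cr \<alpha> \<sigma>. Mop \<alpha> \<sigma> T x \<in> CF \<alpha> \<sigma>}"

definition finite_G_support :: "('g \<Rightarrow> 'a::cstar_alg \<Rightarrow> 'a) \<Rightarrow> bool" where
  "finite_G_support T \<longleftrightarrow> finite {g. T g \<noteq> (\<lambda>_. 0)}"

text \<open>Bounded Fej\'er property. A net is encoded by the proper filter it generates on the
  set of multipliers (``eventually'' plays the role of ``for all indices beyond some index'').\<close>
definition bounded_fejer :: "('g::discrete_group \<Rightarrow> 'a \<Rightarrow> 'a) \<Rightarrow> ('g \<Rightarrow> 'g \<Rightarrow> 'a::cstar_alg) \<Rightarrow> bool" where
  "bounded_fejer \<alpha> \<sigma> \<longleftrightarrow> (\<exists>F :: ('g \<Rightarrow> 'a \<Rightarrow> 'a) filter. F \<noteq> bot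
     \<and> (\<forall>\<^sub>F T in F. T \<in> MCF \<alpha> \<sigma> \<and> finite_G_support T)
     \<and> (\<exists>K. \<forall>\<^sub>F T in F. tnorm \<alpha> \<sigma> T \<le> K)
     \<and> (\<forall>x\<in>Cr \<alpha> \<sigma>. ((\<lambda>T. opnorm \<alpha> (op_diff (Mop \<alpha> \<sigma> T x) x)) \<longlongrightarrow> 0) F))"

text \<open>\<open>C_r^*(G)\<close> on \<open>\<ell>^2(G)\<close>: the case \<open>A = \<complex>\<close>, trivial action and cocycle
  (then \<open>A^\<Sigma> = \<ell>^2(G)\<close> and \<open>\<lambda>\<^sub>\<Sigma> = \<lambda>\<close>).\<close>
definition triv_act :: "'g \<Rightarrow> complex \<Rightarrow> complex" where "triv_act = (\<lambda>_ z. z)"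
definition triv_coc :: "'g \<Rightarrow> 'g \<Rightarrow> complex" where "triv_coc = (\<lambda>_ _. 1)"

definition l2 :: "('g \<Rightarrow> complex) set" where "l2 = AS (triv_act :: 'g \<Rightarrow> complex \<Rightarrow> complex)"

definition CrG :: "('g::discrete_group, complex) op set" where "CrG = Cr triv_act triv_coc"

definition lamG :: "'g::discrete_group \<Rightarrow> ('g, complex) op" where "lamG g = lam triv_act triv_coc g"

definition vecnorm2 :: "nat \<Rightarrow> (nat \<Rightarrow> 'g \<Rightarrow> complex) \<Rightarrow> real" where
  "vecnorm2 n \<xi> = (\<Sum>i<n. infsum (\<lambda>g. (cmod (\<xi> i g))\<^sup>2) UNIV)"

definition matapp :: "nat \<Rightarrow> (nat \<Rightarrow> nat \<Rightarrow> ('g, complex) op) \<Rightarrow> (nat \<Rightarrow> 'g \<Rightarrow> complex) \<Rightarrow> (nat \<Rightarrow> 'g \<Rightarrow> complex)" where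
  "matapp n X \<xi> = (\<lambda>i g. \<Sum>j<n. X i j (\<xi> j) g)"

definition matnorm :: "nat \<Rightarrow> (nat \<Rightarrow> nat \<Rightarrow> ('g, complex) op) \<Rightarrow> real" where
  "matnorm n X = Sup {sqrt (vecnorm2 n (matapp n X \<xi>)) | \<xi>. (\<forall>i<n. \<xi> i \<in> l2) \<and> vecnorm2 n \<xi> \<le> 1}"

definition cb_mult :: "('g::discrete_group \<Rightarrow> complex) \<Rightarrow> (('g, complex) op \<Rightarrow> ('g, complex) op) \<Rightarrow> real \<Rightarrow> bool" where
  "cb_mult \<phi> M K \<longleftrightarrow>
     (\<forall>x\<in>CrG. M x \<in> CrG)
   \<and> (\<forall>x\<in>CrG. \<forall>y\<in>CrG. M (op_add x y) = op_add (M x) (M y))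
   \<and> (\<forall>c. \<forall>x\<in>CrG. M (op_scale c x) = op_scale c (M x))
   \<and> (\<forall>g. M (lamG g) = op_scale (\<phi> g) (lamG g))
   \<and> (\<forall>n X. (\<forall>i<n. \<forall>j<n. X i j \<in> CrG) \<longrightarrow> matnorm n (\<lambda>i j. M (X i j)) \<le> K * matnorm n X)"

definition weakly_amenable :: "'g::discrete_group itself \<Rightarrow> bool" where
  "weakly_amenable _ \<longleftrightarrow> (\<exists>F :: ('g \<Rightarrow> complex) filter. F \<noteq> bot
     \<and> (\<exists>K. \<forall>\<^sub>F \<phi> in F. finite {g. \<phi> g \<noteq> 0} \<and> (\<exists>M. cb_mult \<phi> M K))
     \<and> (\<forall>g. ((\<lambda>\<phi>. \<phi> g) \<longlongrightarrow> 1) F))"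

end

theory Submission
  imports Defs
begin

text \<open>For a finitely supported completely bounded multiplier \<open>\<phi>\<close> of \<open>G\<close> the map
  \<open>\<Lambda>\<^sub>\<Sigma>(f) \<mapsto> \<Lambda>\<^sub>\<Sigma>(\<phi> f)\<close> extends to \<open>x \<mapsto> \<Lambda>\<^sub>\<Sigma>(\<phi> \<cdot> hat x)\<close>, and the point is that its norm is at most
  the completely bounded norm \<open>K\<close> of \<open>\<phi>\<close>. After the unitary change of coordinates
  \<open>\<zeta>(g) = \<alpha>\<^sub>g\<inverse>(\<xi>(g))\<close> the operator \<open>\<Lambda>\<^sub>\<Sigma>(f)\<close> is a matrix \<open>(x\<^sub>h\<^sub>k)\<close> over \<open>A\<close>, and multiplication of \<open>f\<close> by
  \<open>\<phi>\<close> becomes the Schur multiplication \<open>x\<^sub>h\<^sub>k \<mapsto> \<phi>(h k\<inverse>) x\<^sub>h\<^sub>k\<close>. The norm of a vector of the module is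
  attained by a state, whose GNS space, compressed to a finite-dimensional subspace, replaces \<open>A\<close> by
  a full matrix algebra. For scalar matrices the bound follows by applying \<open>id \<otimes> M\<^sub>\<phi>\<close> to
  \<open>(x\<^sub>h\<^sub>k \<lambda>(h k\<inverse>))\<close>, which is unitarily equivalent to \<open>(x\<^sub>h\<^sub>k) \<otimes> 1\<close>. Density of \<open>\<Lambda>\<^sub>\<Sigma>(C\<^sub>c(\<Sigma>))\<close> then gives
  \<open>M\<^sub>\<phi>(x) \<rightarrow> x\<close> along a bounded net with \<open>\<phi> \<rightarrow> 1\<close> pointwise.\<close>

section \<open>Positive elements of a C*-algebra\<close>

text \<open>A norm bound on the module controls only the largest value over all states, while the
  Schur step needs the bound under one fixed state on both sides, namely the state that attains the
  norm of the output. \<open>cstate_hip_operator_le\<close> supplies this and is the bridge from the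
  \<open>A\<close>-valued norm to scalar matrices. The Schur bound is applied with pairs (group
  element, basis index) as indices, so the matrix size grows with the compressed space; hence the
  bound must be uniform over all matrix sizes, and this is where complete boundedness enters.
  Positivity is developed from norm estimates: positive means selfadjoint and within distance t of
  t, and a power series for the square root takes the place of the spectrum. Adjointable operators
  carry no boundedness assumption, and \<open>opnorm\<close> is a supremum that says nothing about
  an unbounded set; hence the uniform boundedness principle, and the completeness of the module that
  it requires. The sign of \<open>K\<close> is not part of \<open>cb_mult\<close>, hence |K| in the
  estimates.\<close>

lemma scaleC_zero_right [simp]: "scaleC c (0::'a::cstar_alg) = 0"
  using scaleC_add_right[of c 0 "0::'a"] by simp

lemma scaleC_zero_left [simp]: "scaleC 0 (x::'a::cstar_alg) = 0"
  using scaleC_add_left[of 0 0 x] by simp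

lemma scaleC_one [simp]: "scaleC 1 (x::'a::cstar_alg) = x"
  using scaleC_of_real[of 1 x] by simp

lemma scaleC_uminus_right: "scaleC c (- x::'a::cstar_alg) = - scaleC c x"
  using scaleC_add_right[of c x "-x"] by (simp add: eq_neg_iff_add_eq_0 add.commute)

lemma scaleC_uminus_left: "scaleC (- c) (x::'a::cstar_alg) = - scaleC c x"
  using scaleC_add_left[of c "- c" x] by (simp add: eq_neg_iff_add_eq_0 add.commute)

lemma scaleC_diff_right: "scaleC c (x - y::'a::cstar_alg) = scaleC c x - scaleC c y"
  using scaleC_add_right[of c x "- y"] by (simp add: scaleC_uminus_right)

lemma scaleC_scaleR: "scaleC c (r *\<^sub>R (x::'a::cstar_alg)) = r *\<^sub>R scaleC c x"
  by (simp add: scaleC_of_real[symmetric] scaleC_scaleC mult.commute)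

lemma bounded_linear_scaleC: "bounded_linear (scaleC c :: 'a::cstar_alg \<Rightarrow> 'a)"
  by (rule bounded_linear_intro[where K="cmod c"])
    (auto simp: scaleC_add_right scaleC_scaleR norm_scaleC mult.commute)

lemma scaleC_sum_right: "scaleC c (\<Sum>i\<in>I. f i) = (\<Sum>i\<in>I. scaleC c (f i :: 'a::cstar_alg))"
  by (induction I rule: infinite_finite_induct) (auto simp: scaleC_add_right)

lemma cstar_zero [simp]: "cstar (0::'a::cstar_alg) = 0"
  using cstar_add[of 0 "0::'a"] by simp

lemma cstar_uminus: "cstar (- x::'a::cstar_alg) = - cstar x"
  using cstar_add[of x "-x"] by (simp add: eq_neg_iff_add_eq_0 add.commute)

lemma cstar_diff: "cstar (x - y::'a::cstar_alg) = cstar x - cstar y"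
  using cstar_add[of x "- y"] by (simp add: cstar_uminus)

lemma cstar_scaleR: "cstar (r *\<^sub>R (x::'a::cstar_alg)) = r *\<^sub>R cstar x"
  by (metis cstar_scaleC scaleC_of_real complex_cnj_complex_of_real)

lemma cstar_one [simp]: "cstar (1::'a::cstar_alg) = 1"
  by (metis cstar_cstar cstar_mult mult.left_neutral mult.right_neutral)

lemma cstar_of_real [simp]: "cstar (of_real r::'a::cstar_alg) = of_real r"
  by (simp add: of_real_def cstar_scaleR)

lemma norm_cstar [simp]: "norm (cstar (x::'a::cstar_alg)) = norm x"
proof -
  have le: "norm y \<le> norm (cstar y)" for y :: 'a
  proof (cases "norm y = 0")
    case False
    have "norm y * norm y \<le> norm (cstar y) * norm y"
      using norm_mult_ineq[of "cstar y" y] by (simp add: cstar_identity power2_eq_square)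
    then show ?thesis using False by (simp add: mult_le_cancel_right)
  qed auto
  show ?thesis using le[of x] le[of "cstar x"] by (simp add: cstar_cstar)
qed

lemma bounded_linear_cstar: "bounded_linear (cstar :: 'a::cstar_alg \<Rightarrow> 'a)"
  by (rule bounded_linear_intro[where K=1]) (auto simp: cstar_add cstar_scaleR)

abbreviation csq :: "'a::cstar_alg \<Rightarrow> 'a" where "csq a \<equiv> cstar a * a"

abbreviation finsupp :: "('g \<Rightarrow> 'b::zero) \<Rightarrow> bool" where "finsupp f \<equiv> finite {g. f g \<noteq> 0}"

section \<open>Norms of selfadjoint elements\<close>

lemma norm_square_selfadjoint:
  fixes k :: "'a::cstar_alg"
  assumes "cstar k = k" shows "norm (k * k) = (norm k)\<^sup>2"
  using cstar_identity[of k] assms by simp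

lemma square_selfadjoint_eq_0_iff:
  fixes k :: "'a::cstar_alg"
  assumes "cstar k = k" shows "k * k = 0 \<longleftrightarrow> k = 0"
  using norm_square_selfadjoint[OF assms] by auto

lemma cstar_mult_self_eq_0_iff: "cstar x * x = 0 \<longleftrightarrow> (x::'a::cstar_alg) = 0"
  using cstar_identity[of x] by (metis norm_eq_zero mult_zero_right power2_eq_square mult_eq_0_iff)

text \<open>With u = k + i m the commutation gives \<open>csq u\<close> = k^2 + m^2, while k is the
  real part of u and so is no longer than u. This is the basic comparison of norms on which
  positivity rests.\<close>

lemma norm_commuting_selfadjoint_le:
  fixes k m :: "'a::cstar_alg"
  assumes k: "cstar k = k" and m: "cstar m = m" and comm: "k * m = m * k"
  shows "(norm k)\<^sup>2 \<le> norm (k * k + m * m)"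
proof -
  define u where "u = k + scaleC \<i> m"
  have us: "cstar u = k - scaleC \<i> m"
    by (simp add: u_def cstar_add cstar_scaleC k m scaleC_uminus_left)
  have "cstar u * u = k * k + m * m"
    unfolding us unfolding u_def
    by (simp add: algebra_simps scaleC_mult_left scaleC_mult_right scaleC_scaleC comm scaleC_uminus_left scaleC_diff_right)
  then have nu: "(norm u)\<^sup>2 = norm (k * k + m * m)" by (simp add: cstar_identity[symmetric])
  have "2 *\<^sub>R k = u + cstar u" unfolding us by (simp add: u_def scaleR_2)
  then have "2 * norm k = norm (u + cstar u)" by (metis norm_scaleR abs_numeral)
  also have "\<dots> \<le> 2 * norm u" using norm_triangle_ineq[of u "cstar u"] by simp
  finally have "norm k \<le> norm u" by simp
  then have "(norm k)\<^sup>2 \<le> (norm u)\<^sup>2" by (simp add: power_mono)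
  then show ?thesis by (simp add: nu)
qed

text \<open>The coefficients of the power series of \<open>1 - sqrt (1 - x)\<close>: they are nonnegative with sum
  at most 1, so the series makes sense on the whole closed unit ball.\<close>

function sqrt_coeff :: "nat \<Rightarrow> real" where
  "sqrt_coeff n = (if n = 0 then 0 else if n = 1 then 1/2
     else (\<Sum>i\<in>{1..<n}. sqrt_coeff i * sqrt_coeff (n - i)) / 2)"
  by auto
termination by (relation "Wellfounded.measure id") auto

declare sqrt_coeff.simps [simp del]

lemma sqrt_coeff_nonneg: "sqrt_coeff n \<ge> 0"
proof (induction n rule: less_induct)
  case (less n)
  then show ?case by (subst sqrt_coeff.simps) (auto intro!: sum_nonneg mult_nonneg_nonneg)
qed

lemma sqrt_coeff_0 [simp]: "sqrt_coeff 0 = 0" by (simp add: sqrt_coeff.simps)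
lemma sqrt_coeff_1 [simp]: "sqrt_coeff (Suc 0) = 1/2" by (simp add: sqrt_coeff.simps)

text \<open>Coefficient form of S^2 = 2 S - x for S = 1 - sqrt (1 - x); the correction at n = 1 is
  the term x.\<close>

lemma sqrt_coeff_convolution:
  "(\<Sum>i\<le>n. sqrt_coeff i * sqrt_coeff (n - i)) = 2 * sqrt_coeff n - (if n = 1 then 1 else 0)"
proof (cases "n \<le> 1")
  case True
  then have "n = 0 \<or> n = 1" by auto
  then show ?thesis by auto
next
  case False
  have "{..n} = insert 0 (insert n {1..<n})" using False by auto
  then have "(\<Sum>i\<le>n. sqrt_coeff i * sqrt_coeff (n - i)) = (\<Sum>i\<in>{1..<n}. sqrt_coeff i * sqrt_coeff (n - i))"
    using False by simp
  also have "\<dots> = 2 * sqrt_coeff n" using False by (subst (3) sqrt_coeff.simps) simp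
  finally show ?thesis using False by simp
qed

text \<open>Write s_n for the sum of the first n coefficients. For n > 1 the convolution identity
  gives 2 s_(n+1) = 1 + (sum of the products over i + j <= n), and since the coefficient at 0
  vanishes, the nonzero products lie in the square i, j < n. Hence 2 s_(n+1) <= 1 + s_n^2 <= 2 by
  induction.\<close>

lemma sum_sqrt_coeff_le_1: "(\<Sum>i<n. sqrt_coeff i) \<le> 1"
proof (induction n)
  case (Suc n)
  show ?case
  proof (cases "n \<le> 1")
    case True
    then have "n = 0 \<or> n = 1" by auto
    then show ?thesis by (auto simp: numeral_eq_Suc)
  next
    case False
    have "2 * (\<Sum>i\<le>n. sqrt_coeff i) = (\<Sum>k\<le>n. (\<Sum>i\<le>k. sqrt_coeff i * sqrt_coeff (k - i)) + (if k = 1 then 1 else 0))"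
      by (simp add: sqrt_coeff_convolution sum_distrib_left)
    also have "\<dots> = (\<Sum>k\<le>n. \<Sum>i\<le>k. sqrt_coeff i * sqrt_coeff (k - i)) + 1"
      using False by (simp add: sum.distrib)
    also have "(\<Sum>k\<le>n. \<Sum>i\<le>k. sqrt_coeff i * sqrt_coeff (k - i)) = (\<Sum>(i, j)\<in>{(i, j). i + j \<le> n}. sqrt_coeff i * sqrt_coeff j)"
      using sum.triangle_reindex_eq[of "\<lambda>i j. sqrt_coeff i * sqrt_coeff j" n] by simp
    also have "\<dots> \<le> (\<Sum>(i, j)\<in>{..<n} \<times> {..<n}. sqrt_coeff i * sqrt_coeff j)"
    proof -
      have "(\<Sum>(i, j)\<in>{(i, j). i + j \<le> n}. sqrt_coeff i * sqrt_coeff j)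
          = (\<Sum>(i, j)\<in>{(i, j). i + j \<le> n \<and> i < n \<and> j < n}. sqrt_coeff i * sqrt_coeff j)"
      proof (rule sum.mono_neutral_right)
        show "finite {(i, j). i + j \<le> n}" by (rule finite_subset[of _ "{..n} \<times> {..n}"]) auto
        have "i = 0 \<or> j = 0" if "i + j \<le> n" "\<not> (i < n \<and> j < n)" for i j using that by linarith
        then show "\<forall>p\<in>{(i, j). i + j \<le> n} - {(i, j). i + j \<le> n \<and> i < n \<and> j < n}.
            (case p of (i, j) \<Rightarrow> sqrt_coeff i * sqrt_coeff j) = 0"
          by fastforce
      qed auto
      also have "\<dots> \<le> (\<Sum>(i, j)\<in>{..<n} \<times> {..<n}. sqrt_coeff i * sqrt_coeff j)"
        by (rule sum_mono2) (auto simp: sqrt_coeff_nonneg)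
      finally show ?thesis .
    qed
    also have "\<dots> = (\<Sum>i<n. sqrt_coeff i) * (\<Sum>i<n. sqrt_coeff i)"
      by (simp add: sum_product sum.cartesian_product)
    also have "\<dots> \<le> 1"
      using Suc sum_nonneg[of "{..<n}" sqrt_coeff] sqrt_coeff_nonneg by (metis mult_le_one)
    finally show ?thesis by (simp add: lessThan_Suc_atMost)
  qed
qed simp

lemma summable_sqrt_coeff: "summable sqrt_coeff"
  by (rule summableI_nonneg_bounded[where x=1]) (auto simp: sqrt_coeff_nonneg sum_sqrt_coeff_le_1)

text \<open>r = 1 - S with S the series at h, which converges absolutely because the coefficients
  are summable and the powers of h stay in the unit ball. As a limit of polynomials in h it commutes
  with all that commutes with h, and the bound on \<open>1 - r\<close> is later the witness for
  positivity of r.\<close>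

lemma exists_sqrt_one_minus:
  fixes h :: "'a::cstar_alg"
  assumes "cstar h = h" and nh: "norm h \<le> 1"
  obtains r where "cstar r = r" "r * r = 1 - h" "norm (1 - r) \<le> 1" "\<forall>x. x * h = h * x \<longrightarrow> x * r = r * x"
proof -
  define f where "f = (\<lambda>n. sqrt_coeff n *\<^sub>R h ^ n)"
  have nf: "norm (f n) \<le> sqrt_coeff n" for n
  proof -
    have "norm (h ^ n) \<le> 1"
      by (meson norm_power_ineq order_trans nh norm_ge_zero power_le_one)
    then show ?thesis using sqrt_coeff_nonneg[of n] by (simp add: f_def mult_left_le)
  qed
  have sn: "summable (\<lambda>n. norm (f n))"
    by (rule summable_comparison_test'[OF summable_sqrt_coeff, of 0]) (use nf in auto)
  then have sf: "summable f" by (rule summable_norm_cancel)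
  define S where "S = suminf f"
  have "norm S \<le> (\<Sum>n. norm (f n))" unfolding S_def by (rule summable_norm[OF sn])
  also have "\<dots> \<le> suminf sqrt_coeff" by (rule suminf_le[OF nf sn summable_sqrt_coeff])
  also have "\<dots> \<le> 1" by (rule suminf_le_const[OF summable_sqrt_coeff]) (rule sum_sqrt_coeff_le_1)
  finally have nS: "norm S \<le> 1" .
  have fS: "f sums S" unfolding S_def by (rule summable_sums[OF sf])
  have "(\<lambda>n. \<Sum>i\<le>n. f i * f (n - i)) sums (S * S)"
    unfolding S_def by (rule Cauchy_product_sums[OF sn sn])
  moreover have "(\<Sum>i\<le>n. f i * f (n - i)) = 2 *\<^sub>R f n - (if n = 1 then h else 0)" for n
  proof -
    have "(\<Sum>i\<le>n. f i * f (n - i)) = (\<Sum>i\<le>n. sqrt_coeff i * sqrt_coeff (n - i)) *\<^sub>R h ^ n"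
      unfolding scaleR_sum_left by (rule sum.cong) (auto simp: f_def power_add[symmetric])
    then show ?thesis by (simp add: sqrt_coeff_convolution f_def scaleR_left_diff_distrib)
  qed
  ultimately have "(\<lambda>n. 2 *\<^sub>R f n - (if n = 1 then h else 0)) sums (S * S)" by simp
  moreover have "(\<lambda>n. 2 *\<^sub>R f n - (if n = 1 then h else 0)) sums (2 *\<^sub>R S - h)"
    by (intro sums_diff sums_scaleR_right fS) (use sums_single[of 1 "\<lambda>_. h"] in \<open>simp\<close>)
  ultimately have SS: "S * S = 2 *\<^sub>R S - h" by (rule sums_unique2)
  have hp: "cstar (h ^ n) = h ^ n" for n
    by (induction n) (auto simp: cstar_mult assms power_commutes)
  have "(\<lambda>n. cstar (f n)) sums cstar S"
    by (rule bounded_linear.sums[OF bounded_linear_cstar fS])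
  then have cS: "cstar S = S" using fS sums_unique2 by (simp add: f_def cstar_scaleR hp) 
  have comm: "x * S = S * x" if "x * h = h * x" for x
  proof -
    have "x * h ^ n = h ^ n * x" for n
      by (induction n) (auto simp: algebra_simps, metis that mult.assoc)
    then have "(\<lambda>n. x * f n) = (\<lambda>n. f n * x)" by (simp add: f_def)
    moreover have "(\<lambda>n. x * f n) sums (x * S)" "(\<lambda>n. f n * x) sums (S * x)"
      by (rule bounded_linear.sums[OF bounded_linear_mult_right fS], rule bounded_linear.sums[OF bounded_linear_mult_left fS])
    ultimately show ?thesis using sums_unique2 by metis
  qed
  show thesis
  proof (rule that[of "1 - S"])
    show "cstar (1 - S) = 1 - S" by (simp add: cstar_diff cS)
    show "(1 - S) * (1 - S) = 1 - h" by (simp add: algebra_simps SS scaleR_2)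
    show "norm (1 - (1 - S)) \<le> 1" using nS by simp
    show "\<forall>x. x * h = h * x \<longrightarrow> x * (1 - S) = (1 - S) * x"
      using comm by (simp add: algebra_simps)
  qed
qed

text \<open>Selfadjoint and within distance t of t describes a spectrum in [0, 2 t]. The existential
  t makes sums and multiples easy; \<open>cpos_iff_norm\<close> later fixes it to
  \<open>norm a\<close>, which gives a closed condition.\<close>

definition cpos :: "'a::cstar_alg \<Rightarrow> bool" where
  "cpos a \<longleftrightarrow> cstar a = a \<and> (\<exists>t. norm (of_real t - a) \<le> t)"

lemma cposI: "cstar a = a \<Longrightarrow> norm (of_real t - a) \<le> t \<Longrightarrow> cpos a"
  unfolding cpos_def by blast

lemma cpos_zero [simp]: "cpos 0"
  unfolding cpos_def by (auto intro: exI[of _ 0])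

lemma cpos_add: "cpos a \<Longrightarrow> cpos b \<Longrightarrow> cpos (a + b)"
proof -
  assume a: "cpos a" and b: "cpos b"
  then obtain s t where st: "norm (of_real s - a) \<le> s" "norm (of_real t - b) \<le> t" by (auto simp: cpos_def)
  have "norm (of_real (s + t) - (a + b)) \<le> s + t"
    using norm_triangle_ineq[of "of_real s - a" "of_real t - b"] st by (simp add: algebra_simps)
  then show ?thesis by (rule cposI[rotated]) (use a b in \<open>simp add: cpos_def cstar_add\<close>)
qed

lemma cpos_sum: "(\<And>i. i \<in> I \<Longrightarrow> cpos (f i)) \<Longrightarrow> cpos (\<Sum>i\<in>I. f i)"
  by (induction I rule: infinite_finite_induct) (auto intro: cpos_add)

lemma cpos_scaleR: 
  fixes a :: "'a::cstar_alg"
  assumes "cpos a" "r \<ge> 0" shows "cpos (r *\<^sub>R a)"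
proof -
  obtain t where t: "norm (of_real t - a) \<le> t" using assms by (auto simp: cpos_def)
  have "of_real (r * t) - r *\<^sub>R a = r *\<^sub>R (of_real t - a)"
    by (simp add: of_real_def scaleR_right_diff_distrib)
  then have "norm (of_real (r * t) - r *\<^sub>R a) \<le> r * t"
    using t assms(2) by (simp add: mult_left_mono)
  then show ?thesis by (rule cposI[rotated]) (use assms in \<open>simp add: cpos_def cstar_scaleR\<close>)
qed

lemma cpos_norm_minus: "cstar a = a \<Longrightarrow> cpos (of_real (norm a) - a)"
  by (rule cposI[where t="norm a"]) (auto simp: cstar_diff)

text \<open>For t > 0 one has a / t = 1 - h with \<open>norm h\<close> <= 1, so the power series
  applies; t = 0 forces a = 0.\<close>

lemma cpos_sqrt:
  fixes a :: "'a::cstar_alg"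
  assumes "cpos a"
  obtains r where "cpos r" "r * r = a" "\<forall>x. x * a = a * x \<longrightarrow> x * r = r * x"
proof -
  obtain t where t: "norm (of_real t - a) \<le> t" using assms by (auto simp: cpos_def)
  then have t0: "t \<ge> 0" by (meson norm_ge_zero order_trans)
  show thesis
  proof (cases "t = 0")
    case True
    then have "a = 0" using t by simp
    then show ?thesis using that[of 0] by simp
  next
    case False
    then have tp: "t > 0" using t0 by simp
    define h where "h = 1 - (1 / t) *\<^sub>R a"
    have "h = (1/t) *\<^sub>R (of_real t - a)" using tp by (simp add: h_def of_real_def algebra_simps)
    then have "norm h \<le> 1" using t tp by (simp add: divide_simps)
    moreover have "cstar h = h" using assms by (simp add: h_def cstar_diff cstar_scaleR cpos_def)
    ultimately obtain r where r: "cstar r = r" "r * r = 1 - h" "norm (1 - r) \<le> 1" "\<forall>x. x * h = h * x \<longrightarrow> x * r = r * x"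
      using exists_sqrt_one_minus by blast
    have "cpos r" by (rule cposI[where t=1]) (use r(1,3) in auto)
    show ?thesis
    proof (rule that[of "sqrt t *\<^sub>R r"])
      show "cpos (sqrt t *\<^sub>R r)" using \<open>cpos r\<close> t0 by (simp add: cpos_scaleR)
      have "sqrt t * sqrt t = t" using t0 by simp
      then show "(sqrt t *\<^sub>R r) * (sqrt t *\<^sub>R r) = a" using tp by (simp add: r(2) h_def)
      show "\<forall>x. x * a = a * x \<longrightarrow> x * sqrt t *\<^sub>R r = sqrt t *\<^sub>R r * x"
      proof (intro allI impI)
        fix x assume that: "x * a = a * x"
        have "x * h = h * x" using that by (simp add: h_def algebra_simps)
        then show "x * sqrt t *\<^sub>R r = sqrt t *\<^sub>R r * x" using r(4) by simp
      qed
    qed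
  qed
qed

text \<open>Scale k to norm 1 and take m with m^2 = 1 - k^2. Since m commutes with k,
  \<open>norm_commuting_selfadjoint_le\<close> bounds \<open>norm (m * m)\<close> by the norm of m^2
  + k^2 = 1.\<close>

lemma cpos_square_norm:
  fixes k :: "'a::cstar_alg"
  assumes k: "cstar k = k"
  shows "norm (of_real ((norm k)\<^sup>2) - k * k) \<le> (norm k)\<^sup>2"
proof (cases "k = 0")
  case False
  define n where "n = norm k"
  have np: "n > 0" using False by (simp add: n_def)
  define k' where "k' = (1 / n) *\<^sub>R k"
  have k': "cstar k' = k'" by (simp add: k'_def cstar_scaleR k)
  have "norm k' = 1" using np by (simp add: k'_def n_def)
  then have "norm (k' * k') \<le> 1" by (simp add: norm_square_selfadjoint[OF k'])
  moreover have "cstar (k' * k') = k' * k'" by (simp add: cstar_mult k')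
  ultimately obtain m where m: "cstar m = m" "m * m = 1 - k' * k'" "\<forall>x. x * (k' * k') = (k' * k') * x \<longrightarrow> x * m = m * x"
    using exists_sqrt_one_minus by blast
  have "m * k' = k' * m" using m(3)[rule_format, of k'] by (simp add: mult.assoc)
  from norm_commuting_selfadjoint_le[OF m(1) k' this] have "norm (m * m) \<le> 1"
    unfolding norm_square_selfadjoint[OF m(1)] by (simp add: m(2))
  moreover have "of_real (n\<^sup>2) - k * k = n\<^sup>2 *\<^sub>R (m * m)"
    using np by (simp add: m(2) k'_def of_real_def algebra_simps power2_eq_square)
  ultimately have "norm (of_real (n\<^sup>2) - k * k) \<le> n\<^sup>2 * 1"
    using np by (simp add: mult_left_le)
  then show ?thesis by (simp add: n_def)
qed simp

lemma cpos_square: "cstar k = k \<Longrightarrow> cpos (k * k)"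
  by (rule cposI[OF _ cpos_square_norm]) (auto simp: cstar_mult)

text \<open>Every positive a is a square r^2, and \<open>cpos_square_norm\<close> gives the witness
  (norm r)^2, which is \<open>norm a\<close>.\<close>

lemma cpos_iff_norm: "cpos a \<longleftrightarrow> cstar a = a \<and> norm (of_real (norm a) - a) \<le> norm a"
proof
  assume a: "cpos a"
  then obtain r where r: "cpos r" "r * r = a" by (rule cpos_sqrt)
  then have "norm a = (norm r)\<^sup>2" using norm_square_selfadjoint[of r] by (auto simp: cpos_def)
  then show "cstar a = a \<and> norm (of_real (norm a) - a) \<le> norm a"
    using a r cpos_square_norm[of r] by (auto simp: cpos_def)
qed (auto simp: cpos_def)

lemma closed_cpos: "closed {a::'a::cstar_alg. cpos a}"
proof -
  have c: "continuous_on UNIV (cstar :: 'a \<Rightarrow> 'a)"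
    by (rule linear_continuous_on[OF bounded_linear_cstar])
  have "{a::'a. cpos a} = {a. cstar a = a} \<inter> {a. norm (of_real (norm a) - a) \<le> norm a}"
    by (auto simp: cpos_iff_norm)
  also have "closed \<dots>"
    by (intro closed_Int closed_Collect_eq closed_Collect_le c continuous_intros)
  finally show ?thesis .
qed

text \<open>The square roots of commuting positive elements commute, because each root commutes with
  everything its square commutes with; so the comparison for commuting selfadjoint elements
  applies.\<close>

lemma cpos_norm_le_add:
  fixes a b :: "'a::cstar_alg"
  assumes "cpos a" "cpos b" "a * b = b * a"
  shows "norm a \<le> norm (a + b)"
proof -
  obtain k where k: "cpos k" "k * k = a" "\<forall>x. x * a = a * x \<longrightarrow> x * k = k * x" using cpos_sqrt[OF assms(1)] by blast
  obtain m where m: "cpos m" "m * m = b" "\<forall>x. x * b = b * x \<longrightarrow> x * m = m * x" using cpos_sqrt[OF assms(2)] by blast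
  have "a * m = m * a" using m(3) assms(3) by blast
  then have "m * k = k * m" using k(3) by simp
  then show ?thesis
    using norm_commuting_selfadjoint_le[of k m] k(1,2) m(1,2) norm_square_selfadjoint[of k] by (auto simp: cpos_def)
qed

lemma cpos_antisym:
  fixes a :: "'a::cstar_alg"
  assumes "cpos a" "cpos (- a)" shows "a = 0"
  using cpos_norm_le_add[OF assms] by simp

text \<open>a commutes with r - a, so its norm is at most that of their sum, which is |r|. A
  negative r is impossible: r would be positive as a sum, and so would -r.\<close>

lemma cpos_le_of_real: 
  fixes a :: "'a::cstar_alg"
  assumes "cpos a" "cpos (of_real r - a)" shows "norm a \<le> r"
proof -
  have *: "norm a \<le> \<bar>r\<bar>"
    using cpos_norm_le_add[OF assms] by (simp add: algebra_simps of_real_def)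
  have "r \<ge> 0"
  proof (rule ccontr)
    assume "\<not> r \<ge> 0"
    have "cpos (1 * 1 :: 'a)" by (rule cpos_square) simp
    then have "cpos ((-r) *\<^sub>R 1 :: 'a)" using \<open>\<not> r \<ge> 0\<close> by (intro cpos_scaleR) auto
    moreover have "cpos (of_real r :: 'a)" using cpos_add[OF assms] by simp
    ultimately have "(of_real r :: 'a) = 0" by (intro cpos_antisym) (auto simp: of_real_def)
    then show False using \<open>\<not> r \<ge> 0\<close> by simp
  qed
  then show ?thesis using * by simp
qed

text \<open>Noncommuting a and b are compared through the scalar \<open>norm b\<close>, which
  dominates b and hence a, and which commutes with a.\<close>

lemma cpos_mono_norm:
  assumes "cpos a" "cpos (b - a)" shows "norm a \<le> norm b"
proof (rule cpos_le_of_real[OF assms(1)])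
  have "cstar b = b" using assms cstar_add[of a "b - a"] by (simp add: cpos_def)
  from cpos_add[OF cpos_norm_minus[OF this] assms(2)] show "cpos (of_real (norm b) - a)" by simp
qed

lemma cpos_cube: 
  fixes n :: "'a::cstar_alg"
  assumes "cpos n" shows "cpos (n * n * n)"
proof -
  obtain s where s: "cpos s" "s * s = n" using cpos_sqrt[OF assms] by blast
  have "n * n * n = (n * s) * (n * s)" by (metis s(2) mult.assoc)
  moreover have "cstar (n * s) = n * s"
    using s assms by (simp add: cstar_mult cpos_def) (metis mult.assoc)
  ultimately show ?thesis using cpos_square by metis
qed

text \<open>With d = u - v the elements d u d and d v d are positive and add up to (u^2 - v^2) d =
  0, so both vanish. Then d^3 = d (u - v) d = 0, and the C*-identity gives d = 0.\<close>

lemma cpos_sqrt_unique: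
  fixes u v :: "'a::cstar_alg"
  assumes u: "cpos u" and v: "cpos v" and uv: "u * v = v * u" and sq: "u * u = v * v"
  shows "u = v"
proof -
  define d where "d = u - v"
  have sd: "cstar d = d" using u v by (simp add: d_def cstar_diff cpos_def)
  have *: "cpos (d * w * d)" if w: "cpos w" and wd: "d * w = w * d" for w
  proof -
    obtain s where s: "cpos s" "s * s = w" "\<forall>x. x * w = w * x \<longrightarrow> x * s = s * x"
      using cpos_sqrt[OF w] by blast
    have ds: "d * s = s * d" using s(3) wd by blast
    have "d * w * d = (d * s) * (s * d)" by (metis s(2) mult.assoc)
    then have "d * w * d = (d * s) * (d * s)" by (simp add: ds)
    moreover have "cstar (d * s) = d * s" using s(1) ds by (simp add: cstar_mult sd cpos_def)
    ultimately show ?thesis using cpos_square by metis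
  qed
  have du: "d * u = u * d" and dv: "d * v = v * d" using uv by (simp_all add: d_def algebra_simps)
  have "d * u * d + d * v * d = (u * u - v * v) * d"
    using uv by (simp add: d_def algebra_simps)
  then have z: "d * v * d = - (d * u * d)" using sq by (simp add: add_eq_0_iff)
  have "d * u * d = 0" using *[OF u du] *[OF v dv] unfolding z by (rule cpos_antisym)
  then have "d * (u - v) * d = 0" using z by (simp add: algebra_simps)
  then have "(d * d) * (d * d) = 0" by (simp add: d_def[symmetric] mult.assoc[symmetric])
  then have "d = 0" using square_selfadjoint_eq_0_iff[of "d * d"] square_selfadjoint_eq_0_iff[OF sd]
    by (simp add: cstar_mult sd)
  then show ?thesis by (simp add: d_def)
qed

section \<open>Negative parts and the positivity of \<open>cstar a * a\<close>\<close>

lemma square_mult_commute: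
  fixes x y :: "'a::semigroup_mult"
  assumes "x * y = y * x" shows "(x * y) * (x * y) = (x * x) * (y * y)"
  by (metis assms mult.assoc)

text \<open>With |b| the root of b^2 the witness is n = |b| - b, twice the usual negative part,
  which explains n^2 = -2 b n. To see that n is positive, let p = |b| + b, so that p n = 0, and take
  the roots q of p^2 and r of n^2. The products p r, n q and q r vanish, so q + r and p + n = 2 |b|
  are positive roots of the same element; uniqueness gives p + n = q + r, and then p = q and n =
  r.\<close>

lemma negative_part:
  fixes b :: "'a::cstar_alg"
  assumes b: "cstar b = b"
  obtains n where "cpos n" "cpos (b + n)" "b * n = n * b" "n * n = - (2 *\<^sub>R (b * n))"
proof -
  obtain k where k: "cpos k" "k * k = b * b" "\<forall>x. x * (b * b) = (b * b) * x \<longrightarrow> x * k = k * x"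
    using cpos_sqrt[OF cpos_square[OF b]] by blast
  have bk: "b * k = k * b" using k(3) by (simp add: mult.assoc)
  have sk: "cstar k = k" using k(1) by (simp add: cpos_def)
  define p where "p = k + b"
  define n where "n = k - b"
  have sp: "cstar p = p" and sn: "cstar n = n" by (simp_all add: p_def n_def cstar_add cstar_diff sk b)
  have pn: "p * n = 0" and np: "n * p = 0" by (simp_all add: p_def n_def algebra_simps k(2) bk)
  obtain q where q: "cpos q" "q * q = p * p" "\<forall>x. x * (p * p) = (p * p) * x \<longrightarrow> x * q = q * x"
    using cpos_sqrt[OF cpos_square[OF sp]] by blast
  obtain r where r: "cpos r" "r * r = n * n" "\<forall>x. x * (n * n) = (n * n) * x \<longrightarrow> x * r = r * x"
    using cpos_sqrt[OF cpos_square[OF sn]] by blast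
  have pq: "p * q = q * p" using q(3) by (simp add: mult.assoc)
  have nq: "n * q = q * n" using q(3) pn np by (metis mult.assoc mult_zero_left mult_zero_right)
  have pr: "p * r = r * p" using r(3) pn np by (metis mult.assoc mult_zero_left mult_zero_right)
  have nr: "n * r = r * n" using r(3) by (simp add: mult.assoc)
  have qr: "q * r = r * q" using r(3) nq by (metis mult.assoc)
  have sq: "cstar q = q" and sr: "cstar r = r" using q(1) r(1) by (simp_all add: cpos_def)
  have ppnn: "(p * p) * (n * n) = 0" "(n * n) * (p * p) = 0"
    using pn np by (metis mult.assoc mult_zero_left mult_zero_right)+
  have pr0: "p * r = 0"
    using square_selfadjoint_eq_0_iff[of "p * r"] square_mult_commute[OF pr] ppnn
    by (simp add: cstar_mult sp sr pr r(2))
  have nq0: "n * q = 0"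
    using square_selfadjoint_eq_0_iff[of "n * q"] square_mult_commute[OF nq] ppnn
    by (simp add: cstar_mult sn sq nq q(2))
  have qr0: "q * r = 0"
    using square_selfadjoint_eq_0_iff[of "q * r"] square_mult_commute[OF qr] ppnn
    by (simp add: cstar_mult sr sq qr r(2) q(2))
  have "p + n = q + r"
  proof (rule cpos_sqrt_unique)
    have "p + n = 2 *\<^sub>R k" by (simp add: p_def n_def scaleR_2)
    then show "cpos (p + n)" using k(1) by (simp add: cpos_scaleR)
    show "cpos (q + r)" using q(1) r(1) by (rule cpos_add)
    show "(p + n) * (q + r) = (q + r) * (p + n)" by (simp add: algebra_simps pq nq pr nr)
    show "(p + n) * (p + n) = (q + r) * (q + r)"
      using qr0 qr by (simp add: algebra_simps pn np q(2) r(2))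
  qed
  note sum_eq = this
  \<comment> \<open>Multiplying the equality by p and by q gives p^2 = p q = q^2, so (p - q)^2 =
    0.\<close>
  have "p * (p + n) = p * (q + r)" using sum_eq by simp
  then have pp: "p * p = p * q" by (simp add: distrib_left pn pr0)
  have "(p + n) * q = (q + r) * q" using sum_eq by simp
  then have "p * q = q * q" using nq0 qr0 qr by (simp add: distrib_right)
  then have "(p - q) * (p - q) = 0" using pp pq by (simp add: algebra_simps)
  then have "p = q" using square_selfadjoint_eq_0_iff[of "p - q"] by (simp add: cstar_diff sp sq)
  then have nr': "n = r" using sum_eq by simp
  show thesis
  proof (rule that[of n])
    show "cpos n" using nr' r(1) by simp
    show "cpos (b + n)" using k(1) by (simp add: n_def)
    show "b * n = n * b" by (simp add: n_def algebra_simps bk)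
    show "n * n = - (2 *\<^sub>R (b * n))" by (simp add: n_def algebra_simps bk k(2) scaleR_2)
  qed
qed

lemma norm_power_2_power_selfadjoint:
  fixes w :: "'a::cstar_alg"
  assumes "cstar w = w" shows "norm (w ^ 2 ^ j) = norm w ^ 2 ^ j"
proof (induction j)
  case (Suc j)
  have s: "cstar (w ^ n) = w ^ n" for n by (induction n) (auto simp: cstar_mult assms power_commutes)
  have "w ^ 2 ^ Suc j = w ^ 2 ^ j * w ^ 2 ^ j" by (simp add: power_add[symmetric] mult_2)
  then have "norm (w ^ 2 ^ Suc j) = (norm (w ^ 2 ^ j))\<^sup>2" by (simp add: norm_square_selfadjoint s)
  also have "\<dots> = norm w ^ 2 ^ Suc j" by (simp add: Suc power_mult[symmetric] mult.commute)
  finally show ?case .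
qed simp

text \<open>The powers of \<open>t + x x\<^sup>*\<close> grow like those of \<open>t + x\<^sup>* x\<close> up to a linear factor, which
  replaces the usual comparison of the spectra of \<open>x x\<^sup>*\<close> and \<open>x\<^sup>* x\<close>.\<close>

lemma cpos_uminus_swap:
  fixes x :: "'a::cstar_alg"
  assumes "cpos (- (cstar x * x))"
  shows "cpos (- (x * cstar x))"
proof (cases "x = 0")
  case False
  define t where "t = (norm x)\<^sup>2"
  have tp: "t > 0" using False by (simp add: t_def)
  define w where "w = of_real t + x * cstar x"
  define W where "W = of_real t + cstar x * x"
  have nW: "norm W \<le> t"
    using assms unfolding cpos_iff_norm by (simp add: W_def t_def cstar_identity)
  have sw: "cstar w = w" by (simp add: w_def cstar_add cstar_mult cstar_cstar)
  \<comment> \<open>Multiplying t^n + x P x^* by w = t + x x^* replaces P by t^n + W P and leaves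
    t^(n+1) in front. As \<open>norm W\<close> <= t, the norm of P grows at most by the factor t and
    the summand t^n in each step, hence the factor n.\<close>
  have ex: "\<exists>P. w ^ n = of_real (t ^ n) + x * P * cstar x \<and> t * norm P \<le> real n * t ^ n" for n
  proof (induction n)
    case 0
    show ?case by (rule exI[of _ 0]) simp
  next
    case (Suc n)
    then obtain P where P: "w ^ n = of_real (t ^ n) + x * P * cstar x" "t * norm P \<le> real n * t ^ n" by blast
    have "w ^ Suc n = of_real (t ^ Suc n) + x * (of_real (t ^ n) + W * P) * cstar x"
      unfolding power_Suc P(1) unfolding w_def W_def
      by (simp add: algebra_simps of_real_def)
    moreover have "t * norm (of_real (t ^ n) + W * P) \<le> real (Suc n) * t ^ Suc n"
    proof -
      have "norm (of_real (t ^ n) :: 'a) = t ^ n" unfolding norm_of_real using tp by simp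
      then have "norm (of_real (t ^ n) + W * P) \<le> t ^ n + norm W * norm P"
        using norm_triangle_ineq[of "of_real (t ^ n)" "W * P"] norm_mult_ineq[of W P] by linarith
      also have "\<dots> \<le> t ^ n + t * norm P" by (simp add: nW mult_right_mono)
      also have "\<dots> \<le> t ^ n + real n * t ^ n" using P(2) by simp
      finally have "t * norm (of_real (t ^ n) + W * P) \<le> t * (t ^ n + real n * t ^ n)"
        using tp by simp
      then show ?thesis by (simp add: algebra_simps)
    qed
    ultimately show ?case by blast
  qed
  have bd: "norm (w ^ n) \<le> t ^ n + real n * t ^ n" for n
  proof -
    obtain P where P: "w ^ n = of_real (t ^ n) + x * P * cstar x" "t * norm P \<le> real n * t ^ n" using ex by blast
    have "norm (w ^ n) \<le> t ^ n + norm (x * P * cstar x)"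
      unfolding P(1) by (rule order_trans[OF norm_triangle_ineq]) (use tp in \<open>simp only: norm_of_real; simp\<close>)
    also have "norm (x * P * cstar x) \<le> norm x * norm P * norm x"
      by (rule order_trans[OF norm_mult_ineq]) (simp add: mult_right_mono norm_mult_ineq)
    also have "\<dots> = t * norm P" by (simp add: t_def power2_eq_square)
    finally show ?thesis using P(2) by simp
  qed
  \<comment> \<open>If \<open>norm w\<close> exceeded t, then c = t / norm w < 1 would satisfy 1 <=
    (1 + n) c^n for n = 2^j, and the right side tends to 0. Powers of two are used because there the
    norm of the power of a selfadjoint element is the power of its norm.\<close>
  have "norm w \<le> t"
  proof (rule ccontr)
    assume "\<not> norm w \<le> t"
    define c where "c = t / norm w"
    have "norm w > t" using \<open>\<not> norm w \<le> t\<close> by simp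
    moreover from this have "norm w > 0" using tp by linarith
    ultimately have c: "0 < c" "c < 1" "norm w > 0" using tp by (simp_all add: c_def divide_simps)
    have "1 \<le> c ^ 2 ^ j + real (2 ^ j) * c ^ 2 ^ j" for j
    proof -
      have "norm w ^ 2 ^ j \<le> t ^ 2 ^ j + real (2 ^ j) * t ^ 2 ^ j"
        using bd[of "2 ^ j"] by (simp add: norm_power_2_power_selfadjoint[OF sw])
      then have "norm w ^ 2 ^ j / norm w ^ 2 ^ j \<le> (t ^ 2 ^ j + real (2 ^ j) * t ^ 2 ^ j) / norm w ^ 2 ^ j"
        using c by (intro divide_right_mono) auto
      then show ?thesis using c by (simp add: c_def power_divide add_divide_distrib)
    qed
    moreover have "(\<lambda>n. c ^ n + real n * c ^ n) \<longlonglongrightarrow> 0 + 0"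
      using powser_times_n_limit_0[of c] c by (intro tendsto_add LIMSEQ_realpow_zero) auto
    then have "((\<lambda>n. c ^ n + real n * c ^ n) \<circ> (\<lambda>j. 2 ^ j)) \<longlonglongrightarrow> 0 + 0"
      by (rule LIMSEQ_subseq_LIMSEQ) (auto simp: strict_mono_def)
    ultimately have "1 \<le> (0::real)"
      by (intro LIMSEQ_le_const[of "(\<lambda>n. c ^ n + real n * c ^ n) \<circ> (\<lambda>j. 2 ^ j)"]) (auto simp: o_def)
    then show False by simp
  qed
  then show ?thesis
    by (intro cposI[where t=t]) (auto simp: w_def cstar_mult cstar_cstar cstar_uminus)
qed simp

text \<open>Kaplansky's argument. Let n be the negative part of b = \<open>cstar a * a\<close> and x
  = a n. Then x^* x = n b n = -n^3 / 2 is negative, so x x^* is negative by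
  \<open>cpos_uminus_swap\<close>. But x^* x + x x^* is half a sum of two squares of selfadjoint
  elements, hence positive, so x^* x is positive as well as negative and vanishes; this forces n =
  0.\<close>

theorem cpos_cstar_mult: "cpos (cstar a * (a::'a::cstar_alg))"
proof -
  define b where "b = cstar a * a"
  have "cstar b = b" by (simp add: b_def cstar_mult cstar_cstar)
  then obtain n where n: "cpos n" "cpos (b + n)" "b * n = n * b" "n * n = - (2 *\<^sub>R (b * n))"
    by (rule negative_part)
  have sn: "cstar n = n" using n by (simp add: cpos_def)
  define x where "x = a * n"
  have "cstar x * x = n * (b * n)"
    by (simp add: x_def b_def cstar_mult sn mult.assoc)
  also have "b * n = (- (1/2)) *\<^sub>R (n * n)" by (simp add: n(4))
  finally have xx: "- (cstar x * x) = (1/2) *\<^sub>R (n * n * n)" by (simp add: mult.assoc)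
  then have 1: "cpos (- (cstar x * x))" using cpos_cube[OF n(1)] by (simp add: cpos_scaleR)
  then have 2: "cpos (- (x * cstar x))" by (rule cpos_uminus_swap)
  define u where "u = x + cstar x"
  define v where "v = scaleC \<i> (x - cstar x)"
  have "cstar u = u" "cstar v = v"
    by (simp_all add: u_def v_def cstar_add cstar_diff cstar_cstar cstar_scaleC scaleC_uminus_left
        scaleC_diff_right)
  then have "cpos (u * u + v * v)" by (intro cpos_add cpos_square)
  moreover have "u * u + v * v = 2 *\<^sub>R (cstar x * x + x * cstar x)"
    by (simp add: u_def v_def scaleC_mult_left scaleC_mult_right scaleC_scaleC scaleC_uminus_left
        scaleC_diff_right scaleR_2 algebra_simps)
  ultimately have "cpos (2 *\<^sub>R (cstar x * x + x * cstar x))" by simp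
  from cpos_scaleR[OF this, of "1/2"] have 3: "cpos (cstar x * x + x * cstar x)" by simp
  have "cpos (cstar x * x)" using cpos_add[OF 3 2] by simp
  then have "cstar x * x = 0" using 1 by (rule cpos_antisym)
  then have "n * n * n = 0" using xx by simp
  then have "(n * n) * (n * n) = 0" by (simp add: mult.assoc[symmetric])
  then have "n = 0" using square_selfadjoint_eq_0_iff[of "n * n"] square_selfadjoint_eq_0_iff[OF sn]
    by (simp add: cstar_mult sn)
  then show ?thesis using n(2) by (simp add: b_def)
qed

lemma cpos_conj:
  assumes "cpos a" shows "cpos (cstar c * a * c)"
proof -
  obtain s where s: "cpos s" "s * s = a" using cpos_sqrt[OF assms] by blast
  have "csq (s * c) = cstar c * a * c"
    using s by (simp add: cstar_mult cpos_def mult.assoc) (metis mult.assoc)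
  then show ?thesis using cpos_cstar_mult by metis
qed

text \<open>The order form of boundedness of left multiplication, from m^* m <= (norm m)^2
  conjugated by c. It bounds multiplication operators on the module and makes the null vectors of a
  state a left ideal.\<close>

lemma cpos_conj_le: 
  fixes c :: "'a::cstar_alg"
  shows "cpos ((norm m)\<^sup>2 *\<^sub>R (cstar c * c) - csq (m * c))"
proof -
  have "cstar (cstar m * m) = cstar m * m" by (simp add: cstar_mult cstar_cstar)
  from cpos_conj[OF cpos_norm_minus[OF this], of c] show ?thesis
    by (simp add: cstar_identity cstar_mult algebra_simps of_real_def)
qed

section \<open>States\<close>

definition sublinear :: "('a::real_vector \<Rightarrow> real) \<Rightarrow> bool" where
  "sublinear p \<longleftrightarrow> (\<forall>x y. p (x + y) \<le> p x + p y) \<and> (\<forall>r x. r \<ge> 0 \<longrightarrow> p (r *\<^sub>R x) = r * p x)"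

lemma sublinear_add: "sublinear p \<Longrightarrow> p (x + y) \<le> p x + p y"
  and sublinear_scaleR: "sublinear p \<Longrightarrow> r \<ge> 0 \<Longrightarrow> p (r *\<^sub>R x) = r * p x"
  by (auto simp: sublinear_def)

lemma sublinear_zero: "sublinear p \<Longrightarrow> p 0 = 0"
  using sublinear_scaleR[of p 0 0] by simp

lemma sublinear_lower: "sublinear p \<Longrightarrow> - p (- x) \<le> p x"
  using sublinear_add[of p x "- x"] sublinear_zero[of p] by simp

lemma sublinearI:
  assumes "\<And>x y. p (x + y) \<le> p x + p y" "p 0 = 0" "\<And>r x. r > 0 \<Longrightarrow> p (r *\<^sub>R x) \<le> r * p x"
  shows "sublinear p"
  unfolding sublinear_def
proof (intro conjI allI impI)
  fix r :: real and x assume "r \<ge> 0"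
  show "p (r *\<^sub>R x) = r * p x"
  proof (cases "r = 0")
    case False
    then have r: "r > 0" using \<open>r \<ge> 0\<close> by simp
    have "p ((1/r) *\<^sub>R r *\<^sub>R x) \<le> (1/r) * p (r *\<^sub>R x)" using r by (intro assms(3)) simp
    then have "r * p x \<le> p (r *\<^sub>R x)" using r by (simp add: field_simps)
    then show ?thesis using assms(3)[OF r, of x] by simp
  qed (simp add: assms)
qed (rule assms)

text \<open>A sublinear functional below p whose value at -y is at most -p(y). A functional that is
  minimal among the sublinear ones equals all its shifts and is therefore odd.\<close>

definition sublinear_shift :: "('a::real_vector \<Rightarrow> real) \<Rightarrow> 'a \<Rightarrow> 'a \<Rightarrow> real" where
  "sublinear_shift p y x = (INF t\<in>{0..}. p (x + t *\<^sub>R y) - t * p y)"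

lemma
  assumes p: "sublinear p"
  shows sublinear_shift_sublinear: "sublinear (sublinear_shift p y)"
    and sublinear_shift_le: "sublinear_shift p y x \<le> p x"
    and sublinear_shift_uminus: "sublinear_shift p y (- y) \<le> - p y"
proof -
  define q where "q = sublinear_shift p y"
  have bdd: "bdd_below ((\<lambda>t. p (x + t *\<^sub>R y) - t * p y) ` {0..})" for x
  proof (rule bdd_belowI2)
    fix t :: real assume t: "t \<in> {0..}"
    have "p (t *\<^sub>R y) \<le> p (x + t *\<^sub>R y) + p (- x)" using sublinear_add[OF p, of "x + t *\<^sub>R y" "- x"] by simp
    then show "- p (- x) \<le> p (x + t *\<^sub>R y) - t * p y" using t sublinear_scaleR[OF p, of t y] by simp
  qed
  have le: "q x \<le> p (x + t *\<^sub>R y) - t * p y" if "t \<ge> 0" for x t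
    unfolding q_def sublinear_shift_def using that by (intro cINF_lower[OF bdd]) auto
  have ge: "c \<le> q x" if "\<And>t. t \<ge> 0 \<Longrightarrow> c \<le> p (x + t *\<^sub>R y) - t * p y" for x c
    unfolding q_def sublinear_shift_def using that by (intro cINF_greatest) auto
  show "sublinear_shift p y x \<le> p x" using le[of 0 x] by (simp add: q_def)
  show "sublinear_shift p y (- y) \<le> - p y" using le[of 1 "- y"] sublinear_zero[OF p] by (simp add: q_def)
  have "sublinear q"
  proof (rule sublinearI)
    fix u v
    have "q (u + v) - q u \<le> q v"
    proof (rule ge)
      fix t :: real assume t: "t \<ge> 0"
      have "q (u + v) - (p (v + t *\<^sub>R y) - t * p y) \<le> q u"
      proof (rule ge)
        fix s :: real assume s: "s \<ge> 0"
        have "q (u + v) \<le> p (u + v + (s + t) *\<^sub>R y) - (s + t) * p y" using s t by (intro le) simp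
        also have "u + v + (s + t) *\<^sub>R y = (u + s *\<^sub>R y) + (v + t *\<^sub>R y)" by (simp add: algebra_simps)
        also have "p \<dots> \<le> p (u + s *\<^sub>R y) + p (v + t *\<^sub>R y)" by (rule sublinear_add[OF p])
        finally show "q (u + v) - (p (v + t *\<^sub>R y) - t * p y) \<le> p (u + s *\<^sub>R y) - s * p y"
          by (simp add: algebra_simps)
      qed
      then show "q (u + v) - q u \<le> p (v + t *\<^sub>R y) - t * p y" by simp
    qed
    then show "q (u + v) \<le> q u + q v" by simp
  next
    show "q 0 = 0"
    proof (rule antisym)
      show "q 0 \<le> 0" using le[of 0 0] sublinear_zero[OF p] by simp
      show "0 \<le> q 0" by (rule ge) (simp add: sublinear_scaleR[OF p])
    qed
  next
    fix r :: real and u assume r: "r > 0"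
    have "(1 / r) * q (r *\<^sub>R u) \<le> q u"
    proof (rule ge)
      fix t :: real assume t: "t \<ge> 0"
      have "q (r *\<^sub>R u) \<le> p (r *\<^sub>R u + (r * t) *\<^sub>R y) - (r * t) * p y" using t r by (intro le) simp
      also have "r *\<^sub>R u + (r * t) *\<^sub>R y = r *\<^sub>R (u + t *\<^sub>R y)" by (simp add: algebra_simps)
      also have "p \<dots> = r * p (u + t *\<^sub>R y)" using r by (simp add: sublinear_scaleR[OF p])
      finally show "(1 / r) * q (r *\<^sub>R u) \<le> p (u + t *\<^sub>R y) - t * p y" using r by (simp add: field_simps)
    qed
    then show "q (r *\<^sub>R u) \<le> r * q u" using r by (simp add: field_simps)
  qed
  then show "sublinear (sublinear_shift p y)" by (simp add: q_def)
qed

text \<open>Hahn-Banach by minimality: Zorn gives a minimal sublinear m below p, minimality against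
  all its shifts makes m odd, and an odd sublinear functional is linear. In the order
  \<open>P\<close> the smaller functional is the larger element.\<close>

lemma exists_linear_le_sublinear:
  fixes p :: "'a::real_vector \<Rightarrow> real"
  assumes p: "sublinear p"
  obtains f where "linear f" "\<And>x. f x \<le> p x"
proof -
  define Q where "Q = {q. sublinear q \<and> (\<forall>x. q x \<le> p x)}"
  define P where "P = (\<lambda>q r :: 'a \<Rightarrow> real. \<forall>x. r x \<le> q x)"
  have "\<exists>m\<in>Q. \<forall>a\<in>Q. P m a \<longrightarrow> a = m"
  proof (rule predicate_Zorn)
    show "partial_order_on Q (relation_of P Q)"
    proof (rule partial_order_on_relation_ofI)
      show "P a c" if "P a b" "P b c" for a b c using that unfolding P_def by (meson order_trans)
      show "a = b" if "P a b" "P b a" for a b using that unfolding P_def by (auto intro!: ext antisym)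
    qed (auto simp: P_def)
  next
    fix C assume C: "C \<in> Chains (relation_of P Q)"
    then have CQ: "C \<subseteq> Q" and ch: "\<And>a b. a \<in> C \<Longrightarrow> b \<in> C \<Longrightarrow> P a b \<or> P b a"
      by (auto simp: Chains_def relation_of_def)
    show "\<exists>u\<in>Q. \<forall>a\<in>C. P a u"
    proof (cases "C = {}")
      case True
      then show ?thesis using p by (auto simp: Q_def)
    next
      case False
      \<comment> \<open>Chains are bounded by pointwise infima, which are finite because every
        member of Q lies above -p(-x).\<close>
      define u where "u = (\<lambda>x. INF q\<in>C. q x)"
      have sub: "sublinear q" "q x \<le> p x" if "q \<in> C" for q x using that CQ by (auto simp: Q_def)
      have bdd: "bdd_below ((\<lambda>q. q x) ` C)" for x
      proof (rule bdd_belowI2)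
        fix q assume q: "q \<in> C"
        show "- p (- x) \<le> q x" using sublinear_lower[OF sub(1)[OF q], of x] sub(2)[OF q, of "- x"] by simp
      qed
      have le: "u x \<le> q x" if "q \<in> C" for q x
        unfolding u_def using that by (intro cINF_lower[OF bdd]) auto
      have ge: "c \<le> u x" if "\<And>q. q \<in> C \<Longrightarrow> c \<le> q x" for x c
        unfolding u_def using that False by (intro cINF_greatest) auto
      have "sublinear u"
      proof (rule sublinearI)
        fix x y
        have "u (x + y) - u x \<le> u y"
        proof (rule ge)
          fix q assume q: "q \<in> C"
          have "u (x + y) - q y \<le> u x"
          proof (rule ge)
            fix r assume r: "r \<in> C"
            \<comment> \<open>Two members of a chain are comparable, and subadditivity of the
              smaller one bounds u (x + y) by r x + q y.\<close>
            consider "P q r" | "P r q" using ch q r by blast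
            then show "u (x + y) - q y \<le> r x"
            proof cases
              case 1
              then show ?thesis
                using le[OF r, of "x + y"] sublinear_add[OF sub(1)[OF r], of x y] by (force simp: P_def dest: spec[of _ y])
            next
              case 2
              then show ?thesis
                using le[OF q, of "x + y"] sublinear_add[OF sub(1)[OF q], of x y] by (force simp: P_def dest: spec[of _ x])
            qed
          qed
          then show "u (x + y) - u x \<le> q y" by simp
        qed
        then show "u (x + y) \<le> u x + u y" by simp
      next
        show "u 0 = 0" 
        proof (rule antisym)
          obtain q where q: "q \<in> C" using False by blast
          show "u 0 \<le> 0" using le[OF q, of 0] sublinear_zero[OF sub(1)[OF q]] by simp
          show "0 \<le> u 0" by (rule ge) (simp add: sublinear_zero[OF sub(1)])
        qed
      next
        fix r :: real and x assume r: "r > 0"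
        have "(1 / r) * u (r *\<^sub>R x) \<le> u x"
        proof (rule ge)
          fix q assume q: "q \<in> C"
          then show "(1 / r) * u (r *\<^sub>R x) \<le> q x"
            using le[OF q, of "r *\<^sub>R x"] sublinear_scaleR[OF sub(1)[OF q], of r x] r by (simp add: field_simps)
        qed
        then show "u (r *\<^sub>R x) \<le> r * u x" using r by (simp add: field_simps)
      qed
      moreover have "u x \<le> p x" for x using False le sub(2) order_trans by blast
      ultimately show ?thesis using le by (auto simp: Q_def P_def)
    qed
  qed
  then obtain m where m: "m \<in> Q" "\<And>a. a \<in> Q \<Longrightarrow> P m a \<Longrightarrow> a = m" by blast
  then have sm: "sublinear m" and mp: "\<And>x. m x \<le> p x" by (auto simp: Q_def)
  have "sublinear_shift m y = m" for y
  proof (rule m(2))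
    show "sublinear_shift m y \<in> Q"
      unfolding Q_def using sublinear_shift_sublinear[OF sm] sublinear_shift_le[OF sm] mp order_trans by blast
    show "P m (sublinear_shift m y)" by (simp add: P_def sublinear_shift_le[OF sm])
  qed
  then have odd: "m (- y) = - m y" for y
    using sublinear_shift_uminus[OF sm, of y] sublinear_lower[OF sm, of "- y"] by simp
  have "linear m"
  proof (rule linearI)
    fix x y
    have "m (- (x + y)) \<le> m (- x) + m (- y)" using sublinear_add[OF sm, of "- x" "- y"] by simp
    then show "m (x + y) = m x + m y" using sublinear_add[OF sm, of x y] by (simp only: odd)
  next
    fix r x
    show "m (r *\<^sub>R x) = r *\<^sub>R m x"
      using sublinear_scaleR[OF sm, of r x] sublinear_scaleR[OF sm, of "- r" x] odd[of "r *\<^sub>R x"]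
      by (cases "r \<ge> 0") auto
  qed
  then show thesis using mp that by blast
qed

text \<open>A functional below the shift of p at s takes at -s a value of at most -p(s), which
  forces equality at s.\<close>

lemma exists_linear_le_sublinear_attaining:
  fixes p :: "'a::real_vector \<Rightarrow> real"
  assumes p: "sublinear p"
  obtains f where "linear f" "\<And>x. f x \<le> p x" "f s = p s"
proof -
  obtain f where f: "linear f" "\<And>x. f x \<le> sublinear_shift p s x"
    using exists_linear_le_sublinear[OF sublinear_shift_sublinear[OF p]] by metis
  have le: "f x \<le> p x" for x using f(2) sublinear_shift_le[OF p] order_trans by blast
  have "f (- s) \<le> - p s" using f(2) sublinear_shift_uminus[OF p] order_trans by blast
  then have "f s = p s" using le[of s] linear_neg[OF f(1), of s] by simp
  then show thesis using that f(1) le by blast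
qed

text \<open>States in the form in which they are used: hermitian, positive and with real part
  bounded by the norm. The factor 2 is what separate bounds for the real and the imaginary part
  give; it serves continuity, while sharp estimates go through the real part.\<close>

definition cstate :: "('a::cstar_alg \<Rightarrow> complex) \<Rightarrow> bool" where
  "cstate \<tau> \<longleftrightarrow> (\<forall>x y. \<tau> (x + y) = \<tau> x + \<tau> y) \<and> (\<forall>c x. \<tau> (scaleC c x) = c * \<tau> x)
    \<and> (\<forall>x. \<tau> (cstar x) = cnj (\<tau> x)) \<and> (\<forall>x. cmod (\<tau> x) \<le> 2 * norm x)
    \<and> (\<forall>a. cpos a \<longrightarrow> Re (\<tau> a) \<ge> 0) \<and> (\<forall>x. Re (\<tau> x) \<le> norm x)"

text \<open>The shift of the norm at 1, p(x) = inf over t >= 0 of norm (t + x) - t, is at most 0 on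
  negatives of positive elements, so every functional below it is nonnegative on positive elements;
  and it still takes the value \<open>norm s\<close> at s, so the norm can be attained. Averaging
  over the adjoint makes the functional hermitian.\<close>

lemma exists_cstate:
  fixes s :: "'a::cstar_alg"
  assumes s: "cpos s"
  obtains \<tau> where "cstate \<tau>" "\<tau> s = of_real (norm s)"
proof -
  define p :: "'a \<Rightarrow> real" where "p = sublinear_shift norm 1"
  have sn: "sublinear (norm :: 'a \<Rightarrow> real)" by (simp add: sublinear_def norm_triangle_ineq)
  have sp: "sublinear p" unfolding p_def by (rule sublinear_shift_sublinear[OF sn])
  have p_le: "p x \<le> norm x" for x unfolding p_def by (rule sublinear_shift_le[OF sn])
  have p_alt: "p x = (INF t\<in>{0..}. norm (of_real t + x) - t)" for x
    by (simp add: p_def sublinear_shift_def of_real_def add.commute)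
  have p_neg: "p (- a) \<le> 0" if a: "cpos a" for a
  proof -
    have "p (- a) \<le> norm (of_real (norm a) + (- a)) - norm a"
      unfolding p_alt
    proof (rule cINF_lower)
      show "bdd_below ((\<lambda>t. norm (of_real t + - a) - t) ` {0..})"
      proof (rule bdd_belowI2)
        fix t :: real assume "t \<in> {0..}"
        then have "norm (of_real t :: 'a) = t" by simp
        then show "- norm a \<le> norm (of_real t + - a) - t"
          using norm_triangle_ineq4[of "of_real t - a" "- a"] by simp
      qed
    qed simp
    also have "\<dots> \<le> 0" using a by (simp add: cpos_iff_norm)
    finally show ?thesis .
  qed
  have "norm s \<le> p s"
    unfolding p_alt
  proof (rule cINF_greatest)
    fix t :: real assume t: "t \<in> {0..}"
    define R where "R = norm (of_real t + s)"
    have "cstar (of_real t + s) = of_real t + s" using s by (simp add: cstar_add cpos_def)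
    \<comment> \<open>t + s is at most its norm R, so s <= R - t, and the comparison with a scalar
      bounds \<open>norm s\<close>.\<close>
    from cpos_norm_minus[OF this] have "cpos (of_real (R - t) - s)" by (simp add: R_def algebra_simps)
    from cpos_le_of_real[OF s this] show "norm s \<le> norm (of_real t + s) - t" by (simp add: R_def)
  qed simp
  then have ps: "p s = norm s" using p_le[of s] by simp
  obtain g where g: "linear g" "\<And>x. g x \<le> p x" "g s = p s"
    using exists_linear_le_sublinear_attaining[OF sp] by metis
  define f where "f = (\<lambda>a. g ((1/2) *\<^sub>R (a + cstar a)))"
  have f_add: "f (a + b) = f a + f b" for a b
    by (simp add: f_def linear_add[OF g(1), symmetric] cstar_add algebra_simps)
  have f_scaleR: "f (r *\<^sub>R a) = r * f a" for r a
    using linear_scale[OF g(1), of r "(1/2) *\<^sub>R (a + cstar a)"]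
    by (simp add: f_def cstar_scaleR scaleR_add_right[symmetric])
  have f_star: "f (cstar a) = f a" for a by (simp add: f_def cstar_cstar add.commute)
  have f_le: "f a \<le> norm a" for a
  proof -
    have "f a \<le> norm ((1/2) *\<^sub>R (a + cstar a))" unfolding f_def using g(2) p_le order_trans by blast
    also have "\<dots> \<le> norm a" using norm_triangle_ineq[of a "cstar a"] by simp
    finally show ?thesis .
  qed
  have f_minus: "f (- a) = - f a" for a using f_scaleR[of "-1" a] by simp
  have f_abs: "\<bar>f a\<bar> \<le> norm a" for a using f_le[of a] f_le[of "- a"] f_minus[of a] by simp
  have f_sa: "f a = g a" if "cstar a = a" for a using that by (simp add: f_def scaleR_2[symmetric])
  \<comment> \<open>The complex-linear functional with real part f.\<close>
  define \<tau> where "\<tau> = (\<lambda>a. Complex (f a) (- f (scaleC \<i> a)))"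
  have \<tau>_add: "\<tau> (x + y) = \<tau> x + \<tau> y" for x y
    by (simp add: \<tau>_def f_add scaleC_add_right complex_eq_iff)
  have \<tau>_R: "\<tau> (r *\<^sub>R x) = of_real r * \<tau> x" for r x
    by (simp add: \<tau>_def f_scaleR scaleC_scaleR complex_eq_iff)
  have \<tau>_i: "\<tau> (scaleC \<i> x) = \<i> * \<tau> x" for x
    by (simp add: \<tau>_def scaleC_scaleC complex_eq_iff scaleC_uminus_left f_minus)
  have \<tau>_C: "\<tau> (scaleC c x) = c * \<tau> x" for c x
  proof -
    have "scaleC c x = Re c *\<^sub>R x + scaleC \<i> (Im c *\<^sub>R x)"
      by (subst complex_eq[of c]) (simp add: scaleC_add_left scaleC_of_real scaleC_scaleC[symmetric])
    then have "\<tau> (scaleC c x) = of_real (Re c) * \<tau> x + \<i> * (of_real (Im c) * \<tau> x)"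
      by (simp add: \<tau>_add \<tau>_R \<tau>_i)
    also have "\<dots> = (of_real (Re c) + \<i> * of_real (Im c)) * \<tau> x" by (simp add: algebra_simps)
    finally show ?thesis by (simp add: complex_eq[symmetric])
  qed
  have "cstate \<tau>"
    unfolding cstate_def
  proof (intro conjI allI impI \<tau>_add \<tau>_C)
    fix x
    have "f (scaleC \<i> (cstar x)) = - f (scaleC \<i> x)"
      using f_star[of "scaleC \<i> x"] by (simp add: cstar_scaleC scaleC_uminus_left f_minus)
    then show "\<tau> (cstar x) = cnj (\<tau> x)" by (simp add: \<tau>_def f_star complex_eq_iff)
    show "cmod (\<tau> x) \<le> 2 * norm x"
      using cmod_le[of "\<tau> x"] f_abs[of x] f_abs[of "scaleC \<i> x"] by (simp add: \<tau>_def norm_scaleC)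
    show "Re (\<tau> x) \<le> norm x" using f_le[of x] by (simp add: \<tau>_def)
  next
    fix a :: 'a assume a: "cpos a"
    have "g (- a) \<le> 0" using g(2)[of "- a"] p_neg[OF a] by simp
    then show "Re (\<tau> a) \<ge> 0" using a by (simp add: \<tau>_def f_sa cpos_def linear_neg[OF g(1)])
  qed
  moreover have "\<tau> s = of_real (norm s)"
  proof -
    have "\<tau> s = cnj (\<tau> s)" using s \<open>cstate \<tau>\<close> unfolding cstate_def cpos_def by metis
    then have "Im (\<tau> s) = - Im (\<tau> s)" by (metis cnj.sel(2))
    then show ?thesis using s g(3) ps by (simp add: \<tau>_def f_sa cpos_def complex_eq_iff)
  qed
  ultimately show thesis using that by blast
qed

section \<open>The standard Hilbert module\<close>

text \<open>Unconditional convergence as smallness of finite sums far out; in this form it passes to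
  families whose finite sums are dominated in norm.\<close>

lemma summable_on_Cauchy_disjoint:
  fixes f :: "'g \<Rightarrow> 'a::banach"
  shows "f summable_on UNIV \<longleftrightarrow>
    (\<forall>\<epsilon>>0. \<exists>F0. finite F0 \<and> (\<forall>F. finite F \<and> F \<inter> F0 = {} \<longrightarrow> norm (sum f F) < \<epsilon>))"
    (is "_ \<longleftrightarrow> ?C")
proof
  assume "f summable_on UNIV"
  then obtain s where "(f has_sum s) UNIV" by (auto simp: summable_on_def)
  then have lim: "(sum f \<longlongrightarrow> s) (finite_subsets_at_top UNIV)" by (simp add: has_sum_def)
  show ?C
  proof (intro allI impI)
    fix \<epsilon> :: real assume "\<epsilon> > 0"
    then have "eventually (\<lambda>F. dist (sum f F) s < \<epsilon> / 2) (finite_subsets_at_top UNIV)"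
      by (intro tendstoD[OF lim]) simp
    then obtain F0 where F0: "finite F0" "\<And>F. finite F \<Longrightarrow> F0 \<subseteq> F \<Longrightarrow> dist (sum f F) s < \<epsilon> / 2"
      by (auto simp: eventually_finite_subsets_at_top)
    have "norm (sum f F) < \<epsilon>" if F: "finite F" "F \<inter> F0 = {}" for F
    proof -
      have "sum f F = sum f (F \<union> F0) - sum f F0"
        using F F0(1) by (simp add: sum.union_disjoint)
      moreover have "dist (sum f (F \<union> F0)) s < \<epsilon> / 2" "dist (sum f F0) s < \<epsilon> / 2"
        using F F0 by auto
      ultimately show ?thesis by (metis dist_triangle_half_l dist_norm)
    qed
    then show "\<exists>F0. finite F0 \<and> (\<forall>F. finite F \<and> F \<inter> F0 = {} \<longrightarrow> norm (sum f F) < \<epsilon>)"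
      using F0(1) by blast
  qed
next
  assume C: ?C
  have "cauchy_filter (filtermap (sum f) (finite_subsets_at_top UNIV))"
    unfolding cauchy_filter_metric_filtermap
  proof (intro allI impI)
    fix \<epsilon> :: real assume "\<epsilon> > 0"
    then obtain F0 where F0: "finite F0" "\<And>F. finite F \<Longrightarrow> F \<inter> F0 = {} \<Longrightarrow> norm (sum f F) < \<epsilon> / 2"
      using C[rule_format, of "\<epsilon>/2"] by auto
    have "dist (sum f E) (sum f F) < \<epsilon>" if "finite E" "F0 \<subseteq> E" "finite F" "F0 \<subseteq> F" for E F
    proof -
      have "sum f E = sum f (E - F0) + sum f F0" "sum f F = sum f (F - F0) + sum f F0"
        using that by (simp_all add: sum.subset_diff)
      then have "dist (sum f E) (sum f F) = norm (sum f (E - F0) - sum f (F - F0))"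
        by (simp add: dist_norm)
      also have "\<dots> \<le> norm (sum f (E - F0)) + norm (sum f (F - F0))" by (rule norm_triangle_ineq4)
      also have "\<dots> < \<epsilon>" using F0(2)[of "E - F0"] F0(2)[of "F - F0"] that by (simp add: Diff_Int_distrib2)
      finally show ?thesis .
    qed
    then show "\<exists>P. eventually P (finite_subsets_at_top UNIV) \<and> (\<forall>E F. P E \<and> P F \<longrightarrow> dist (sum f E) (sum f F) < \<epsilon>)"
      using F0(1) by (intro exI[of _ "\<lambda>F. finite F \<and> F0 \<subseteq> F"]) (auto simp: eventually_finite_subsets_at_top)
  qed
  moreover have "complete (UNIV::'a set)"
    by (meson Cauchy_convergent UNIV_I complete_def convergent_def)
  ultimately obtain L where "(sum f \<longlongrightarrow> L) (finite_subsets_at_top UNIV)"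
    using complete_uniform[where S="UNIV :: 'a set"] by (force simp add: filterlim_def)
  then show "f summable_on UNIV" by (auto simp: summable_on_def has_sum_def)
qed

text \<open>Finite sums of positive elements are monotone in norm, so smallness of the far sums
  passes from k to f. A termwise comparison of norms would not do, since these series need not
  converge absolutely.\<close>

lemma summable_on_cpos_comparison:
  fixes f k :: "'g \<Rightarrow> 'a::cstar_alg"
  assumes "k summable_on UNIV" "\<And>g. cpos (f g)" "\<And>g. cpos (k g - f g)"
  shows "f summable_on UNIV"
  unfolding summable_on_Cauchy_disjoint
proof (intro allI impI)
  fix \<epsilon> :: real assume "\<epsilon> > 0"
  then obtain F0 where F0: "finite F0" "\<And>F. finite F \<Longrightarrow> F \<inter> F0 = {} \<Longrightarrow> norm (sum k F) < \<epsilon>"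
    using assms(1) unfolding summable_on_Cauchy_disjoint by metis
  have "norm (sum f F) \<le> norm (sum k F)" for F
  proof (rule cpos_mono_norm)
    show "cpos (sum f F)" by (rule cpos_sum) (rule assms)
    have "cpos (\<Sum>g\<in>F. k g - f g)" by (rule cpos_sum) (rule assms)
    then show "cpos (sum k F - sum f F)" by (simp add: sum_subtractf)
  qed
  then show "\<exists>F0. finite F0 \<and> (\<forall>F. finite F \<and> F \<inter> F0 = {} \<longrightarrow> norm (sum f F) < \<epsilon>)"
    using F0 by (meson order_le_less_trans)
qed

definition sq_summable :: "('g \<Rightarrow> 'a::cstar_alg) \<Rightarrow> bool" where
  "sq_summable z \<longleftrightarrow> (\<lambda>g. csq (z g)) summable_on UNIV"

lemma cpos_parallelogram:
  fixes a b :: "'a::cstar_alg"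
  shows "cpos (2 *\<^sub>R (cstar a * a + cstar b * b) - csq (a + b))"
proof -
  have "2 *\<^sub>R (cstar a * a + cstar b * b) - csq (a + b) = csq (a - b)"
    by (simp add: cstar_add cstar_diff algebra_simps scaleR_2)
  then show ?thesis by (simp add: cpos_cstar_mult)
qed

lemma sq_summable_add:
  assumes "sq_summable z" "sq_summable w" shows "sq_summable (\<lambda>g. z g + w g)"
  unfolding sq_summable_def
proof (rule summable_on_cpos_comparison)
  show "(\<lambda>g. 2 *\<^sub>R (csq (z g) + csq (w g))) summable_on UNIV"
    using assms unfolding sq_summable_def by (intro summable_on_scaleR_right summable_on_add)
qed (auto simp: cpos_cstar_mult cpos_parallelogram)

lemma cpos_conj_le_bound: 
  fixes c :: "'a::cstar_alg"
  assumes "norm m \<le> C"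
  shows "cpos (C\<^sup>2 *\<^sub>R (cstar c * c) - csq (m * c))"
proof -
  have "(norm m)\<^sup>2 \<le> C\<^sup>2" using assms by (simp add: power_mono)
  then have "cpos ((C\<^sup>2 - (norm m)\<^sup>2) *\<^sub>R (cstar c * c))" by (intro cpos_scaleR cpos_cstar_mult) simp
  from cpos_add[OF cpos_conj_le[of m c] this] show ?thesis by (simp add: algebra_simps)
qed

lemma sq_summable_mult_left:
  assumes "sq_summable z" "\<And>g. norm (m g) \<le> C" shows "sq_summable (\<lambda>g. m g * z g)"
  unfolding sq_summable_def
proof (rule summable_on_cpos_comparison)
  show "(\<lambda>g. C\<^sup>2 *\<^sub>R (csq (z g))) summable_on UNIV"
    using assms unfolding sq_summable_def by (intro summable_on_scaleR_right)
qed (auto simp: cpos_cstar_mult cpos_conj_le_bound assms)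

lemma sq_summable_scaleC: "sq_summable z \<Longrightarrow> sq_summable (\<lambda>g. scaleC c (z g))"
  using sq_summable_mult_left[of z "\<lambda>_. scaleC c 1" "cmod c"]
  by (simp add: scaleC_mult_left norm_scaleC)

lemma sq_summable_scaleR: "sq_summable z \<Longrightarrow> sq_summable (\<lambda>g. r *\<^sub>R z g)"
  using sq_summable_scaleC[of z "of_real r"] by (simp add: scaleC_of_real)

lemma sq_summable_zero [simp]: "sq_summable (\<lambda>_. 0)"
  by (simp add: sq_summable_def)

lemma sq_summable_diff: "sq_summable z \<Longrightarrow> sq_summable w \<Longrightarrow> sq_summable (\<lambda>g. z g - w g)"
  using sq_summable_add[OF _ sq_summable_scaleR[of w "-1"], of z] by simp

lemma sq_summable_mult_right:
  assumes "sq_summable z" shows "sq_summable (\<lambda>g. z g * a)"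
proof -
  have "bounded_linear (\<lambda>x. cstar a * x * a)"
    by (intro bounded_linear_mult_left[THEN bounded_linear_compose] bounded_linear_mult_right)
  from summable_on_bounded_linear[OF this assms[unfolded sq_summable_def]]
  show ?thesis by (simp add: sq_summable_def cstar_mult mult.assoc)
qed

lemma sq_summable_finite_support: "finite {g. z g \<noteq> 0} \<Longrightarrow> sq_summable z"
  unfolding sq_summable_def
  by (subst summable_on_cong_neutral[of "{g. z g \<noteq> 0}" UNIV _ "\<lambda>g. csq (z g)"]) auto

text \<open>Cross terms are combinations of four squares, which carries summability from
  \<open>sq_summable\<close> to inner products.\<close>

lemma polarization_cstar:
  fixes z w :: "'a::cstar_alg"
  shows "cstar z * w = (1/4) *\<^sub>R (csq (w + z) - csq (w - z)
    + scaleC \<i> (csq (w + scaleC \<i> z) - csq (w - scaleC \<i> z)))"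
proof -
  have "csq (w + z) - csq (w - z)
    + scaleC \<i> (csq (w + scaleC \<i> z) - csq (w - scaleC \<i> z))
    = 4 *\<^sub>R (cstar z * w)"
  proof -
    have 4: "4 *\<^sub>R x = x + x + x + x" for x :: 'a
      using scaleR_add_left[of 2 2 x] by (simp add: scaleR_2 add.assoc)
    show ?thesis unfolding 4
    by (simp add: cstar_add cstar_diff cstar_scaleC scaleC_uminus_left scaleC_mult_left scaleC_mult_right
        scaleC_scaleC scaleC_diff_right scaleC_add_right scaleC_uminus_right algebra_simps)
  qed
  then show ?thesis by simp
qed

lemma summable_on_diff:
  fixes f g :: "'b \<Rightarrow> 'a::real_normed_vector"
  shows "f summable_on A \<Longrightarrow> g summable_on A \<Longrightarrow> (\<lambda>x. f x - g x) summable_on A"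
  using summable_on_add[of f A "\<lambda>x. - g x"] by (simp add: summable_on_uminus)

lemma summable_on_cstar_mult:
  assumes "sq_summable z" "sq_summable w" shows "(\<lambda>g. cstar (z g) * w g) summable_on UNIV"
  unfolding polarization_cstar[of "z _"]
  by (intro summable_on_scaleR_right summable_on_add summable_on_diff
      summable_on_bounded_linear[OF bounded_linear_scaleC]
      sq_summable_add[THEN sq_summable_def[THEN iffD1]] sq_summable_diff[THEN sq_summable_def[THEN iffD1]]
      sq_summable_scaleC assms)

text \<open>Unlike \<open>AS \<alpha>\<close>, the square-summable functions do not involve
  \<alpha>, so they form a type and the classes of normed spaces become available.\<close>

typedef (overloaded) ('g, 'a::cstar_alg) hmod = "{z :: 'g \<Rightarrow> 'a. sq_summable z}"
  morphisms hcoord Hmod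
  by (rule exI[of _ "\<lambda>_. 0"]) simp

lemma hcoord_Hmod [simp]: "sq_summable z \<Longrightarrow> hcoord (Hmod z) = z"
  by (simp add: Hmod_inverse)

lemma sq_summable_hcoord [simp]: "sq_summable (hcoord z)"
  using hcoord[of z] by simp

lemma hmod_eqI: "(\<And>g. hcoord z g = hcoord w g) \<Longrightarrow> z = w"
  by (metis ext hcoord_inject)

instantiation hmod :: (type, cstar_alg) real_vector
begin
definition "0 = Hmod (\<lambda>_. 0)"
definition "z + w = Hmod (\<lambda>g. hcoord z g + hcoord w g)"
definition "z - w = Hmod (\<lambda>g. hcoord z g - hcoord w g)"
definition "- z = Hmod (\<lambda>g. - hcoord z g)"
definition "r *\<^sub>R z = Hmod (\<lambda>g. r *\<^sub>R hcoord z g)"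

lemma hcoord_zero [simp]: "hcoord (0::('a, 'b) hmod) g = 0"
  by (simp add: zero_hmod_def)
lemma hcoord_add [simp]: "hcoord (z + w :: ('a, 'b) hmod) g = hcoord z g + hcoord w g"
  by (simp add: plus_hmod_def sq_summable_add)
lemma hcoord_diff [simp]: "hcoord (z - w :: ('a, 'b) hmod) g = hcoord z g - hcoord w g"
  by (simp add: minus_hmod_def sq_summable_diff)
lemma hcoord_uminus [simp]: "hcoord (- z :: ('a, 'b) hmod) g = - hcoord z g"
  using sq_summable_scaleR[of "hcoord z" "-1"] by (simp add: uminus_hmod_def)
lemma hcoord_scaleR [simp]: "hcoord (r *\<^sub>R z :: ('a, 'b) hmod) g = r *\<^sub>R hcoord z g"
  by (simp add: scaleR_hmod_def sq_summable_scaleR)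

instance by standard (auto intro!: hmod_eqI simp: algebra_simps)
end

lemma hcoord_sum [simp]: "hcoord (\<Sum>i\<in>I. z i) g = (\<Sum>i\<in>I. hcoord (z i) g)"
  by (induction I rule: infinite_finite_induct) auto

definition hip :: "('g, 'a::cstar_alg) hmod \<Rightarrow> ('g, 'a) hmod \<Rightarrow> 'a" where
  "hip z w = (\<Sum>\<^sub>\<infinity>g. cstar (hcoord z g) * hcoord w g)"

definition hract :: "('g, 'a::cstar_alg) hmod \<Rightarrow> 'a \<Rightarrow> ('g, 'a) hmod" where
  "hract z a = Hmod (\<lambda>g. hcoord z g * a)"

lemma hcoord_hract [simp]: "hcoord (hract z a) g = hcoord z g * a"
  by (simp add: hract_def sq_summable_mult_right)

lemma hip_has_sum: "((\<lambda>g. cstar (hcoord z g) * hcoord w g) has_sum hip z w) UNIV"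
  unfolding hip_def by (intro has_sum_infsum summable_on_cstar_mult) auto

lemma hip_eqI: "((\<lambda>g. cstar (hcoord z g) * hcoord w g) has_sum s) UNIV \<Longrightarrow> hip z w = s"
  using hip_has_sum has_sum_unique by metis

lemma hip_add_right: "hip z (w + v) = hip z w + hip z v"
  by (rule hip_eqI) (simp add: distrib_left has_sum_add hip_has_sum)

lemma hip_mult_right: "hip z (hract w a) = hip z w * a"
  by (rule hip_eqI)
    (simp add: mult.assoc[symmetric] has_sum_bounded_linear[OF bounded_linear_mult_left hip_has_sum])

lemma cstar_hip: "cstar (hip z w) = hip w z"
  by (rule sym, rule hip_eqI)
    (use has_sum_bounded_linear[OF bounded_linear_cstar hip_has_sum[of z w]] in \<open>simp add: cstar_mult cstar_cstar\<close>)

lemma hip_add_left: "hip (w + v) z = hip w z + hip v z"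
  by (metis cstar_hip cstar_add hip_add_right)

lemma hip_mult_left: "hip (hract w a) z = cstar a * hip w z"
  by (metis cstar_hip cstar_mult hip_mult_right)

lemma hip_scaleR_right: "hip z (r *\<^sub>R w) = r *\<^sub>R hip z w"
  by (rule hip_eqI) (simp add: has_sum_bounded_linear[OF bounded_linear_scaleR_right hip_has_sum])

lemma hip_scaleR_left: "hip (r *\<^sub>R w) z = r *\<^sub>R hip w z"
  by (metis cstar_hip cstar_scaleR hip_scaleR_right)

lemma hip_uminus_right: "hip z (- w) = - hip z w"
  using hip_scaleR_right[of z "-1" w] by simp

lemma hip_diff_right: "hip z (w - v) = hip z w - hip z v"
  using hip_add_right[of z w "- v"] by (simp add: hip_uminus_right)

lemma hip_diff_left: "hip (w - v) z = hip w z - hip v z"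
  by (metis cstar_hip cstar_diff hip_diff_right)

lemma hip_zero_right [simp]: "hip z 0 = 0"
  using hip_scaleR_right[of z 0 0] by simp

lemma cpos_has_sum:
  fixes f :: "'g \<Rightarrow> 'a::cstar_alg"
  assumes "(f has_sum s) A" "\<And>g. cpos (f g)" shows "cpos s"
proof -
  have "s \<in> {a. cpos a}"
  proof (rule Lim_in_closed_set[OF closed_cpos])
    show "(sum f \<longlongrightarrow> s) (finite_subsets_at_top A)" using assms(1) by (simp add: has_sum_def)
    show "\<forall>\<^sub>F F in finite_subsets_at_top A. sum f F \<in> {a. cpos a}"
      by (intro always_eventually allI) (simp add: cpos_sum assms(2))
  qed simp
  then show ?thesis by simp
qed

lemma cpos_hip_self: "cpos (hip z z)"
  by (rule cpos_has_sum[OF hip_has_sum]) (rule cpos_cstar_mult)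

lemma cpos_hip_minus_finite:
  assumes "finite F"
  shows "cpos (hip z z - (\<Sum>g\<in>F. csq (hcoord z g)))"
proof -
  have "((\<lambda>g. if g \<in> F then csq (hcoord z g) else 0) has_sum (\<Sum>g\<in>F. csq (hcoord z g))) UNIV"
    by (rule has_sum_cong_neutral[THEN iffD1, rotated -1, OF has_sum_finite[OF assms]]) auto
  then have "((\<lambda>g. csq (hcoord z g) + - (if g \<in> F then csq (hcoord z g) else 0)) has_sum
      (hip z z + - (\<Sum>g\<in>F. csq (hcoord z g)))) UNIV"
    by (intro has_sum_add hip_has_sum) (simp add: has_sum_uminus)
  from cpos_has_sum[OF this] show ?thesis by (auto simp: cpos_cstar_mult)
qed

lemma hip_self_eq_0_iff: "hip z z = 0 \<longleftrightarrow> z = 0"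
proof
  assume z: "hip z z = 0"
  show "z = 0"
  proof (rule hmod_eqI)
    fix g
    have "norm (csq (hcoord z g)) \<le> norm (hip z z)"
      using cpos_hip_minus_finite[of "{g}" z] by (intro cpos_mono_norm) (auto simp: cpos_cstar_mult)
    then show "hcoord z g = hcoord 0 g" using z by (simp add: cstar_mult_self_eq_0_iff)
  qed
qed simp

section \<open>Scalar inequalities under a state\<close>

lemma cstate_add: "cstate \<tau> \<Longrightarrow> \<tau> (x + y) = \<tau> x + \<tau> y"
  and cstate_scaleC: "cstate \<tau> \<Longrightarrow> \<tau> (scaleC c x) = c * \<tau> x"
  and cstate_cstar: "cstate \<tau> \<Longrightarrow> \<tau> (cstar x) = cnj (\<tau> x)"
  and cstate_norm_le: "cstate \<tau> \<Longrightarrow> cmod (\<tau> x) \<le> 2 * norm x"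
  and cstate_cpos: "cstate \<tau> \<Longrightarrow> cpos a \<Longrightarrow> Re (\<tau> a) \<ge> 0"
  and cstate_Re_le: "cstate \<tau> \<Longrightarrow> Re (\<tau> x) \<le> norm x"
  by (auto simp: cstate_def)

lemma cstate_scaleR: "cstate \<tau> \<Longrightarrow> \<tau> (r *\<^sub>R x) = of_real r * \<tau> x"
  using cstate_scaleC[of \<tau> "of_real r" x] by (simp add: scaleC_of_real)

lemma cstate_bounded_linear: "cstate \<tau> \<Longrightarrow> bounded_linear \<tau>"
  by (rule bounded_linear_intro[where K=2])
    (simp_all add: cstate_add cstate_scaleR scaleR_conv_of_real[where 'a=complex], metis cstate_norm_le mult.commute)

lemma cstate_zero: "cstate \<tau> \<Longrightarrow> \<tau> 0 = 0"
  and cstate_diff: "cstate \<tau> \<Longrightarrow> \<tau> (x - y) = \<tau> x - \<tau> y"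
  and cstate_sum: "cstate \<tau> \<Longrightarrow> \<tau> (\<Sum>i\<in>I. f i) = (\<Sum>i\<in>I. \<tau> (f i))"
  using cstate_bounded_linear[of \<tau>]
  by (auto simp: linear_0 linear_diff linear_sum bounded_linear.linear)

lemma cstate_selfadjoint: "cstate \<tau> \<Longrightarrow> cstar x = x \<Longrightarrow> \<tau> x = of_real (Re (\<tau> x))"
proof -
  assume \<tau>: "cstate \<tau>" and x: "cstar x = x"
  have "Im (\<tau> x) = - Im (\<tau> x)" using cstate_cstar[OF \<tau>, of x] x by (metis cnj.sel(2))
  then show ?thesis by (simp add: complex_eq_iff)
qed

lemma discriminant_le:
  fixes a b c :: real
  assumes nn: "\<And>t. a + 2 * t * b + t\<^sup>2 * c \<ge> 0" and c: "c \<ge> 0"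
  shows "b\<^sup>2 \<le> a * c"
proof (cases "c = 0")
  case True
  have "b = 0"
  proof (rule ccontr)
    assume "b \<noteq> 0"
    \<comment> \<open>The quadratic is affine when c = 0, and at this t it takes the value
      -1.\<close>
    then have "a + 2 * (- (a + 1) / (2 * b)) * b = - 1" by (simp add: field_simps)
    then show False using nn[of "- (a + 1) / (2 * b)"] True by simp
  qed
  then show ?thesis using True by simp
next
  case False
  then have "c > 0" using c by simp
  have "0 \<le> (a + 2 * (- b / c) * b + (- b / c)\<^sup>2 * c) * c" using nn[of "- b / c"] c by simp
  also have "\<dots> = a * c - b\<^sup>2" using False by (simp add: field_simps power2_eq_square)
  finally show ?thesis by simp
qed

text \<open>Each state turns the \<open>A\<close>-valued product into a scalar semi-inner product. A
  state that attains a norm then carries scalar inequalities back to the module.\<close>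

lemma cstate_hip_Cauchy_Schwarz:
  assumes \<tau>: "cstate \<tau>"
  shows "(Re (\<tau> (hip z w)))\<^sup>2 \<le> Re (\<tau> (hip z z)) * Re (\<tau> (hip w w))"
proof (rule discriminant_le)
  fix t :: real
  have s: "Re (\<tau> (hip w z)) = Re (\<tau> (hip z w))" using cstate_cstar[OF \<tau>, of "hip z w"] by (simp add: cstar_hip)
  have "0 \<le> Re (\<tau> (hip (z + t *\<^sub>R w) (z + t *\<^sub>R w)))" by (intro cstate_cpos[OF \<tau>] cpos_hip_self)
  also have "\<dots> = Re (\<tau> (hip z z)) + 2 * t * Re (\<tau> (hip z w)) + t\<^sup>2 * Re (\<tau> (hip w w))"
    by (simp add: hip_add_left hip_add_right hip_scaleR_left hip_scaleR_right cstate_add[OF \<tau>] cstate_scaleR[OF \<tau>]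
        s algebra_simps power2_eq_square)
  finally show "0 \<le> \<dots>" .
qed (intro cstate_cpos[OF \<tau>] cpos_hip_self)

instantiation hmod :: (type, cstar_alg) real_normed_vector
begin
definition norm_hmod :: "('a, 'b) hmod \<Rightarrow> real" where "norm_hmod z = sqrt (norm (hip z z))"
definition dist_hmod :: "('a, 'b) hmod \<Rightarrow> ('a, 'b) hmod \<Rightarrow> real" where "dist_hmod z w = norm (z - w)"
definition sgn_hmod :: "('a, 'b) hmod \<Rightarrow> ('a, 'b) hmod" where "sgn_hmod z = z /\<^sub>R norm z"
definition uniformity_hmod :: "(('a, 'b) hmod \<times> ('a, 'b) hmod) filter" where
  "uniformity_hmod = (INF e\<in>{0<..}. principal {(x, y). dist x y < e})"
definition open_hmod :: "('a, 'b) hmod set \<Rightarrow> bool" where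
  "open_hmod U = (\<forall>x\<in>U. eventually (\<lambda>(x', y). x' = x \<longrightarrow> y \<in> U) uniformity)"

instance
proof
  fix z w :: "('a, 'b) hmod" and r :: real and U :: "('a, 'b) hmod set"
  show "dist z w = norm (z - w)" by (rule dist_hmod_def)
  show "sgn z = z /\<^sub>R norm z" by (rule sgn_hmod_def)
  show "uniformity = (INF e\<in>{0<..}. principal {(x, y :: ('a, 'b) hmod). dist x y < e})"
    by (rule uniformity_hmod_def)
  show "open U \<longleftrightarrow> (\<forall>x\<in>U. eventually (\<lambda>(x', y). x' = x \<longrightarrow> y \<in> U) uniformity)"
    by (rule open_hmod_def)
  show "norm z = 0 \<longleftrightarrow> z = 0" by (simp add: norm_hmod_def hip_self_eq_0_iff)
  show "norm (r *\<^sub>R z) = \<bar>r\<bar> * norm z"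
    by (simp add: norm_hmod_def hip_scaleR_left hip_scaleR_right real_sqrt_mult mult.assoc[symmetric])
  show "norm (z + w) \<le> norm z + norm w"
  proof -
    \<comment> \<open>The state attains the squared norm of the sum, and contractivity of its real
      part bounds the squares of the two summands.\<close>
    obtain \<tau> where \<tau>: "cstate \<tau>" and eq: "\<tau> (hip (z + w) (z + w)) = of_real (norm (hip (z + w) (z + w)))"
      by (rule exists_cstate[OF cpos_hip_self])
    have s: "Re (\<tau> (hip w z)) = Re (\<tau> (hip z w))" using cstate_cstar[OF \<tau>, of "hip z w"] by (simp add: cstar_hip)
    have n: "0 \<le> Re (\<tau> (hip v v))" "Re (\<tau> (hip v v)) \<le> (norm v)\<^sup>2" for v :: "('a, 'b) hmod"
      using cstate_Re_le[OF \<tau>, of "hip v v"] cstate_cpos[OF \<tau> cpos_hip_self] by (auto simp: norm_hmod_def)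
    have "(Re (\<tau> (hip z w)))\<^sup>2 \<le> (norm z)\<^sup>2 * (norm w)\<^sup>2"
      using cstate_hip_Cauchy_Schwarz[OF \<tau>, of z w] n[of z] n[of w] by (meson mult_mono order_trans zero_le_power2)
    then have "(Re (\<tau> (hip z w)))\<^sup>2 \<le> (norm z * norm w)\<^sup>2" by (simp only: power_mult_distrib)
    then have cs: "Re (\<tau> (hip z w)) \<le> norm z * norm w"
      by (rule power2_le_imp_le) (simp add: norm_hmod_def)
    have "(norm (z + w))\<^sup>2 = Re (\<tau> (hip (z + w) (z + w)))" using eq by (simp add: norm_hmod_def)
    also have "\<dots> = Re (\<tau> (hip z z)) + 2 * Re (\<tau> (hip z w)) + Re (\<tau> (hip w w))"
      by (simp add: hip_add_left hip_add_right cstate_add[OF \<tau>] s)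
    also have "\<dots> \<le> (norm z + norm w)\<^sup>2" using n[of z] n[of w] cs by (simp add: power2_sum)
    finally show ?thesis by (rule power2_le_imp_le) (simp add: norm_hmod_def)
  qed
qed
end

lemma norm_hmod_square: "(norm (z :: ('g, 'a::cstar_alg) hmod))\<^sup>2 = norm (hip z z)"
  by (simp add: norm_hmod_def)

lemma norm_finite_gram_le:
  assumes "finite F" shows "norm (\<Sum>g\<in>F. csq (hcoord z g)) \<le> (norm z)\<^sup>2"
  unfolding norm_hmod_square
  by (rule cpos_mono_norm) (auto intro: cpos_sum cpos_cstar_mult cpos_hip_minus_finite[OF assms])

lemma norm_hcoord_le: "norm (hcoord z g) \<le> norm z"
proof (rule power2_le_imp_le)
  show "(norm (hcoord z g))\<^sup>2 \<le> (norm z)\<^sup>2"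
    using norm_finite_gram_le[of "{g}" z] by (simp add: cstar_identity)
qed simp

lemma norm_hmod_leI:
  assumes "\<And>F. finite F \<Longrightarrow> norm (\<Sum>g\<in>F. csq (hcoord z g)) \<le> C\<^sup>2" "C \<ge> 0"
  shows "norm z \<le> C"
proof (rule power2_le_imp_le)
  have "norm (hip z z) \<le> C\<^sup>2"
  proof (rule tendsto_upperbound)
    show "((\<lambda>F. norm (\<Sum>g\<in>F. csq (hcoord z g))) \<longlongrightarrow> norm (hip z z)) (finite_subsets_at_top UNIV)"
      by (intro tendsto_norm hip_has_sum[unfolded has_sum_def])
    show "\<forall>\<^sub>F F in finite_subsets_at_top UNIV. norm (\<Sum>g\<in>F. csq (hcoord z g)) \<le> C\<^sup>2"
      by (rule eventually_finite_subsets_at_top_weakI) (rule assms)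
  qed simp
  then show "(norm z)\<^sup>2 \<le> C\<^sup>2" by (simp add: norm_hmod_square)
qed (rule assms)

text \<open>For a = \<open>hip z w\<close> one has a^* a = \<open>hip (hract z a) w\<close>. A state
  attaining the norm of a^* a and the scalar Cauchy-Schwarz inequality bound (norm a)^2 by the
  product of the norms of z a and w; since norm (z a) <= norm z norm a, one factor
  \<open>norm a\<close> cancels.\<close>

lemma norm_hip_le:
  fixes z w :: "('g, 'a::cstar_alg) hmod"
  shows "norm (hip z w) \<le> norm z * norm w"
proof (cases "hip z w = 0")
  case False
  define a where "a = hip z w"
  obtain \<tau> where \<tau>: "cstate \<tau>" and eq: "\<tau> (cstar a * a) = of_real (norm (cstar a * a))"
    by (rule exists_cstate[OF cpos_cstar_mult])
  have "norm (hract z a) \<le> norm z * norm a"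
  proof (rule power2_le_imp_le)
    have "norm (hip (hract z a) (hract z a)) \<le> norm (cstar a) * norm (hip z z) * norm a"
      unfolding hip_mult_left hip_mult_right
      by (metis (no_types, opaque_lifting) mult.assoc mult_left_mono norm_ge_zero norm_mult_ineq order_trans)
    then show "(norm (hract z a))\<^sup>2 \<le> (norm z * norm a)\<^sup>2"
      by (simp add: norm_hmod_square power_mult_distrib) (simp add: power2_eq_square algebra_simps)
  qed simp
  have n: "0 \<le> Re (\<tau> (hip v v))" "Re (\<tau> (hip v v)) \<le> (norm v)\<^sup>2" for v :: "('g, 'a) hmod"
    using cstate_Re_le[OF \<tau>, of "hip v v"] cstate_cpos[OF \<tau> cpos_hip_self] by (auto simp: norm_hmod_def)
  have "((norm a)\<^sup>2)\<^sup>2 = (Re (\<tau> (hip (hract z a) w)))\<^sup>2"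
    using eq by (simp add: hip_mult_left a_def cstar_identity)
  also have "\<dots> \<le> (norm (hract z a))\<^sup>2 * (norm w)\<^sup>2"
    using cstate_hip_Cauchy_Schwarz[OF \<tau>, of "hract z a" w] n[of "hract z a"] n[of w]
    by (meson mult_mono order_trans zero_le_power2)
  also have "\<dots> = (norm (hract z a) * norm w)\<^sup>2" by (simp add: power_mult_distrib)
  finally have "(norm a)\<^sup>2 \<le> norm (hract z a) * norm w" by (rule power2_le_imp_le) simp
  also have "\<dots> \<le> norm z * norm a * norm w" using \<open>norm (hract z a) \<le> norm z * norm a\<close> by (simp add: mult_right_mono)
  finally show ?thesis using False by (simp add: a_def power2_eq_square)
qed simp

text \<open>The limit is formed coordinatewise. The finite Gram sums of l - Z n are small uniformly
  in the finite set, which yields both square-summability of l and convergence in norm.\<close>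

instance hmod :: (type, cstar_alg) banach
proof
  fix Z :: "nat \<Rightarrow> ('a, 'b) hmod" assume Z: "Cauchy Z"
  have "Cauchy (\<lambda>n. hcoord (Z n) g)" for g
  proof (rule metric_CauchyI)
    fix e :: real assume "e > 0"
    then obtain N where "\<forall>m\<ge>N. \<forall>n\<ge>N. dist (Z m) (Z n) < e" using Z by (meson metric_CauchyD)
    moreover have "dist (hcoord (Z m) g) (hcoord (Z n) g) \<le> dist (Z m) (Z n)" for m n
      using norm_hcoord_le[of "Z m - Z n" g] by (simp add: dist_norm)
    ultimately show "\<exists>N. \<forall>m\<ge>N. \<forall>n\<ge>N. dist (hcoord (Z m) g) (hcoord (Z n) g) < e"
      using order_le_less_trans by blast
  qed
  then have "\<exists>l. (\<lambda>n. hcoord (Z n) g) \<longlonglongrightarrow> l" for g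
    by (simp add: Cauchy_convergent_iff convergent_def)
  then obtain l where l: "\<And>g. (\<lambda>n. hcoord (Z n) g) \<longlonglongrightarrow> l g" by metis
  have tail: "\<exists>N. \<forall>n\<ge>N. \<forall>F. finite F \<longrightarrow> norm (\<Sum>g\<in>F. csq (l g - hcoord (Z n) g)) \<le> e\<^sup>2"
    if e: "e > 0" for e
  proof -
    obtain N where N: "\<forall>m\<ge>N. \<forall>n\<ge>N. dist (Z m) (Z n) < e" using Z e by (meson metric_CauchyD)
    have "norm (\<Sum>g\<in>F. csq (l g - hcoord (Z n) g)) \<le> e\<^sup>2"
      if n: "n \<ge> N" and F: "finite F" for n F
    proof (rule tendsto_upperbound)
      show "(\<lambda>m. norm (\<Sum>g\<in>F. csq (hcoord (Z m) g - hcoord (Z n) g)))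
        \<longlonglongrightarrow> norm (\<Sum>g\<in>F. csq (l g - hcoord (Z n) g))"
        by (intro tendsto_intros l bounded_linear.tendsto[OF bounded_linear_cstar])
      show "\<forall>\<^sub>F m in sequentially. norm (\<Sum>g\<in>F. csq (hcoord (Z m) g - hcoord (Z n) g)) \<le> e\<^sup>2"
        unfolding eventually_sequentially
      proof (intro exI allI impI)
        fix m assume "N \<le> m"
        then have "norm (Z m - Z n) \<le> e" using N n by (force simp: dist_norm)
        then have "(norm (Z m - Z n))\<^sup>2 \<le> e\<^sup>2" by (simp add: power_mono)
        then show "norm (\<Sum>g\<in>F. csq (hcoord (Z m) g - hcoord (Z n) g)) \<le> e\<^sup>2"
          using norm_finite_gram_le[OF F, of "Z m - Z n"] by simp
      qed
    qed simp
    then show ?thesis by blast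
  qed
  have sl: "sq_summable l"
    unfolding sq_summable_def summable_on_Cauchy_disjoint
  proof (intro allI impI)
    fix \<epsilon> :: real assume \<epsilon>: "\<epsilon> > 0"
    \<comment> \<open>The parallelogram bound doubles a sum of two terms of size at most \<epsilon>
      / 5, and 4 / 5 < 1.\<close>
    define e where "e = sqrt (\<epsilon> / 5)"
    have e: "e > 0" "e\<^sup>2 = \<epsilon> / 5" using \<epsilon> by (auto simp: e_def)
    obtain n where n: "\<And>F. finite F \<Longrightarrow> norm (\<Sum>g\<in>F. csq (l g - hcoord (Z n) g)) \<le> \<epsilon> / 5"
      using tail[OF e(1)] e(2) by fastforce
    obtain F0 where F0: "finite F0" "\<And>F. finite F \<Longrightarrow> F \<inter> F0 = {} \<Longrightarrow> norm (\<Sum>g\<in>F. csq (hcoord (Z n) g)) < \<epsilon> / 5"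
      using sq_summable_hcoord[of "Z n"] \<epsilon> unfolding sq_summable_def summable_on_Cauchy_disjoint
      by (metis zero_less_divide_iff zero_less_numeral)
    have "norm (\<Sum>g\<in>F. csq (l g)) < \<epsilon>" if F: "finite F" "F \<inter> F0 = {}" for F
    proof -
      let ?d = "\<lambda>g. l g - hcoord (Z n) g"
      have "norm (\<Sum>g\<in>F. csq (l g)) \<le> norm (\<Sum>g\<in>F. 2 *\<^sub>R (csq (?d g) + csq (hcoord (Z n) g)))"
      proof (rule cpos_mono_norm)
        show "cpos (\<Sum>g\<in>F. csq (l g))" by (intro cpos_sum cpos_cstar_mult)
        show "cpos ((\<Sum>g\<in>F. 2 *\<^sub>R (csq (?d g) + csq (hcoord (Z n) g))) - (\<Sum>g\<in>F. csq (l g)))"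
          unfolding sum_subtractf[symmetric]
        proof (rule cpos_sum)
          fix g
          show "cpos (2 *\<^sub>R (csq (?d g) + csq (hcoord (Z n) g)) - csq (l g))"
            using cpos_parallelogram[of "?d g" "hcoord (Z n) g"] by (simp del: scaleR_add_right)
        qed
      qed
      also have "\<dots> = 2 * norm ((\<Sum>g\<in>F. csq (?d g)) + (\<Sum>g\<in>F. csq (hcoord (Z n) g)))"
        by (simp add: scaleR_sum_right[symmetric] sum.distrib del: scaleR_add_right)
      also have "\<dots> \<le> 2 * (\<epsilon> / 5 + \<epsilon> / 5)"
        by (intro mult_left_mono order_trans[OF norm_triangle_ineq] add_mono n less_imp_le[OF F0(2)] F) simp
      also have "\<dots> < \<epsilon>" using \<epsilon> by simp
      finally show ?thesis .
    qed
    then show "\<exists>F0. finite F0 \<and> (\<forall>F. finite F \<and> F \<inter> F0 = {} \<longrightarrow> norm (\<Sum>g\<in>F. csq (l g)) < \<epsilon>)"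
      using F0(1) by blast
  qed
  have "Z \<longlonglongrightarrow> Hmod l"
  proof (rule metric_LIMSEQ_I)
    fix r :: real assume r: "r > 0"
    obtain N where N: "\<And>n F. n \<ge> N \<Longrightarrow> finite F \<Longrightarrow> norm (\<Sum>g\<in>F. csq (l g - hcoord (Z n) g)) \<le> (r/2)\<^sup>2"
      using tail[of "r/2"] r by auto
    have "dist (Z n) (Hmod l) < r" if "n \<ge> N" for n
    proof -
      have "norm (Hmod l - Z n) \<le> r / 2"
        using N[OF that] r by (intro norm_hmod_leI) (auto simp: sl)
      then show ?thesis using r by (simp add: dist_norm norm_minus_commute)
    qed
    then show "\<exists>no. \<forall>n\<ge>no. dist (Z n) (Hmod l) < r" by blast
  qed
  then show "convergent Z" by (auto simp: convergent_def)
qed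

section \<open>Adjointable operators\<close>

text \<open>Neither linearity nor boundedness is built in; both follow from the existence of an
  adjoint.\<close>

definition hadj :: "(('g, 'a::cstar_alg) hmod \<Rightarrow> ('g, 'a) hmod) \<Rightarrow> (('g, 'a) hmod \<Rightarrow> ('g, 'a) hmod) \<Rightarrow> bool" where
  "hadj T S \<longleftrightarrow> (\<forall>z w. hip (T z) w = hip z (S w))"

lemma hadjD: "hadj T S \<Longrightarrow> hip (T z) w = hip z (S w)"
  by (simp add: hadj_def)

lemma hadj_sym: "hadj T S \<Longrightarrow> hadj S T"
  unfolding hadj_def by (metis cstar_hip)

lemma hip_left_ext: "(\<And>w. hip z w = hip z' w) \<Longrightarrow> z = z'"
  using hip_self_eq_0_iff[of "z - z'"] by (simp add: hip_diff_left)

lemma hadj_linear: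
  assumes "hadj T S" shows "linear T"
proof (rule linearI)
  show "T (z + w) = T z + T w" for z w
    by (rule hip_left_ext) (simp add: hadjD[OF assms] hip_add_left)
  show "T (r *\<^sub>R z) = r *\<^sub>R T z" for r z
    by (rule hip_left_ext) (simp add: hadjD[OF assms] hip_scaleR_left)
qed

lemma hadj_comp: "hadj T S \<Longrightarrow> hadj T' S' \<Longrightarrow> hadj (T \<circ> T') (S' \<circ> S)"
  by (simp add: hadj_def)

text \<open>(norm (T z))^2 = norm (hip z (S (T z))), and one factor \<open>norm (T z)\<close>
  cancels. The constant is kept, so approximation errors pass to adjoints unchanged.\<close>

lemma hadj_bound_transfer:
  assumes adj: "hadj T S" and bd: "\<And>w. norm (S w) \<le> K * norm w"
  shows "norm (T z) \<le> K * norm z"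
proof (cases "T z = 0")
  case True
  have "0 \<le> K * norm z" using bd[of z] norm_ge_zero order_trans by blast
  then show ?thesis using True by simp
next
  case False
  have "norm (T z) * norm (T z) = norm (hip z (S (T z)))"
    using hadjD[OF adj, of z "T z"] norm_hmod_square[of "T z"] by (simp add: power2_eq_square)
  also have "\<dots> \<le> norm z * norm (S (T z))" by (rule norm_hip_le)
  also have "\<dots> \<le> norm z * (K * norm (T z))" by (intro mult_left_mono bd) simp
  finally have "norm (T z) * norm (T z) \<le> (K * norm z) * norm (T z)" by (simp only: mult_ac)
  then show ?thesis using False by simp
qed

text \<open>The uniform boundedness principle, by the gliding hump argument.\<close>

lemma hadj_bounded:
  assumes adj: "hadj T S"
  obtains K where "K \<ge> 0" "\<And>z. norm (T z) \<le> K * norm z"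
proof -
  have linS: "linear S" using hadj_linear[OF hadj_sym[OF adj]] .
  have "\<exists>K. \<forall>w. norm w \<le> 1 \<longrightarrow> norm (S w) \<le> K"
  proof (rule ccontr)
    assume "\<not> ?thesis"
    then have "\<forall>K. \<exists>w. norm w \<le> 1 \<and> norm (S w) > K" by (meson not_le)
    then have "\<forall>n::nat. \<exists>w. norm w \<le> 1 \<and> norm (S w) > 6 ^ n" by blast
    \<comment> \<open>Heights 6^n against steps of length 3^-n leave 2^n, which is
      unbounded.\<close>
    then obtain w where w: "\<And>n. norm (w n) \<le> 1" "\<And>n::nat. norm (S (w n)) > 6 ^ n" by metis
    define u where "u = (\<lambda>n. (1/3) ^ n *\<^sub>R ((1 / norm (S (w n))) *\<^sub>R S (w n)))"
    have Spos: "norm (S (w n)) > 0" for n using w(2)[of n] by (meson less_trans zero_less_numeral zero_less_power)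
    have nu: "norm (u n) = (1/3) ^ n" for n using Spos[of n] by (simp add: u_def)
    have hu: "norm (hip (S (w n)) (u n)) = (1/3) ^ n * norm (S (w n))" for n
      using Spos[of n] by (simp add: u_def hip_scaleR_right norm_hmod_square[symmetric] power2_eq_square)
    \<comment> \<open>The sign of each step makes the pairing of S (w n) with the new partial sum at
      least 3^-n norm (S (w n)): the pairings for the two signs differ by twice that amount, so one
      of them succeeds.\<close>
    define x where "x = rec_nat 0 (\<lambda>n y. if (1/3) ^ n * norm (S (w n)) \<le> norm (hip (S (w n)) (y + u n)) then y + u n else y - u n)"
    have x0: "x 0 = 0" by (simp add: x_def)
    have xS: "x (Suc n) = (if (1/3) ^ n * norm (S (w n)) \<le> norm (hip (S (w n)) (x n + u n)) then x n + u n else x n - u n)" for n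
      by (simp add: x_def)
    have hx: "(1/3) ^ n * norm (S (w n)) \<le> norm (hip (S (w n)) (x (Suc n)))" for n
    proof (cases "(1/3) ^ n * norm (S (w n)) \<le> norm (hip (S (w n)) (x n + u n))")
      case False
      have "2 *\<^sub>R hip (S (w n)) (u n) = hip (S (w n)) (x n + u n) - hip (S (w n)) (x n - u n)"
        by (simp add: hip_add_right hip_diff_right scaleR_2)
      then have "2 * norm (hip (S (w n)) (u n)) \<le> norm (hip (S (w n)) (x n + u n)) + norm (hip (S (w n)) (x n - u n))"
        using norm_triangle_ineq4[of "hip (S (w n)) (x n + u n)" "hip (S (w n)) (x n - u n)"]
        by (metis norm_scaleR abs_numeral)
      then show ?thesis using False unfolding xS hu by simp
    qed (simp add: xS)
    define d where "d = (\<lambda>n. x (Suc n) - x n)"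
    have nd: "norm (d n) \<le> (1/3) ^ n" for n by (simp add: d_def xS nu norm_minus_cancel)
    have sgeo: "summable (\<lambda>n. (1/3::real) ^ n)" by (rule summable_geometric) simp
    have sd: "summable (\<lambda>n. norm (d n))"
      by (rule summable_comparison_test'[OF sgeo, of 0]) (use nd in simp)
    define z where "z = suminf d"
    have xsum: "x n = sum d {..<n}" for n unfolding d_def by (simp add: sum_lessThan_telescope x0)
    \<comment> \<open>The steps after step n have total length at most 3^-n / 2, so at least half of
      the hump survives in the limit.\<close>
    have tail: "norm (z - x (Suc n)) \<le> (1/3) ^ n / 2" for n
    proof -
      have "z - x (Suc n) = (\<Sum>k. d (k + Suc n))"
        unfolding z_def xsum using suminf_minus_initial_segment[OF summable_norm_cancel[OF sd], of "Suc n"] by simp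
      also have "norm \<dots> \<le> (\<Sum>k. norm (d (k + Suc n)))"
        by (rule summable_norm) (use sd in \<open>simp only: summable_iff_shift[of "\<lambda>n. norm (d n)"]\<close>)
      also have "\<dots> \<le> (\<Sum>k. (1/3) ^ Suc n * (1/3) ^ k)"
      proof (rule suminf_le)
        show "norm (d (k + Suc n)) \<le> (1/3) ^ Suc n * (1/3) ^ k" for k
          using nd[of "k + Suc n"] by (simp add: power_add mult.commute)
        show "summable (\<lambda>k. norm (d (k + Suc n)))" using sd by (simp only: summable_iff_shift[of "\<lambda>n. norm (d n)"])
        show "summable (\<lambda>k. (1/3) ^ Suc n * (1/3::real) ^ k)" by (rule summable_mult[OF sgeo])
      qed
      also have "\<dots> = (1/3) ^ Suc n * (\<Sum>k. (1/3::real) ^ k)" by (rule suminf_mult[OF sgeo])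
      also have "\<dots> = (1/3) ^ n / 2" by (simp add: suminf_geometric)
      finally show ?thesis .
    qed
    have big: "2 ^ n / 2 \<le> norm (T z)" for n :: nat
    proof -
      have "(1/3) ^ n * norm (S (w n)) \<le> norm (hip (S (w n)) (x (Suc n)))" by (rule hx)
      also have "hip (S (w n)) (x (Suc n)) = hip (S (w n)) z - hip (S (w n)) (z - x (Suc n))"
        by (simp add: hip_diff_right)
      also have "norm \<dots> \<le> norm (hip (S (w n)) z) + norm (hip (S (w n)) (z - x (Suc n)))" by (rule norm_triangle_ineq4)
      also have "norm (hip (S (w n)) (z - x (Suc n))) \<le> norm (S (w n)) * ((1/3) ^ n / 2)"
        by (rule order_trans[OF norm_hip_le]) (intro mult_left_mono tail norm_ge_zero)
      also have "norm (hip (S (w n)) z) \<le> norm (T z)"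
      proof -
        have "hip (S (w n)) z = hip (w n) (T z)" using hadjD[OF hadj_sym[OF adj]] by simp
        then show ?thesis using norm_hip_le[of "w n" "T z"] w(1)[of n]
          by (simp add: mult_left_le_one_le order_trans)
      qed
      finally have "(1/3) ^ n * norm (S (w n)) / 2 \<le> norm (T z)" by (simp add: field_simps)
      moreover have "(1/3) ^ n * 6 ^ n \<le> (1/3) ^ n * norm (S (w n))" using w(2)[of n] by (intro mult_left_mono) auto
      moreover have "(1/3::real) ^ n * 6 ^ n = 2 ^ n" by (simp add: power_mult_distrib[symmetric])
      ultimately show ?thesis by linarith
    qed
    obtain n :: nat where "2 * norm (T z) < 2 ^ n" using real_arch_pow[of 2] by auto
    then show False using big[of n] by simp
  qed
  then obtain K where K: "\<And>w. norm w \<le> 1 \<Longrightarrow> norm (S w) \<le> K" by blast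
  have "norm (S w) \<le> K * norm w" for w
  proof (cases "w = 0")
    case False
    have "norm (S ((1 / norm w) *\<^sub>R w)) \<le> K" using False by (intro K) simp
    then show ?thesis using False by (simp add: linear_scale[OF linS] divide_simps)
  qed (simp add: linear_0[OF linS])
  moreover have "K \<ge> 0" using K[of 0] norm_ge_zero order_trans by (metis norm_zero zero_le_one)
  ultimately show thesis using hadj_bound_transfer[OF adj] that by metis
qed

lemma hadj_bounded_linear: "hadj T S \<Longrightarrow> bounded_linear T"
proof -
  assume adj: "hadj T S"
  obtain K where "\<And>z. norm (T z) \<le> K * norm z" using hadj_bounded[OF adj] by metis
  then show ?thesis using hadj_linear[OF adj]
    by (intro bounded_linear_intro[where K=K]) (auto simp: linear_add linear_scale mult.commute)
qed

text \<open>A fixed factor C disappears on taking roots of order 2^n: otherwise the powers of a / b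
  > 1 would stay below C.\<close>

lemma le_of_power_2_power_le:
  fixes a b C :: real
  assumes "a \<ge> 0" "b \<ge> 0" "\<And>n. a ^ 2 ^ n \<le> C * b ^ 2 ^ n"
  shows "a \<le> b"
proof (rule ccontr)
  assume "\<not> a \<le> b"
  then have ab: "b < a" by simp
  have "b \<noteq> 0"
  proof
    assume "b = 0"
    then have "a \<le> 0" using assms(3)[of 0] by simp
    then show False using ab \<open>b = 0\<close> by simp
  qed
  then have bp: "b > 0" using assms by simp
  define c where "c = a / b"
  have c: "c > 1" using ab bp by (simp add: c_def)
  have "c ^ n \<le> C" for n
  proof -
    have "c ^ n \<le> c ^ 2 ^ n" using c by (intro power_increasing) (auto simp: less_imp_le)
    also have "\<dots> \<le> C" using assms(3)[of n] bp by (simp add: c_def power_divide divide_simps)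
    finally show ?thesis .
  qed
  then show False using real_arch_pow[OF c, of C] by (meson not_le)
qed

text \<open>K bounds norms, but the claim concerns an arbitrary state. With Y = S T, q =
  \<open>Re (\<tau> (hip z z))\<close> and p_n the real part of the state at
  \<open>hip z ((Y ^^ (2 ^ n)) z)\<close>, Cauchy-Schwarz gives p_n^2 <= q p_(n+1). Iteration bounds
  p_0^(2^n) q by q^(2^n) p_n, the norm bound gives p_n <= (K^2)^(2^n) (norm z)^2, and roots of order
  2^n leave p_0 <= K^2 q.\<close>

lemma cstate_hip_operator_le:
  assumes adj: "hadj T S" and bd: "\<And>z. norm (T z) \<le> K * norm z" and K: "K \<ge> 0" and \<tau>: "cstate \<tau>"
  shows "Re (\<tau> (hip (T z) (T z))) \<le> K\<^sup>2 * Re (\<tau> (hip z z))"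
proof -
  define Y where "Y = S \<circ> T"
  have Ysym: "hip (Y v) w = hip v (Y w)" for v w
    using hadjD[OF adj] hadjD[OF hadj_sym[OF adj]] by (simp add: Y_def)
  have Ypow: "hip ((Y ^^ m) v) w = hip v ((Y ^^ m) w)" for m v w
    by (induction m arbitrary: v w) (auto simp: Ysym funpow_swap1)
  have bdS: "norm (S v) \<le> K * norm v" for v by (rule hadj_bound_transfer[OF hadj_sym[OF adj] bd])
  have Ybd: "norm ((Y ^^ m) v) \<le> (K\<^sup>2) ^ m * norm v" for m v
  proof (induction m)
    case (Suc m)
    have "norm ((Y ^^ Suc m) v) \<le> K * (K * norm ((Y ^^ m) v))"
      using bdS bd K by (simp add: Y_def) (meson mult_left_mono order_trans)
    also have "\<dots> \<le> K * (K * ((K\<^sup>2) ^ m * norm v))" using Suc K by (intro mult_left_mono) auto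
    finally show ?case by (simp add: power2_eq_square mult.assoc)
  qed simp
  define q where "q = Re (\<tau> (hip z z))"
  define p where "p = (\<lambda>n. Re (\<tau> (hip z ((Y ^^ (2 ^ n)) z))))"
  have q0: "q \<ge> 0" unfolding q_def by (intro cstate_cpos[OF \<tau>] cpos_hip_self)
  have p0: "p 0 = Re (\<tau> (hip (T z) (T z)))" using hadjD[OF adj] by (simp add: p_def Y_def)
  have p0n: "p 0 \<ge> 0" unfolding p0 by (intro cstate_cpos[OF \<tau>] cpos_hip_self)
  have pS: "(p n)\<^sup>2 \<le> q * p (Suc n)" for n
  proof -
    have "hip z ((Y ^^ (2 ^ Suc n)) z) = hip ((Y ^^ (2 ^ n)) z) ((Y ^^ (2 ^ n)) z)"
      by (simp add: Ypow mult_2 funpow_add)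
    then show ?thesis using cstate_hip_Cauchy_Schwarz[OF \<tau>, of z "(Y ^^ (2 ^ n)) z"] by (simp add: p_def q_def)
  qed
  show ?thesis
  proof (cases "q = 0")
    case True
    then have "p 0 = 0" using pS[of 0] by simp
    then show ?thesis using True by (simp add: p0 q_def)
  next
    case False
    then have qp: "q > 0" using q0 by simp
    have ind: "p 0 ^ 2 ^ n * q \<le> q ^ 2 ^ n * p n" for n
    proof (induction n)
      case (Suc n)
      have "p 0 ^ 2 ^ Suc n * q * q = (p 0 ^ 2 ^ n * q)\<^sup>2"
        by (simp add: power_mult[symmetric] power2_eq_square mult_2 power_add)
      also have "\<dots> \<le> (q ^ 2 ^ n * p n)\<^sup>2" using Suc p0n q0 by (intro power_mono) auto
      also have "\<dots> = q ^ 2 ^ Suc n * (p n)\<^sup>2" by (simp add: power2_eq_square mult_2 power_add)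
      also have "\<dots> \<le> q ^ 2 ^ Suc n * (q * p (Suc n))" using pS q0 by (intro mult_left_mono) auto
      finally have "(p 0 ^ 2 ^ Suc n * q) * q \<le> (q ^ 2 ^ Suc n * p (Suc n)) * q" by (simp only: mult_ac)
      then show ?case using qp by (rule mult_right_le_imp_le)
    qed simp
    have pb: "p n \<le> (K\<^sup>2) ^ 2 ^ n * (norm z)\<^sup>2" for n
    proof -
      have "p n \<le> norm (hip z ((Y ^^ (2 ^ n)) z))" unfolding p_def by (rule cstate_Re_le[OF \<tau>])
      also have "\<dots> \<le> norm z * norm ((Y ^^ (2 ^ n)) z)" by (rule norm_hip_le)
      also have "\<dots> \<le> norm z * ((K\<^sup>2) ^ 2 ^ n * norm z)" by (intro mult_left_mono Ybd) simp
      finally show ?thesis by (simp add: power2_eq_square mult.commute mult.left_commute)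
    qed
    have "p 0 \<le> K\<^sup>2 * q"
    proof (rule le_of_power_2_power_le[where C="(norm z)\<^sup>2 / q"])
      fix n
      have "p 0 ^ 2 ^ n * q \<le> q ^ 2 ^ n * ((K\<^sup>2) ^ 2 ^ n * (norm z)\<^sup>2)"
        using ind[of n] pb[of n] q0 by (meson mult_left_mono order_trans zero_le_power)
      then show "p 0 ^ 2 ^ n \<le> (norm z)\<^sup>2 / q * (K\<^sup>2 * q) ^ 2 ^ n"
        using qp by (simp add: field_simps power_mult_distrib)
    qed (use p0n q0 in auto)
    then show ?thesis by (simp add: p0 q_def)
  qed
qed

section \<open>The module \<open>A\<^sup>\<Sigma>\<close> in standard form\<close>

lemma ginv_mult_cancel [simp]: "ginv g * (g * h) = (h::'g::discrete_group)"
  by (simp add: mult.assoc[symmetric] ginv_left)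

lemma mult_ginv_cancel [simp]: "g * (ginv g * h) = (h::'g::discrete_group)"
  by (simp add: mult.assoc[symmetric] ginv_right)

lemma ginv_unique: "g * h = 1 \<Longrightarrow> h = ginv (g::'g::discrete_group)"
  using ginv_mult_cancel[of g h] by simp

lemma ginv_ginv [simp]: "ginv (ginv g) = (g::'g::discrete_group)"
  using ginv_unique[of "ginv g" g] by (simp add: ginv_left)

lemma ginv_mult: "ginv (g * h) = ginv h * ginv (g::'g::discrete_group)"
  by (rule ginv_unique[symmetric]) (simp add: mult.assoc ginv_right)

lemma ginv_one [simp]: "ginv (1::'g::discrete_group) = 1"
  using ginv_unique[of "1::'g" 1] by simp

lemma bij_left_mult: "bij (\<lambda>h. g * h :: 'g::discrete_group)"
  by (rule bij_betw_byWitness[where f'="\<lambda>h. ginv g * h"]) auto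

section \<open>Automorphisms and the change of coordinates\<close>

lemma star_automorphism_inv:
  fixes \<phi> :: "'a::cstar_alg \<Rightarrow> 'a"
  assumes "star_automorphism \<phi>" shows "star_automorphism (inv \<phi>)"
proof -
  have b: "bij \<phi>" using assms by (simp add: star_automorphism_def)
  have s [simp]: "\<phi> (inv \<phi> x) = x" for x using b by (simp add: bij_is_surj surj_f_inv_f)
  have eq: "inv \<phi> x = y \<longleftrightarrow> x = \<phi> y" for x y using b by (metis bij_inv_eq_iff)
  show ?thesis using assms unfolding star_automorphism_def by (auto simp: eq bij_imp_bij_inv)
qed

text \<open>An automorphism preserves positivity and scalars, so it carries x^* x <= (norm x)^2 to
  the same bound for the image of x.\<close>

lemma star_automorphism_norm_le:
  fixes \<phi> :: "'a::cstar_alg \<Rightarrow> 'a"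
  assumes \<phi>: "star_automorphism \<phi>" shows "norm (\<phi> x) \<le> norm x"
proof -
  have add: "\<phi> (x + y) = \<phi> x + \<phi> y" and mul: "\<phi> (x * y) = \<phi> x * \<phi> y" and st: "\<phi> (cstar x) = cstar (\<phi> x)"
    and sc: "\<phi> (scaleC c x) = scaleC c (\<phi> x)" and one: "\<phi> 1 = 1" for x y c
    using \<phi> by (auto simp: star_automorphism_def)
  have pos: "cpos (\<phi> a)" if a: "cpos a" for a
  proof -
    obtain r where r: "cpos r" "r * r = a" using cpos_sqrt[OF a] by blast
    have "cstar (\<phi> r) = \<phi> r" using r(1) st[of r] by (simp add: cpos_def)
    then have "cpos (\<phi> r * \<phi> r)" by (rule cpos_square)
    then show ?thesis using r(2) mul by metis
  qed
  have ofr: "\<phi> (of_real r) = of_real r" for r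
    using sc[of "complex_of_real r" 1] by (simp add: scaleC_of_real one of_real_def[where 'a='a])
  have minus: "\<phi> (x - y) = \<phi> x - \<phi> y" for x y
    using add[of "x - y" y] by simp
  have "norm (\<phi> (cstar x * x)) \<le> norm (cstar x * x)"
  proof (rule cpos_le_of_real)
    show "cpos (\<phi> (cstar x * x))" by (intro pos cpos_cstar_mult)
    have "cpos (of_real (norm (cstar x * x)) - cstar x * x)"
      by (rule cpos_norm_minus) (simp add: cstar_mult cstar_cstar)
    from pos[OF this] show "cpos (of_real (norm (cstar x * x)) - \<phi> (cstar x * x))"
      by (simp only: minus ofr)
  qed
  then have "(norm (\<phi> x))\<^sup>2 \<le> (norm x)\<^sup>2" by (simp add: mul st cstar_identity)
  then show ?thesis by (rule power2_le_imp_le) simp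
qed

locale twisted_system =
  fixes \<alpha> :: "'g::discrete_group \<Rightarrow> 'a::cstar_alg \<Rightarrow> 'a" and \<sigma> :: "'g \<Rightarrow> 'g \<Rightarrow> 'a"
  assumes twisted: "twisted \<alpha> \<sigma>"
begin

definition \<beta> :: "'g \<Rightarrow> 'a \<Rightarrow> 'a" where "\<beta> g = inv (\<alpha> g)"

lemma star_automorphism: "star_automorphism (\<alpha> g)" "star_automorphism (\<beta> g)"
  using twisted star_automorphism_inv by (auto simp: twisted_def \<beta>_def)

lemma act_simps:
  "\<alpha> g (x + y) = \<alpha> g x + \<alpha> g y" "\<alpha> g (scaleC c x) = scaleC c (\<alpha> g x)" "\<alpha> g (x * y) = \<alpha> g x * \<alpha> g y"
  "\<alpha> g (cstar x) = cstar (\<alpha> g x)" "\<alpha> g 1 = 1"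
  "\<beta> g (x + y) = \<beta> g x + \<beta> g y" "\<beta> g (scaleC c x) = scaleC c (\<beta> g x)" "\<beta> g (x * y) = \<beta> g x * \<beta> g y"
  "\<beta> g (cstar x) = cstar (\<beta> g x)" "\<beta> g 1 = 1"
  using star_automorphism[of g] by (auto simp: star_automorphism_def)

lemma act_zero [simp]: "\<alpha> g 0 = 0" "\<beta> g 0 = 0"
  using act_simps(1,6)[of g 0 0] by simp_all

lemma act_sum: "\<alpha> g (\<Sum>i\<in>I. f i) = (\<Sum>i\<in>I. \<alpha> g (f i))" "\<beta> g (\<Sum>i\<in>I. f i) = (\<Sum>i\<in>I. \<beta> g (f i))"
  by (induction I rule: infinite_finite_induct) (auto simp: act_simps)

lemma act_inverse [simp]: "\<alpha> g (\<beta> g x) = x" "\<beta> g (\<alpha> g x) = x"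
proof -
  have "bij (\<alpha> g)" using star_automorphism[of g] by (simp add: star_automorphism_def)
  then show "\<alpha> g (\<beta> g x) = x" "\<beta> g (\<alpha> g x) = x"
    by (simp_all add: \<beta>_def bij_is_surj surj_f_inv_f bij_is_inj)
qed

lemma norm_act [simp]: "norm (\<alpha> g x) = norm x" "norm (\<beta> g x) = norm x"
  using star_automorphism_norm_le[OF star_automorphism(1), of g] star_automorphism_norm_le[OF star_automorphism(2), of g]
  by (metis act_inverse order_antisym)+

lemma sigma_unitary: "csq (\<sigma> g h) = 1" "\<sigma> g h * cstar (\<sigma> g h) = 1"
  using twisted by (auto simp: twisted_def unitary_el_def)

lemma act_act: "\<alpha> g (\<alpha> h x) = \<sigma> g h * \<alpha> (g * h) x * cstar (\<sigma> g h)"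
  using twisted by (simp add: twisted_def)

lemma cocycle: "\<sigma> g h * \<sigma> (g * h) k = \<alpha> g (\<sigma> h k) * \<sigma> g (h * k)"
  using twisted by (simp add: twisted_def)

lemma sigma_one [simp]: "\<sigma> g 1 = 1" "\<sigma> 1 g = 1"
  using twisted by (simp_all add: twisted_def)

lemma norm_sigma [simp]: "norm (\<sigma> g h) = 1"
proof -
  have "(norm (\<sigma> g h))\<^sup>2 = 1" by (simp add: cstar_identity[symmetric] sigma_unitary)
  then show ?thesis by (simp add: power2_eq_1_iff) (metis norm_ge_zero not_one_le_zero neg_0_le_iff_le)
qed

definition toH :: "('g \<Rightarrow> 'a) \<Rightarrow> ('g, 'a) hmod" where "toH \<xi> = Hmod (\<lambda>g. \<beta> g (\<xi> g))"
definition fromH :: "('g, 'a) hmod \<Rightarrow> 'g \<Rightarrow> 'a" where "fromH z = (\<lambda>g. \<alpha> g (hcoord z g))"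

lemma AS_iff: "\<xi> \<in> AS \<alpha> \<longleftrightarrow> sq_summable (\<lambda>g. \<beta> g (\<xi> g))"
  by (simp add: AS_def sq_summable_def \<beta>_def[symmetric] act_simps)

lemma hcoord_toH: "\<xi> \<in> AS \<alpha> \<Longrightarrow> hcoord (toH \<xi>) g = \<beta> g (\<xi> g)"
  by (simp add: toH_def AS_iff)

lemma fromH_AS [simp]: "fromH z \<in> AS \<alpha>"
  by (simp add: AS_iff fromH_def)

lemma toH_fromH [simp]: "toH (fromH z) = z"
  by (rule hmod_eqI) (simp add: hcoord_toH, simp add: fromH_def)

lemma fromH_toH [simp]: "\<xi> \<in> AS \<alpha> \<Longrightarrow> fromH (toH \<xi>) = \<xi>"
  by (simp add: fromH_def hcoord_toH)

lemma ip_toH: "\<xi> \<in> AS \<alpha> \<Longrightarrow> \<eta> \<in> AS \<alpha> \<Longrightarrow> ip \<alpha> \<xi> \<eta> = hip (toH \<xi>) (toH \<eta>)"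
  by (simp add: ip_def hip_def hcoord_toH \<beta>_def[symmetric] act_simps)

text \<open>Operators are functions on all families, so their value off the module is pinned to 0;
  this makes \<open>tr\<close> injective on them.\<close>

definition preserves :: "('g, 'a) op \<Rightarrow> bool" where
  "preserves T \<longleftrightarrow> T = restr \<alpha> T \<and> (\<forall>\<xi>\<in>AS \<alpha>. T \<xi> \<in> AS \<alpha>)"

lemma preservesI: "(\<And>\<xi>. \<xi> \<in> AS \<alpha> \<Longrightarrow> T \<xi> \<in> AS \<alpha>) \<Longrightarrow> (\<And>\<xi>. \<xi> \<notin> AS \<alpha> \<Longrightarrow> T \<xi> = (\<lambda>_. 0)) \<Longrightarrow> preserves T"
  unfolding preserves_def restr_def by auto

lemma preserves_AS: "preserves T \<Longrightarrow> \<xi> \<in> AS \<alpha> \<Longrightarrow> T \<xi> \<in> AS \<alpha>"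
  unfolding preserves_def by blast

lemma preserves_outside: "preserves T \<Longrightarrow> \<xi> \<notin> AS \<alpha> \<Longrightarrow> T \<xi> = (\<lambda>_. 0)"
  unfolding preserves_def restr_def by metis

definition tr :: "('g, 'a) op \<Rightarrow> ('g, 'a) hmod \<Rightarrow> ('g, 'a) hmod" where
  "tr T z = toH (T (fromH z))"

definition untr :: "(('g, 'a) hmod \<Rightarrow> ('g, 'a) hmod) \<Rightarrow> ('g, 'a) op" where
  "untr S = restr \<alpha> (\<lambda>\<xi>. fromH (S (toH \<xi>)))"

lemma preserves_untr [simp]: "preserves (untr S)" and tr_untr [simp]: "tr (untr S) = S"
  by (auto simp: untr_def restr_def tr_def fun_eq_iff intro!: preservesI)

lemma untr_tr: "preserves T \<Longrightarrow> untr (tr T) = T"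
  by (rule ext) (simp add: untr_def restr_def tr_def preserves_AS preserves_outside)

lemma tr_inject: "preserves T \<Longrightarrow> preserves S \<Longrightarrow> tr T = tr S \<Longrightarrow> T = S"
  by (metis untr_tr)

lemma hcoord_tr: "preserves T \<Longrightarrow> hcoord (tr T z) g = \<beta> g (T (fromH z) g)"
  by (simp add: tr_def hcoord_toH preserves_AS)

lemma is_adjoint_iff:
  assumes "preserves T" "\<forall>\<xi>\<in>AS \<alpha>. S \<xi> \<in> AS \<alpha>"
  shows "is_adjoint \<alpha> T S \<longleftrightarrow> hadj (tr T) (tr S)"
proof
  assume a: "is_adjoint \<alpha> T S"
  show "hadj (tr T) (tr S)"
    unfolding hadj_def tr_def
  proof (intro allI)
    fix z w
    have "ip \<alpha> (T (fromH z)) (fromH w) = ip \<alpha> (fromH z) (S (fromH w))"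
      using a by (simp add: is_adjoint_def)
    then show "hip (toH (T (fromH z))) w = hip z (toH (S (fromH w)))"
      using assms by (simp add: ip_toH preserves_AS)
  qed
next
  assume a: "hadj (tr T) (tr S)"
  show "is_adjoint \<alpha> T S"
    unfolding is_adjoint_def
  proof (intro ballI)
    fix \<xi> \<eta> assume "\<xi> \<in> AS \<alpha>" "\<eta> \<in> AS \<alpha>"
    then show "ip \<alpha> (T \<xi>) \<eta> = ip \<alpha> \<xi> (S \<eta>)"
      using assms hadjD[OF a, of "toH \<xi>" "toH \<eta>"] by (simp add: ip_toH preserves_AS tr_def)
  qed
qed

lemma Lmod_iff: "T \<in> Lmod \<alpha> \<longleftrightarrow> preserves T \<and> (\<exists>S. hadj (tr T) S)"
proof
  assume "T \<in> Lmod \<alpha>"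
  then show "preserves T \<and> (\<exists>S. hadj (tr T) S)"
    unfolding Lmod_def using is_adjoint_iff preserves_def by blast
next
  assume a: "preserves T \<and> (\<exists>S. hadj (tr T) S)"
  then obtain S where "hadj (tr T) (tr (untr S))" by auto
  then have "is_adjoint \<alpha> T (untr S)"
    using a preserves_untr[of S] by (subst is_adjoint_iff) (auto simp: preserves_AS)
  moreover have "\<forall>\<xi>\<in>AS \<alpha>. untr S \<xi> \<in> AS \<alpha>" by (simp add: preserves_AS)
  ultimately show "T \<in> Lmod \<alpha>" using a unfolding Lmod_def preserves_def by blast
qed

text \<open>Boundedness makes the supremum in \<open>opnorm\<close> an actual least upper
  bound.\<close>

lemma opnorm_tr:
  assumes p: "preserves T" and b: "bounded_linear (tr T)"
  shows "opnorm \<alpha> T = onorm (tr T)"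
proof -
  have nrm: "sqrt (norm (ip \<alpha> \<xi> \<xi>)) = norm (toH \<xi>)" if "\<xi> \<in> AS \<alpha>" for \<xi>
    using that by (simp add: ip_toH norm_hmod_def)
  have "{sqrt (norm (ip \<alpha> (T \<xi>) (T \<xi>))) | \<xi>. \<xi> \<in> AS \<alpha> \<and> sqrt (norm (ip \<alpha> \<xi> \<xi>)) \<le> 1}
     = {norm (tr T z) | z. norm z \<le> 1}" (is "?A = ?B")
  proof (intro set_eqI iffI)
    fix x assume "x \<in> ?A"
    then obtain \<xi> where \<xi>: "\<xi> \<in> AS \<alpha>" "sqrt (norm (ip \<alpha> \<xi> \<xi>)) \<le> 1" "x = sqrt (norm (ip \<alpha> (T \<xi>) (T \<xi>)))"
      by blast
    then have "norm (toH \<xi>) \<le> 1" "x = norm (tr T (toH \<xi>))"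
      using nrm[OF \<xi>(1)] nrm[OF preserves_AS[OF p \<xi>(1)]] by (simp_all add: tr_def)
    then show "x \<in> ?B" by blast
  next
    fix x assume "x \<in> ?B"
    then obtain z where z: "norm z \<le> 1" "x = norm (tr T z)" by blast
    have "x = sqrt (norm (ip \<alpha> (T (fromH z)) (T (fromH z))))" "sqrt (norm (ip \<alpha> (fromH z) (fromH z))) \<le> 1"
      using z nrm[OF fromH_AS, of z] nrm[OF preserves_AS[OF p fromH_AS], of z] by (simp_all add: tr_def)
    then show "x \<in> ?A" by (intro CollectI exI[of _ "fromH z"]) simp
  qed
  then have eq: "opnorm \<alpha> T = Sup {norm (tr T z) | z. norm z \<le> 1}" by (simp add: opnorm_def)
  show ?thesis
    unfolding eq
  proof (rule cSup_eq_non_empty)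
    show "{norm (tr T z) | z. norm z \<le> 1} \<noteq> {}" by (auto intro: exI[of _ 0])
    show "x \<le> onorm (tr T)" if x: "x \<in> {norm (tr T z) | z. norm z \<le> 1}" for x
    proof -
      obtain z where z: "norm z \<le> 1" "x = norm (tr T z)" using x by blast
      have "x \<le> onorm (tr T) * norm z" using z onorm[OF b] by simp
      also have "\<dots> \<le> onorm (tr T)" using z(1) onorm_pos_le[OF b] by (simp add: mult_left_le)
      finally show ?thesis .
    qed
    show "onorm (tr T) \<le> y" if y: "\<And>x. x \<in> {norm (tr T z) | z. norm z \<le> 1} \<Longrightarrow> x \<le> y" for y
    proof (rule onorm_bound)
      have "norm (tr T 0) \<le> y" by (rule y) (auto intro!: exI[of _ 0])
      then show "0 \<le> y" using norm_ge_zero order_trans by blast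
      fix z
      show "norm (tr T z) \<le> y * norm z"
      proof (cases "z = 0")
        case False
        have "norm (tr T ((1 / norm z) *\<^sub>R z)) \<le> y" using False by (intro y CollectI exI conjI) auto
        then show ?thesis using False
          by (simp add: linear_scale[OF bounded_linear.linear[OF b]] divide_simps)
      qed (simp add: linear_0[OF bounded_linear.linear[OF b]])
    qed
  qed
qed

lemma preserves_op_add: "preserves T \<Longrightarrow> preserves S \<Longrightarrow> preserves (op_add T S)"
  and tr_op_add: "preserves T \<Longrightarrow> preserves S \<Longrightarrow> tr (op_add T S) = (\<lambda>z. tr T z + tr S z)"
proof -
  assume T: "preserves T" and S: "preserves S"
  have "op_add T S = untr (\<lambda>z. tr T z + tr S z)"
  proof (rule ext)
    fix \<xi>
    show "op_add T S \<xi> = untr (\<lambda>z. tr T z + tr S z) \<xi>"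
    proof (cases "\<xi> \<in> AS \<alpha>")
      case True
      then show ?thesis using T S
        by (simp add: op_add_def untr_def restr_def fun_eq_iff fromH_def[of "_ + _"] hcoord_tr act_simps)
    next
      case False
      then have "T \<xi> = (\<lambda>_. 0)" "S \<xi> = (\<lambda>_. 0)" using T S by (simp_all add: preserves_outside)
      then show ?thesis using False by (simp add: op_add_def untr_def restr_def)
    qed
  qed
  then show "preserves (op_add T S)" "tr (op_add T S) = (\<lambda>z. tr T z + tr S z)" by simp_all
qed

text \<open>Complex scalars act as right multiplication by scalars of \<open>A\<close>, since
  \<open>hmod\<close> carries only a real vector space structure.\<close>

definition hscale :: "complex \<Rightarrow> ('g, 'a) hmod \<Rightarrow> ('g, 'a) hmod" where
  "hscale c z = hract z (scaleC c 1)"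

lemma hcoord_hscale [simp]: "hcoord (hscale c z) g = scaleC c (hcoord z g)"
  by (simp add: hscale_def scaleC_mult_right)

lemma preserves_op_scale: "preserves T \<Longrightarrow> preserves (op_scale c T)"
  and tr_op_scale: "preserves T \<Longrightarrow> tr (op_scale c T) = (\<lambda>z. hscale c (tr T z))"
proof -
  assume T: "preserves T"
  have "op_scale c T = untr (\<lambda>z. hscale c (tr T z))"
  proof (rule ext)
    fix \<xi>
    show "op_scale c T \<xi> = untr (\<lambda>z. hscale c (tr T z)) \<xi>"
    proof (cases "\<xi> \<in> AS \<alpha>")
      case True
      then show ?thesis using T
        by (simp add: op_scale_def untr_def restr_def fun_eq_iff fromH_def[of "hscale _ _"] hcoord_tr act_simps)
    next
      case False
      then have "T \<xi> = (\<lambda>_. 0)" using T by (simp add: preserves_outside)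
      then show ?thesis using False by (simp add: op_scale_def untr_def restr_def)
    qed
  qed
  then show "preserves (op_scale c T)" "tr (op_scale c T) = (\<lambda>z. hscale c (tr T z))" by simp_all
qed

lemma op_diff_eq: "op_diff T S = op_add T (op_scale (-1) S)"
  by (simp add: op_diff_def op_add_def op_scale_def scaleC_uminus_left)

lemma preserves_op_diff: "preserves T \<Longrightarrow> preserves S \<Longrightarrow> preserves (op_diff T S)"
  by (simp add: op_diff_eq preserves_op_add preserves_op_scale)

lemma tr_op_diff: "preserves T \<Longrightarrow> preserves S \<Longrightarrow> tr (op_diff T S) = (\<lambda>z. tr T z - tr S z)"
  by (auto simp: op_diff_eq tr_op_add preserves_op_scale tr_op_scale fun_eq_iff scaleC_uminus_left intro!: hmod_eqI)

lemma preserves_comp: "preserves T \<Longrightarrow> preserves S \<Longrightarrow> preserves (restr \<alpha> (T \<circ> S))"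
  and tr_comp: "preserves T \<Longrightarrow> preserves S \<Longrightarrow> tr (restr \<alpha> (T \<circ> S)) = tr T \<circ> tr S"
  by (auto simp: restr_def tr_def fun_eq_iff preserves_AS intro!: preservesI)

end

section \<open>Density of \<open>\<Lambda>(C\<^sub>c(\<Sigma>))\<close>\<close>

text \<open>Weighted left translation, the common shape of both kinds of generators in the new
  coordinates.\<close>

definition band :: "'g::discrete_group \<Rightarrow> ('g \<Rightarrow> 'a::cstar_alg) \<Rightarrow> ('g, 'a) hmod \<Rightarrow> ('g, 'a) hmod" where
  "band g m z = Hmod (\<lambda>h. m h * hcoord z (ginv g * h))"

lemma sq_summable_shift:
  fixes z :: "'g::discrete_group \<Rightarrow> 'a::cstar_alg"
  assumes "sq_summable z" shows "sq_summable (\<lambda>h. z (g * h))"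
  using assms summable_on_reindex_bij_betw[OF bij_left_mult[of g], of "\<lambda>h. csq (z h)"]
  by (simp add: sq_summable_def)

lemma hcoord_band:
  assumes "\<And>h. norm (m h) \<le> C"
  shows "hcoord (band g m z) h = m h * hcoord z (ginv g * h)"
  unfolding band_def
  by (subst hcoord_Hmod) (auto intro!: sq_summable_mult_left[OF sq_summable_shift[OF sq_summable_hcoord] assms])

lemma hadj_band:
  fixes m :: "'g::discrete_group \<Rightarrow> 'a::cstar_alg"
  assumes m: "\<And>h. norm (m h) \<le> C"
  shows "hadj (band g m) (band (ginv g) (\<lambda>k. cstar (m (g * k))))"
  unfolding hadj_def
proof (intro allI)
  fix z w :: "('g, 'a) hmod"
  have m': "norm (cstar (m (g * k))) \<le> C" for k by (simp add: m)
  have "hip (band g m z) w = (\<Sum>\<^sub>\<infinity>h. cstar (m h * hcoord z (ginv g * h)) * hcoord w h)"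
    by (simp add: hip_def hcoord_band[OF m])
  also have "\<dots> = (\<Sum>\<^sub>\<infinity>k. cstar (m (g * k) * hcoord z (ginv g * (g * k))) * hcoord w (g * k))"
    by (rule infsum_reindex_bij_betw[OF bij_left_mult, symmetric])
  also have "\<dots> = hip z (band (ginv g) (\<lambda>k. cstar (m (g * k))) w)"
    by (simp add: hip_def hcoord_band[OF m'] cstar_mult mult.assoc)
  finally show "hip (band g m z) w = hip z (band (ginv g) (\<lambda>k. cstar (m (g * k))) w)" .
qed

lemma norm_band_le:
  fixes m :: "'g::discrete_group \<Rightarrow> 'a::cstar_alg"
  assumes m: "\<And>h. norm (m h) \<le> C"
  shows "norm (band g m z) \<le> C * norm z"
proof (rule norm_hmod_leI)
  have C: "C \<ge> 0" using m[of 1] norm_ge_zero order_trans by blast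
  then show "0 \<le> C * norm z" by simp
  fix F :: "'g set" assume F: "finite F"
  let ?y = "\<lambda>h. hcoord z (ginv g * h)"
  have "norm (\<Sum>h\<in>F. csq (m h * ?y h)) \<le> norm (\<Sum>h\<in>F. C\<^sup>2 *\<^sub>R (csq (?y h)))"
    by (rule cpos_mono_norm)
      (auto simp: sum_subtractf[symmetric] intro!: cpos_sum cpos_cstar_mult cpos_conj_le_bound m)
  also have "\<dots> = C\<^sup>2 * norm (\<Sum>h\<in>F. csq (?y h))" by (simp add: scaleR_sum_right[symmetric])
  also have "(\<Sum>h\<in>F. csq (?y h)) = (\<Sum>k\<in>(\<lambda>h. ginv g * h) ` F. csq (hcoord z k))"
    by (subst sum.reindex) (auto simp: inj_on_def dest: arg_cong[of _ _ "\<lambda>x. g * x"])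
  also have "norm \<dots> \<le> (norm z)\<^sup>2" using F by (intro norm_finite_gram_le) simp
  finally show "norm (\<Sum>h\<in>F. csq (hcoord (band g m z) h)) \<le> (C * norm z)\<^sup>2"
    by (simp add: hcoord_band[OF m] power_mult_distrib mult_left_mono)
qed

lemma hadj_zero: "hadj (\<lambda>_. 0) (\<lambda>_. 0)"
  by (simp add: hadj_def) (metis hip_zero_right cstar_hip cstar_zero)

lemma hadj_add: "hadj T S \<Longrightarrow> hadj T' S' \<Longrightarrow> hadj (\<lambda>z. T z + T' z) (\<lambda>z. S z + S' z)"
  by (simp add: hadj_def hip_add_left hip_add_right)

lemma hadj_diff: "hadj T S \<Longrightarrow> hadj T' S' \<Longrightarrow> hadj (\<lambda>z. T z - T' z) (\<lambda>z. S z - S' z)"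
  by (simp add: hadj_def hip_diff_left hip_diff_right)

lemma hadj_sum: "(\<And>i. i \<in> I \<Longrightarrow> hadj (T i) (S i)) \<Longrightarrow> hadj (\<lambda>z. \<Sum>i\<in>I. T i z) (\<lambda>z. \<Sum>i\<in>I. S i z)"
  by (induction I rule: infinite_finite_induct) (auto intro: hadj_zero hadj_add)

context twisted_system
begin

text \<open>The weight of a \<lambda>(g) at h. Because \<alpha>_g \<alpha>_k = Ad(\<sigma>(g, k))
  \<alpha>_(gk), the cocycle moves from the right of the vector entry to its left, so in the new
  coordinates the operator is a translation followed by left multiplication.\<close>

definition coefm :: "'a \<Rightarrow> 'g \<Rightarrow> 'g \<Rightarrow> 'a" where
  "coefm a g h = \<beta> h (a * \<sigma> g (ginv g * h))"

lemma norm_coefm_le: "norm (coefm a g h) \<le> norm a"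
  unfolding coefm_def norm_act by (rule order_trans[OF norm_mult_ineq]) simp

definition W :: "'a \<Rightarrow> 'g \<Rightarrow> ('g, 'a) hmod \<Rightarrow> ('g, 'a) hmod" where
  "W a g = band g (coefm a g)"

lemma hcoord_W: "hcoord (W a g z) h = coefm a g h * hcoord z (ginv g * h)"
  unfolding W_def by (rule hcoord_band[OF norm_coefm_le])

lemma norm_W_le: "norm (W a g z) \<le> norm a * norm z"
  unfolding W_def by (rule norm_band_le[OF norm_coefm_le])

lemma W_add: "W (a + b) g z = W a g z + W b g z"
  by (rule hmod_eqI) (simp add: hcoord_W coefm_def distrib_right act_simps)

lemma W_zero [simp]: "W 0 g z = 0"
  by (rule hmod_eqI) (simp add: hcoord_W coefm_def)

lemma W_diff: "W (a - b) g z = W a g z - W b g z"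
  using W_add[of "a - b" b] by simp

lemma W_scaleC: "W (scaleC c a) g z = hscale c (W a g z)"
  by (rule hmod_eqI) (simp add: hcoord_W coefm_def scaleC_mult_left act_simps)

lemma act_conj: "\<alpha> (g * k) x = cstar (\<sigma> g k) * \<alpha> g (\<alpha> k x) * \<sigma> g k"
proof -
  have "cstar (\<sigma> g k) * \<alpha> g (\<alpha> k x) * \<sigma> g k = (csq (\<sigma> g k)) * \<alpha> (g * k) x * (csq (\<sigma> g k))"
    by (simp add: act_act mult.assoc)
  then show ?thesis by (simp add: sigma_unitary)
qed

text \<open>The product rule a \<lambda>(g) b \<lambda>(k) = a \<alpha>_g(b) \<sigma>(g, k)
  \<lambda>(g k). At h = g k j it reduces, after applying \<alpha>_h, to the cocycle identity for g,
  k, j.\<close>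

lemma W_W: "W a g (W b k z) = W (a * \<alpha> g b * \<sigma> g k) (g * k) z"
proof (rule hmod_eqI)
  fix h
  define l where "l = ginv g * h"
  define j where "j = ginv k * l"
  have h: "h = g * l" and l: "l = k * j" by (simp_all add: l_def j_def)
  have "\<alpha> h (coefm b k l) = cstar (\<sigma> g l) * \<alpha> g (b * \<sigma> k j) * \<sigma> g l"
    unfolding h act_conj by (simp add: coefm_def j_def)
  then have "\<alpha> h (coefm a g h * coefm b k l) = a * (\<sigma> g l * cstar (\<sigma> g l)) * \<alpha> g (b * \<sigma> k j) * \<sigma> g l"
    by (simp add: act_simps coefm_def[of a] l_def[symmetric] mult.assoc)
  also have "\<dots> = a * \<alpha> g b * (\<alpha> g (\<sigma> k j) * \<sigma> g (k * j))"
    by (simp add: sigma_unitary act_simps mult.assoc l[symmetric])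
  also have "\<dots> = a * \<alpha> g b * \<sigma> g k * \<sigma> (g * k) j" by (simp add: cocycle[symmetric] mult.assoc)
  also have "\<dots> = \<alpha> h (coefm (a * \<alpha> g b * \<sigma> g k) (g * k) h)"
    by (simp add: coefm_def ginv_mult mult.assoc j_def l_def)
  finally have "coefm a g h * coefm b k l = coefm (a * \<alpha> g b * \<sigma> g k) (g * k) h"
    by (metis act_inverse(2))
  then show "hcoord (W a g (W b k z)) h = hcoord (W (a * \<alpha> g b * \<sigma> g k) (g * k) z) h"
    by (simp add: hcoord_W l_def[symmetric] mult.assoc[symmetric] ginv_mult) (simp add: l_def mult.assoc)
qed

text \<open>From \<lambda>(g^-1) \<lambda>(g) = \<sigma>(g^-1, g) the adjoint of \<lambda>(g) is
  \<sigma>(g^-1, g)^* \<lambda>(g^-1), and moving a^* to the left of \<lambda>(g^-1) applies the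
  automorphism.\<close>

definition adjcoef :: "'a \<Rightarrow> 'g \<Rightarrow> 'a" where
  "adjcoef a g = cstar (\<sigma> (ginv g) g) * \<alpha> (ginv g) (cstar a)"

lemma hadj_W: "hadj (W a g) (W (adjcoef a g) (ginv g))"
proof -
  have "(\<lambda>k. cstar (coefm a g (g * k))) = coefm (adjcoef a g) (ginv g)"
  proof
    fix k
    define y where "y = cstar (coefm a g (g * k))"
    have "\<alpha> (g * k) y = cstar (\<sigma> g k) * cstar a"
      by (simp add: y_def coefm_def act_simps cstar_mult)
    then have "\<alpha> k y = cstar (\<sigma> (ginv g) (g * k)) * \<alpha> (ginv g) (cstar (\<sigma> g k) * cstar a) * \<sigma> (ginv g) (g * k)"
      using act_conj[of "ginv g" "g * k" y] by simp
    also have "\<dots> = cstar (\<alpha> (ginv g) (\<sigma> g k) * \<sigma> (ginv g) (g * k)) * \<alpha> (ginv g) (cstar a) * \<sigma> (ginv g) (g * k)"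
      by (simp add: act_simps cstar_mult mult.assoc)
    \<comment> \<open>The cocycle identity for g^-1, g, k, where the factor at the neutral element
      is 1.\<close>
    also have "\<alpha> (ginv g) (\<sigma> g k) * \<sigma> (ginv g) (g * k) = \<sigma> (ginv g) g"
      using cocycle[of "ginv g" g k] by (simp add: ginv_left)
    finally have "\<alpha> k y = adjcoef a g * \<sigma> (ginv g) (g * k)" by (simp add: adjcoef_def)
    then have "y = \<beta> k (adjcoef a g * \<sigma> (ginv g) (g * k))" by (metis act_inverse(2))
    then show "cstar (coefm a g (g * k)) = coefm (adjcoef a g) (ginv g) k" by (simp add: y_def coefm_def)
  qed
  then show ?thesis using hadj_band[where g=g and m="coefm a g", OF norm_coefm_le] unfolding W_def by simp
qed

lemma lmul_eq: "lmul \<alpha> a = untr (W a 1)"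
  by (auto simp: lmul_def untr_def restr_def fun_eq_iff fromH_def hcoord_W coefm_def act_simps hcoord_toH)

lemma lam_eq: "lam \<alpha> \<sigma> g = untr (W 1 g)"
proof -
  have "\<alpha> g (\<xi> (ginv g * h)) * \<sigma> g (ginv g * h) = fromH (W 1 g (toH \<xi>)) h" if "\<xi> \<in> AS \<alpha>" for \<xi> h
  proof -
    define k where "k = ginv g * h"
    have h: "h = g * k" by (simp add: k_def)
    have "\<alpha> h (\<beta> k (\<xi> k)) = cstar (\<sigma> g k) * \<alpha> g (\<xi> k) * \<sigma> g k"
      unfolding h act_conj by simp
    then have "\<sigma> g k * \<alpha> h (\<beta> k (\<xi> k)) = (\<sigma> g k * cstar (\<sigma> g k)) * \<alpha> g (\<xi> k) * \<sigma> g k"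
      by (simp add: mult.assoc)
    then show ?thesis using that
      by (simp add: fromH_def hcoord_W coefm_def act_simps hcoord_toH k_def[symmetric] sigma_unitary)
  qed
  then show ?thesis by (auto simp: lam_def untr_def restr_def fun_eq_iff)
qed

section \<open>The algebra of finitely supported operators\<close>

definition L :: "('g \<Rightarrow> 'a) \<Rightarrow> ('g, 'a) hmod \<Rightarrow> ('g, 'a) hmod" where
  "L f z = (\<Sum>g | f g \<noteq> 0. W (f g) g z)"

lemma fromH_sum: "fromH (\<Sum>i\<in>I. z i) h = (\<Sum>i\<in>I. fromH (z i) h)"
  by (simp add: fromH_def act_sum)

lemma mult_lam: "\<xi> \<in> AS \<alpha> \<Longrightarrow> a * lam \<alpha> \<sigma> g \<xi> h = fromH (W a g (toH \<xi>)) h"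
  by (simp add: lam_eq untr_def restr_def fromH_def hcoord_W coefm_def act_simps mult.assoc)

lemma sum_mult_lam: "restr \<alpha> (\<lambda>\<xi> h. \<Sum>g\<in>F. f g * lam \<alpha> \<sigma> g \<xi> h) = untr (\<lambda>z. \<Sum>g\<in>F. W (f g) g z)"
  by (auto simp: untr_def restr_def fun_eq_iff fromH_sum mult_lam)

lemma Lam_eq: "Lam \<alpha> \<sigma> f = untr (L f)"
  unfolding Lam_def sum_mult_lam by (simp add: L_def[abs_def])

lemma L_superset: "finite F \<Longrightarrow> {g. f g \<noteq> 0} \<subseteq> F \<Longrightarrow> L f z = (\<Sum>g\<in>F. W (f g) g z)"
  unfolding L_def by (rule sum.mono_neutral_left) auto

lemma hadj_L: "hadj (L f) (\<lambda>z. \<Sum>g\<in>{g. f g \<noteq> 0}. W (adjcoef (f g) g) (ginv g) z)"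
  unfolding L_def[abs_def] by (intro hadj_sum hadj_W)

definition LC :: "(('g, 'a) hmod \<Rightarrow> ('g, 'a) hmod) set" where "LC = L ` Cc"

lemma W_LC: "W a g \<in> LC"
proof -
  define f where "f = (\<lambda>x. if x = g then a else 0)"
  have "finite {x. f x \<noteq> 0}" by (rule finite_subset[of _ "{g}"]) (auto simp: f_def)
  moreover have "L f = W a g" by (rule ext, subst L_superset[of "{g}"]) (auto simp: f_def)
  ultimately show ?thesis unfolding LC_def Cc_def by (intro image_eqI[of _ L f]) auto
qed

lemma LC_zero: "(\<lambda>_. 0) \<in> LC"
  using W_LC[of 0 1] by (simp add: W_zero[abs_def])

lemma LC_add: "X \<in> LC \<Longrightarrow> Y \<in> LC \<Longrightarrow> (\<lambda>z. X z + Y z) \<in> LC"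
proof -
  assume "X \<in> LC" "Y \<in> LC"
  then obtain f f' where f: "finsupp f" "X = L f" and f': "finsupp f'" "Y = L f'"
    by (auto simp: LC_def Cc_def)
  let ?F = "{g. f g \<noteq> 0} \<union> {g. f' g \<noteq> 0}"
  have "L (\<lambda>g. f g + f' g) z = X z + Y z" for z
  proof -
    have "L (\<lambda>g. f g + f' g) z = (\<Sum>g\<in>?F. W (f g + f' g) g z)" using f f' by (intro L_superset) auto
    also have "\<dots> = (\<Sum>g\<in>?F. W (f g) g z) + (\<Sum>g\<in>?F. W (f' g) g z)" by (simp add: W_add sum.distrib)
    also have "(\<Sum>g\<in>?F. W (f g) g z) = L f z" using f f' by (intro L_superset[symmetric]) auto
    also have "(\<Sum>g\<in>?F. W (f' g) g z) = L f' z" using f f' by (intro L_superset[symmetric]) auto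
    finally show ?thesis using f f' by simp
  qed
  moreover have "(\<lambda>g. f g + f' g) \<in> Cc"
    unfolding Cc_def using f f' by (auto intro: finite_subset[of _ ?F])
  ultimately show ?thesis unfolding LC_def by (intro image_eqI[of _ L "\<lambda>g. f g + f' g"]) auto
qed

lemma LC_sum: "(\<And>i. i \<in> I \<Longrightarrow> X i \<in> LC) \<Longrightarrow> (\<lambda>z. \<Sum>i\<in>I. X i z) \<in> LC"
  by (induction I rule: infinite_finite_induct) (auto intro: LC_zero LC_add)

lemma LC_E:
  assumes "X \<in> LC" obtains F a where "finite F" "X = (\<lambda>z. \<Sum>g\<in>F. W (a g) g z)"
  using assms unfolding LC_def Cc_def L_def[abs_def] by blast

lemma LC_comp: assumes "X \<in> LC" "Y \<in> LC" shows "(\<lambda>z. X (Y z)) \<in> LC"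
proof -
  obtain F a where X: "X = (\<lambda>z. \<Sum>g\<in>F. W (a g) g z)" using LC_E[OF assms(1)] by metis
  obtain E b where Y: "Y = (\<lambda>z. \<Sum>g\<in>E. W (b g) g z)" using LC_E[OF assms(2)] by metis
  have "(\<lambda>z. X (Y z)) = (\<lambda>z. \<Sum>g\<in>F. \<Sum>k\<in>E. W (a g * \<alpha> g (b k) * \<sigma> g k) (g * k) z)"
    unfolding X Y by (simp add: linear_sum[OF hadj_linear[OF hadj_W]] W_W)
  then show ?thesis by (simp add: LC_sum W_LC)
qed

lemma LC_adj: assumes "X \<in> LC" obtains Y where "Y \<in> LC" "hadj X Y"
proof -
  obtain F a where X: "X = (\<lambda>z. \<Sum>g\<in>F. W (a g) g z)" using LC_E[OF assms(1)] by metis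
  have "hadj X (\<lambda>z. \<Sum>g\<in>F. W (adjcoef (a g) g) (ginv g) z)" unfolding X by (intro hadj_sum hadj_W)
  then show thesis by (rule that[rotated]) (intro LC_sum W_LC)
qed

text \<open>Adjointable norm limits of finitely supported operators. The adjoint is carried along
  because it supplies the boundedness that products and limits need.\<close>

definition approximable :: "(('g, 'a) hmod \<Rightarrow> ('g, 'a) hmod) \<Rightarrow> bool" where
  "approximable X \<longleftrightarrow> (\<exists>S. hadj X S) \<and> (\<forall>\<epsilon>>0. \<exists>Y\<in>LC. \<forall>z. norm (X z - Y z) \<le> \<epsilon> * norm z)"

lemma approximable_LC: "X \<in> LC \<Longrightarrow> approximable X"
  unfolding approximable_def
proof (intro conjI allI impI)
  assume X: "X \<in> LC"
  show "\<exists>S. hadj X S" using LC_adj[OF X] by metis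
  show "\<exists>Y\<in>LC. \<forall>z. norm (X z - Y z) \<le> \<epsilon> * norm z" if "\<epsilon> > 0" for \<epsilon>
    using X that by (intro bexI[of _ X]) auto
qed

lemma approximable_add:
  assumes "approximable X" "approximable X'" shows "approximable (\<lambda>z. X z + X' z)"
  unfolding approximable_def
proof (intro conjI allI impI)
  show "\<exists>S. hadj (\<lambda>z. X z + X' z) S" using assms hadj_add unfolding approximable_def by blast
  fix \<epsilon> :: real assume "\<epsilon> > 0"
  then have "\<epsilon> / 2 > 0" by simp
  then obtain Y Y' where Y: "Y \<in> LC" "\<And>z. norm (X z - Y z) \<le> \<epsilon> / 2 * norm z"
    and Y': "Y' \<in> LC" "\<And>z. norm (X' z - Y' z) \<le> \<epsilon> / 2 * norm z"
    using assms unfolding approximable_def by meson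
  have "norm (X z + X' z - (Y z + Y' z)) \<le> \<epsilon> * norm z" for z
  proof -
    have "norm (X z + X' z - (Y z + Y' z)) \<le> norm (X z - Y z) + norm (X' z - Y' z)"
      using norm_triangle_ineq[of "X z - Y z" "X' z - Y' z"] by (simp add: algebra_simps)
    then show ?thesis using Y(2)[of z] Y'(2)[of z] by (simp add: field_simps)
  qed
  then show "\<exists>Y\<in>LC. \<forall>z. norm (X z + X' z - Y z) \<le> \<epsilon> * norm z"
    using LC_add[OF Y(1) Y'(1)] by (intro bexI[of _ "\<lambda>z. Y z + Y' z"]) auto
qed

lemma approximable_comp:
  assumes "approximable X" "approximable X'" shows "approximable (X \<circ> X')"
  unfolding approximable_def
proof (intro conjI allI impI)
  show "\<exists>S. hadj (X \<circ> X') S" using assms hadj_comp unfolding approximable_def by blast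
  fix \<epsilon> :: real assume e: "\<epsilon> > 0"
  obtain S where adj: "hadj X S" using assms unfolding approximable_def by blast
  obtain K where K: "K \<ge> 0" "\<And>z. norm (X z) \<le> K * norm z" using hadj_bounded[OF adj] by metis
  \<comment> \<open>The right factor is approximated first, since the tolerance for the left one
    depends on a bound \<open>K'\<close> of the chosen \<open>Y'\<close>; adding 1 avoids division
    by zero.\<close>
  have "\<epsilon> / (2 * (K + 1)) > 0" using e K by simp
  then obtain Y' where Y': "Y' \<in> LC" "\<And>z. norm (X' z - Y' z) \<le> \<epsilon> / (2 * (K + 1)) * norm z"
    using assms(2) unfolding approximable_def by meson
  obtain S' where adj': "hadj Y' S'" using LC_adj[OF Y'(1)] by metis
  obtain K' where K': "K' \<ge> 0" "\<And>z. norm (Y' z) \<le> K' * norm z" using hadj_bounded[OF adj'] by metis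
  have "\<epsilon> / (2 * (K' + 1)) > 0" using e K' by simp
  then obtain Y where Y: "Y \<in> LC" "\<And>z. norm (X z - Y z) \<le> \<epsilon> / (2 * (K' + 1)) * norm z"
    using assms(1) unfolding approximable_def by meson
  have half: "k * (\<epsilon> / (2 * (k + 1)) * n) \<le> \<epsilon> / 2 * n" if "k \<ge> 0" "n \<ge> 0" for k n :: real
  proof -
    have "k * (\<epsilon> / (2 * (k + 1))) \<le> \<epsilon> / 2" using that e by (simp add: field_simps)
    then show ?thesis using that by (metis mult.assoc mult_right_mono)
  qed
  have "norm (X (X' z) - Y (Y' z)) \<le> \<epsilon> * norm z" for z
  proof -
    have "X (X' z) - Y (Y' z) = X (X' z - Y' z) + (X (Y' z) - Y (Y' z))"
      by (simp add: linear_diff[OF hadj_linear[OF adj]])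
    then have "norm (X (X' z) - Y (Y' z)) \<le> norm (X (X' z - Y' z)) + norm (X (Y' z) - Y (Y' z))"
      by (metis norm_triangle_ineq)
    also have "norm (X (X' z - Y' z)) \<le> K * (\<epsilon> / (2 * (K + 1)) * norm z)"
      using K Y'(2)[of z] by (meson mult_left_mono order_trans)
    also have "\<dots> \<le> \<epsilon> / 2 * norm z" using half K by simp
    also have "norm (X (Y' z) - Y (Y' z)) \<le> \<epsilon> / (2 * (K' + 1)) * (K' * norm z)"
      using e K' Y(2)[of "Y' z"] by (meson less_imp_le mult_left_mono order_trans \<open>\<epsilon> / (2 * (K' + 1)) > 0\<close>)
    also have "\<dots> \<le> \<epsilon> / 2 * norm z" using half[of K' "norm z"] K' by (simp add: mult.left_commute mult.commute)
    finally show ?thesis by simp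
  qed
  then show "\<exists>Y\<in>LC. \<forall>z. norm ((X \<circ> X') z - Y z) \<le> \<epsilon> * norm z"
    using LC_comp[OF Y(1) Y'(1)] by (intro bexI[of _ "\<lambda>z. Y (Y' z)"]) auto
qed

lemma approximable_adj:
  assumes "approximable X" "hadj X S" shows "approximable S"
  unfolding approximable_def
proof (intro conjI allI impI)
  show "\<exists>T. hadj S T" using hadj_sym[OF assms(2)] by blast
  fix \<epsilon> :: real assume e: "\<epsilon> > 0"
  then obtain Y where Y: "Y \<in> LC" "\<And>z. norm (X z - Y z) \<le> \<epsilon> * norm z"
    using assms(1) unfolding approximable_def by meson
  obtain Y' where Y': "Y' \<in> LC" "hadj Y Y'" using LC_adj[OF Y(1)] by metis
  have "norm (S z - Y' z) \<le> \<epsilon> * norm z" for z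
    by (rule hadj_bound_transfer[OF hadj_sym[OF hadj_diff[OF assms(2) Y'(2)]] Y(2)])
  then show "\<exists>Y\<in>LC. \<forall>z. norm (S z - Y z) \<le> \<epsilon> * norm z" using Y'(1) by blast
qed

text \<open>Scaling is itself the operator \<open>W (scaleC c 1) 1\<close>, so this is a case of
  composition.\<close>

lemma approximable_hscale:
  assumes "approximable X" shows "approximable (\<lambda>z. hscale c (X z))"
proof -
  have "hscale c (W 1 1 z) = W (scaleC c 1) 1 z" for z by (simp add: W_scaleC)
  moreover have "W 1 1 z = z" for z by (rule hmod_eqI) (simp add: hcoord_W coefm_def act_simps)
  ultimately have "hscale c = W (scaleC c 1) 1" by auto
  then have "approximable (hscale c)" by (simp add: approximable_LC W_LC)
  from approximable_comp[OF this assms] show ?thesis by (simp add: o_def)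
qed

lemma approximable_lim:
  assumes "hadj X S" "\<And>n. approximable (Xn n)" "(\<lambda>n. onorm (\<lambda>z. Xn n z - X z)) \<longlonglongrightarrow> 0"
  shows "approximable X"
  unfolding approximable_def
proof (intro conjI allI impI)
  show "\<exists>T. hadj X T" using assms(1) by blast
  fix \<epsilon> :: real assume e: "\<epsilon> > 0"
  obtain n where n: "norm (onorm (\<lambda>z. Xn n z - X z)) < \<epsilon> / 2"
    using LIMSEQ_D[OF assms(3), of "\<epsilon>/2"] e by auto
  obtain Y where Y: "Y \<in> LC" "\<And>z. norm (Xn n z - Y z) \<le> \<epsilon> / 2 * norm z"
    using assms(2)[of n] e unfolding approximable_def by (meson half_gt_zero)
  obtain Sn where Sn: "hadj (Xn n) Sn" using assms(2)[of n] unfolding approximable_def by blast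
  have b: "bounded_linear (\<lambda>z. Xn n z - X z)" by (rule hadj_bounded_linear[OF hadj_diff[OF Sn assms(1)]])
  have "norm (X z - Y z) \<le> \<epsilon> * norm z" for z
  proof -
    have "norm (Xn n z - X z) \<le> onorm (\<lambda>z. Xn n z - X z) * norm z" using onorm[OF b] by simp
    also have "\<dots> \<le> \<epsilon> / 2 * norm z" using n by (intro mult_right_mono) auto
    finally have "norm (X z - Y z) \<le> \<epsilon> / 2 * norm z + \<epsilon> / 2 * norm z"
      using norm_triangle_ineq4[of "Xn n z - Y z" "Xn n z - X z"] Y(2)[of z] by simp
    then show ?thesis by simp
  qed
  then show "\<exists>Y\<in>LC. \<forall>z. norm (X z - Y z) \<le> \<epsilon> * norm z" using Y(1) by blast
qed

abbreviation \<C> :: "('g, 'a) op set" where "\<C> \<equiv> Cr \<alpha> \<sigma>"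
abbreviation \<Lambda> :: "('g \<Rightarrow> 'a) \<Rightarrow> ('g, 'a) op" where "\<Lambda> \<equiv> Lam \<alpha> \<sigma>"
abbreviation \<nu> :: "('g, 'a) op \<Rightarrow> real" where "\<nu> \<equiv> opnorm \<alpha>"

text \<open>Density of the finitely supported operators, by induction over the closure rules: the
  approximable operators respect each of them, limits and adjoints included.\<close>

lemma Cr_approximable:
  assumes "x \<in> \<C>" shows "preserves x \<and> approximable (tr x)"
  using assms
proof (induction rule: Cr.induct)
  case (gen_A a)
  then show ?case by (simp add: lmul_eq approximable_LC W_LC)
next
  case (gen_lam g)
  then show ?case by (simp add: lam_eq approximable_LC W_LC)
next
  case (add T S)
  then show ?case by (simp add: preserves_op_add tr_op_add approximable_add)
next
  case (scale T c)
  then show ?case by (simp add: preserves_op_scale tr_op_scale approximable_hscale)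
next
  case (comp T S)
  then show ?case by (metis preserves_comp tr_comp approximable_comp)
next
  case (adj T S)
  have S: "preserves S" using adj.hyps by (simp add: Lmod_iff)
  moreover have "hadj (tr T) (tr S)"
    using adj.IH adj.hyps S by (subst is_adjoint_iff[symmetric]) (auto simp: preserves_AS)
  ultimately show ?case using adj.IH approximable_adj by blast
next
  case (lim Tn T)
  have T: "preserves T" "\<exists>S. hadj (tr T) S" using lim.hyps by (simp_all add: Lmod_iff)
  then obtain S where S: "hadj (tr T) S" by blast
  have "\<nu> (op_diff (Tn n) T) = onorm (\<lambda>z. tr (Tn n) z - tr T z)" for n
  proof -
    obtain Sn where "hadj (tr (Tn n)) Sn" using lim.IH[of n] unfolding approximable_def by blast
    from hadj_bounded_linear[OF hadj_diff[OF this S]] show ?thesis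
      using lim.IH[of n] T by (subst opnorm_tr) (simp_all add: preserves_op_diff tr_op_diff)
  qed
  then have "(\<lambda>n. onorm (\<lambda>z. tr (Tn n) z - tr T z)) \<longlonglongrightarrow> 0" using lim.hyps by simp
  then have "approximable (tr T)" by (rule approximable_lim[OF S, rotated]) (use lim.IH in simp)
  then show ?case using T(1) by simp
qed

lemma Lam_Cr: "finsupp f \<Longrightarrow> \<Lambda> f \<in> \<C>"
proof -
  have WC: "untr (W a g) \<in> \<C>" for a g
  proof -
    have "restr \<alpha> (lmul \<alpha> a \<circ> lam \<alpha> \<sigma> g) \<in> \<C>" by (intro Cr.intros)
    moreover have "restr \<alpha> (lmul \<alpha> a \<circ> lam \<alpha> \<sigma> g) = untr (W a g)"
      by (rule tr_inject) (auto simp: lmul_eq lam_eq preserves_comp tr_comp fun_eq_iff W_W act_simps)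
    ultimately show ?thesis by simp
  qed
  have sumC: "finite F \<Longrightarrow> untr (\<lambda>z. \<Sum>g\<in>F. W (f g) g z) \<in> \<C>" for F
  proof (induction F rule: finite_induct)
    case empty
    have "untr (\<lambda>z. 0) = untr (W 0 1)" by (simp add: W_zero[abs_def])
    then show ?case using WC[of 0 1] by simp
  next
    case (insert g F)
    have "untr (\<lambda>z. \<Sum>g\<in>insert g F. W (f g) g z) = op_add (untr (W (f g) g)) (untr (\<lambda>z. \<Sum>g\<in>F. W (f g) g z))"
      using insert by (intro tr_inject) (auto simp: preserves_op_add tr_op_add)
    then show ?case using insert WC by (simp add: Cr.add)
  qed
  assume "finsupp f"
  then show ?thesis using sumC[of "{g. f g \<noteq> 0}"] by (simp add: Lam_eq L_def[abs_def])
qed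

section \<open>Fourier coefficients\<close>

definition e0 :: "('g, 'a) hmod" where "e0 = toH xi0"

lemma xi0_AS: "xi0 \<in> AS \<alpha>"
  unfolding AS_iff by (rule sq_summable_finite_support, rule finite_subset[of _ "{1}"]) (auto simp: xi0_def)

lemma hcoord_e0: "hcoord e0 g = (if g = 1 then 1 else 0)"
  by (simp add: e0_def hcoord_toH xi0_AS) (simp add: xi0_def act_simps)

lemma hat_eq: "preserves x \<Longrightarrow> hat x g = \<alpha> g (hcoord (tr x e0) g)"
  by (simp add: hcoord_tr e0_def xi0_AS hat_def)

text \<open>In row h of \<open>L f\<close> applied to the unit vector only g = h contributes, where
  the cocycle factor is 1; undoing the change of coordinates gives f h.\<close>

lemma hat_Lam:
  assumes "finsupp f" shows "hat (\<Lambda> f) = f"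
proof
  fix h :: 'g
  have *: "(ginv g * h = 1) \<longleftrightarrow> g = h" for g
    by (metis ginv_left mult_ginv_cancel mult.right_neutral)
  have "hcoord (L f e0) h = (\<Sum>g | f g \<noteq> 0. if g = h then coefm (f g) g h else 0)"
    by (simp add: L_def hcoord_W hcoord_e0 * if_distrib cong: if_cong)
  also have "\<dots> = coefm (f h) h h" using assms by (simp add: coefm_def)
  also have "\<dots> = \<beta> h (f h)" by (simp add: coefm_def ginv_left)
  finally show "hat (\<Lambda> f) h = f h" by (simp add: hat_eq Lam_eq)
qed

end

section \<open>Schur multipliers\<close>

lemma has_sum_finite_sum:
  fixes f :: "'i \<Rightarrow> 'b \<Rightarrow> 'c::{topological_comm_monoid_add}"
  assumes "\<And>i. i \<in> I \<Longrightarrow> (f i has_sum s i) A"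
  shows "((\<lambda>x. \<Sum>i\<in>I. f i x) has_sum (\<Sum>i\<in>I. s i)) A"
  using assms by (induction I rule: infinite_finite_induct) (auto intro: has_sum_add)

lemma has_sum_single:
  assumes "\<And>x. x \<noteq> a \<Longrightarrow> f x = 0" "f a = c"
  shows "(f has_sum c) UNIV"
proof -
  have "(f has_sum c) {a}" using assms(2) by (intro has_sum_finiteI) auto
  then show ?thesis
    by (rule has_sum_cong_neutral[THEN iffD1, rotated -1]) (auto simp: assms)
qed

section \<open>Matrices of translations on the Hilbert space of the group\<close>

lemma l2_iff: "\<xi> \<in> l2 \<longleftrightarrow> (\<lambda>g. (cmod (\<xi> g))\<^sup>2) summable_on UNIV"
proof -
  have i: "inv (triv_act g) = (\<lambda>z. z)" for g :: 'a
    by (simp add: triv_act_def inv_id[unfolded id_def])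
  have c: "cstar z * z = complex_of_real ((cmod z)\<^sup>2)" for z
    by (simp add: cstar_complex_def complex_norm_square mult.commute del: of_real_power)
  have "\<xi> \<in> l2 \<longleftrightarrow> (\<lambda>g. complex_of_real ((cmod (\<xi> g))\<^sup>2)) summable_on UNIV"
    by (simp only: l2_def AS_def i c mem_Collect_eq)
  also have "\<dots> \<longleftrightarrow> (\<lambda>g. (cmod (\<xi> g))\<^sup>2) summable_on UNIV"
    using summable_on_Re[of "\<lambda>g. complex_of_real ((cmod (\<xi> g))\<^sup>2)"] summable_on_of_real by fastforce
  finally show ?thesis .
qed

lemma lamG_apply: "\<xi> \<in> l2 \<Longrightarrow> lamG g \<xi> s = \<xi> (ginv g * s)"
  by (simp add: lamG_def lam_def restr_def l2_def triv_act_def triv_coc_def)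

lemma lamG_CrG: "lamG g \<in> CrG"
  unfolding lamG_def CrG_def by (rule Cr.gen_lam)

lemma op_scale_CrG: "x \<in> CrG \<Longrightarrow> op_scale c x \<in> CrG"
  unfolding CrG_def by (rule Cr.scale)

lemma l2_shift: "(\<xi> :: 'g::discrete_group \<Rightarrow> complex) \<in> l2 \<Longrightarrow> (\<lambda>s. \<xi> (g * s)) \<in> l2"
  using summable_on_reindex_bij_betw[OF bij_left_mult[of g], of "\<lambda>s. (cmod (\<xi> s))\<^sup>2"] by (simp add: l2_iff)

text \<open>The matrix of translations \<open>t\<^sub>i\<^sub>j \<lambda>(h\<^sub>i h\<^sub>j\<inverse>)\<close> is unitarily equivalent to the scalar matrix
  \<open>t\<close> acting diagonally: evaluate the \<open>i\<close>-th component at \<open>h\<^sub>i s\<close>.\<close>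

lemma translation_matrix_apply:
  fixes h :: "nat \<Rightarrow> 'g::discrete_group"
  assumes "\<And>j. j < n \<Longrightarrow> \<xi> j \<in> l2"
  shows "matapp n (\<lambda>i j. op_scale (t i j) (lamG (h i * ginv (h j)))) \<xi> i (h i * s)
    = (\<Sum>j<n. t i j * \<xi> j (h j * s))"
  unfolding matapp_def op_scale_def
  by (rule sum.cong) (auto simp: lamG_apply assms scaleC_complex_def ginv_mult mult.assoc)

lemma vecnorm2_translation_matrix:
  fixes h :: "nat \<Rightarrow> 'g::discrete_group"
  assumes "\<And>j. j < n \<Longrightarrow> \<xi> j \<in> l2"
  shows "vecnorm2 n (matapp n (\<lambda>i j. op_scale (t i j) (lamG (h i * ginv (h j)))) \<xi>)
    = (\<Sum>i<n. \<Sum>\<^sub>\<infinity>s. (cmod (\<Sum>j<n. t i j * \<xi> j (h j * s)))\<^sup>2)"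
  unfolding vecnorm2_def
proof (rule sum.cong[OF refl])
  fix i
  have "(\<Sum>\<^sub>\<infinity>g. (cmod (matapp n (\<lambda>i j. op_scale (t i j) (lamG (h i * ginv (h j)))) \<xi> i g))\<^sup>2)
    = (\<Sum>\<^sub>\<infinity>s. (cmod (matapp n (\<lambda>i j. op_scale (t i j) (lamG (h i * ginv (h j)))) \<xi> i (h i * s)))\<^sup>2)"
    by (rule infsum_reindex_bij_betw[OF bij_left_mult, symmetric])
  then show "(\<Sum>\<^sub>\<infinity>g. (cmod (matapp n (\<lambda>i j. op_scale (t i j) (lamG (h i * ginv (h j)))) \<xi> i g))\<^sup>2)
    = (\<Sum>\<^sub>\<infinity>s. (cmod (\<Sum>j<n. t i j * \<xi> j (h j * s)))\<^sup>2)"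
    by (simp only: translation_matrix_apply[where t=t and h=h and \<xi>=\<xi>, OF assms])
qed

text \<open>The scalar bound is used at each s for the vector with entries
  \<open>\<xi> j (h j * s)\<close> and then summed over s; translation invariance restores the norms
  of the components.\<close>

lemma vecnorm2_translation_matrix_le:
  fixes h :: "nat \<Rightarrow> 'g::discrete_group"
  assumes bd: "\<And>b. (\<Sum>i<n. (cmod (\<Sum>j<n. t i j * b j))\<^sup>2) \<le> D * (\<Sum>j<n. (cmod (b j))\<^sup>2)"
    and \<xi>: "\<And>j. j < n \<Longrightarrow> \<xi> j \<in> l2"
  shows "vecnorm2 n (matapp n (\<lambda>i j. op_scale (t i j) (lamG (h i * ginv (h j)))) \<xi>) \<le> D * vecnorm2 n \<xi>"
proof -
  define A where "A = (\<lambda>i s. (cmod (\<Sum>j<n. t i j * \<xi> j (h j * s)))\<^sup>2)"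
  define B where "B = (\<lambda>j s. (cmod (\<xi> j (h j * s)))\<^sup>2)"
  have B: "(B j has_sum (\<Sum>\<^sub>\<infinity>s. (cmod (\<xi> j s))\<^sup>2)) UNIV" if "j < n" for j
  proof -
    have "B j summable_on UNIV" using l2_shift[OF \<xi>[OF that]] by (simp add: B_def l2_iff)
    moreover have "(\<Sum>\<^sub>\<infinity>s. B j s) = (\<Sum>\<^sub>\<infinity>s. (cmod (\<xi> j s))\<^sup>2)"
      unfolding B_def by (rule infsum_reindex_bij_betw[OF bij_left_mult])
    ultimately show ?thesis by (metis has_sum_infsum)
  qed
  have SB: "((\<lambda>s. D * (\<Sum>j<n. B j s)) has_sum D * vecnorm2 n \<xi>) UNIV"
    unfolding vecnorm2_def using B by (intro has_sum_cmult_right has_sum_finite_sum) auto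
  have le: "(\<Sum>i<n. A i s) \<le> D * (\<Sum>j<n. B j s)" for s
    using bd[of "\<lambda>j. \<xi> j (h j * s)"] by (simp add: A_def B_def)
  have A0: "A i s \<ge> 0" for i s by (simp add: A_def)
  have sA: "A i summable_on UNIV" if "i < n" for i
  proof (rule summable_on_comparison_test)
    show "(\<lambda>s. D * (\<Sum>j<n. B j s)) summable_on UNIV" using SB by (rule has_sum_imp_summable)
    show "A i s \<le> D * (\<Sum>j<n. B j s)" for s
      using le[of s] member_le_sum[of i "{..<n}" "\<lambda>i. A i s"] that A0 by (simp add: order_trans)
  qed (rule A0)
  have "((\<lambda>s. \<Sum>i<n. A i s) has_sum (\<Sum>i<n. \<Sum>\<^sub>\<infinity>s. A i s)) UNIV"
    using sA by (intro has_sum_finite_sum) auto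
  from has_sum_mono[OF this SB le] show ?thesis
    by (simp add: vecnorm2_translation_matrix[OF \<xi>] A_def)
qed

text \<open>The Hilbert-Schmidt bound. It makes the set behind a \<open>matnorm\<close> bounded
  above, so that its supremum dominates its members.\<close>

lemma matrix_crude_bound:
  fixes t :: "nat \<Rightarrow> nat \<Rightarrow> complex"
  shows "(\<Sum>i<n. (cmod (\<Sum>j<n. t i j * b j))\<^sup>2) \<le> (\<Sum>i<n. \<Sum>j<n. (cmod (t i j))\<^sup>2) * (\<Sum>j<n. (cmod (b j))\<^sup>2)"
  unfolding sum_distrib_right
proof (rule sum_mono)
  fix i
  have "cmod (\<Sum>j<n. t i j * b j) \<le> (\<Sum>j<n. cmod (t i j) * cmod (b j))"
    by (rule order_trans[OF norm_sum]) (simp add: norm_mult)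
  then have "(cmod (\<Sum>j<n. t i j * b j))\<^sup>2 \<le> (\<Sum>j<n. cmod (t i j) * cmod (b j))\<^sup>2" by (intro power_mono) auto
  also have "\<dots> \<le> (\<Sum>j<n. (cmod (t i j))\<^sup>2) * (\<Sum>j<n. (cmod (b j))\<^sup>2)"
    by (rule Cauchy_Schwarz_ineq_sum)
  finally show "(cmod (\<Sum>j<n. t i j * b j))\<^sup>2 \<le> (\<Sum>j<n. (cmod (t i j))\<^sup>2 * (\<Sum>j<n. (cmod (b j))\<^sup>2))"
    by (simp add: sum_distrib_right)
qed

text \<open>The matrix with entries t_ij \<lambda>(h_i h_j^-1) has norm at most C, and M multiplies
  its entries by \<phi>(h_i h_j^-1). Testing the image on the point masses of weight w_j at h_j
  places everything at s = 1 and returns the Schur product applied to w.\<close>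

lemma cb_mult_schur_unit:
  fixes h :: "nat \<Rightarrow> 'g::discrete_group"
  assumes cb: "cb_mult \<phi> M K" and C: "C \<ge> 0"
    and bd: "\<And>b. (\<Sum>i<n. (cmod (\<Sum>j<n. t i j * b j))\<^sup>2) \<le> C\<^sup>2 * (\<Sum>j<n. (cmod (b j))\<^sup>2)"
    and w: "(\<Sum>j<n. (cmod (w j))\<^sup>2) \<le> 1"
  shows "(\<Sum>i<n. (cmod (\<Sum>j<n. \<phi> (h i * ginv (h j)) * t i j * w j))\<^sup>2) \<le> (\<bar>K\<bar> * C)\<^sup>2"
proof -
  define X where "X = (\<lambda>i j. op_scale (t i j) (lamG (h i * ginv (h j))))"
  define t' where "t' = (\<lambda>i j. \<phi> (h i * ginv (h j)) * t i j)"
  have XC: "X i j \<in> CrG" for i j unfolding X_def by (intro op_scale_CrG lamG_CrG)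
  have MX: "(\<lambda>i j. M (X i j)) = (\<lambda>i j. op_scale (t' i j) (lamG (h i * ginv (h j))))"
  proof (intro ext)
    fix i j
    have "M (X i j) = op_scale (t i j) (M (lamG (h i * ginv (h j))))"
      unfolding X_def using cb by (simp add: cb_mult_def lamG_CrG)
    also have "M (lamG (h i * ginv (h j))) = op_scale (\<phi> (h i * ginv (h j))) (lamG (h i * ginv (h j)))"
      using cb by (simp add: cb_mult_def)
    finally show "M (X i j) \<xi> s = op_scale (t' i j) (lamG (h i * ginv (h j))) \<xi> s" for \<xi> s
      by (simp add: op_scale_def t'_def scaleC_complex_def)
  qed
  let ?R = "{sqrt (vecnorm2 n (matapp n X \<xi>)) |\<xi>. (\<forall>i<n. \<xi> i \<in> l2) \<and> vecnorm2 n \<xi> \<le> 1}"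
  have RC: "y \<le> C" if "y \<in> ?R" for y
  proof -
    obtain \<xi> where \<xi>: "\<And>i. i < n \<Longrightarrow> \<xi> i \<in> l2" "vecnorm2 n \<xi> \<le> 1" "y = sqrt (vecnorm2 n (matapp n X \<xi>))"
      using \<open>y \<in> ?R\<close> by blast
    have "vecnorm2 n (matapp n X \<xi>) \<le> C\<^sup>2 * vecnorm2 n \<xi>"
      unfolding X_def by (rule vecnorm2_translation_matrix_le[OF bd \<xi>(1)])
    also have "\<dots> \<le> C\<^sup>2" using \<xi>(2) by (simp add: mult_left_le)
    finally show "y \<le> C" unfolding \<xi>(3) using C by (simp add: real_le_lsqrt)
  qed
  define nul :: "nat \<Rightarrow> 'g \<Rightarrow> complex" where "nul = (\<lambda>_ _. 0)"
  \<comment> \<open>The zero vector shows that the supremum is taken over a nonempty set and is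
    nonnegative, which allows K to be replaced by |K|.\<close>
  have R0: "0 \<in> ?R"
  proof (intro CollectI exI conjI)
    show "\<forall>i<n. nul i \<in> l2" by (simp add: l2_iff nul_def)
    have "vecnorm2 n (matapp n X nul) \<le> C\<^sup>2 * vecnorm2 n nul"
      unfolding X_def by (rule vecnorm2_translation_matrix_le[OF bd]) (simp add: l2_iff nul_def)
    moreover have "vecnorm2 n (matapp n X nul) \<ge> 0" by (simp add: vecnorm2_def sum_nonneg infsum_nonneg)
    ultimately show "0 = sqrt (vecnorm2 n (matapp n X nul))" by (simp add: vecnorm2_def nul_def)
    show "vecnorm2 n nul \<le> 1" by (simp add: vecnorm2_def nul_def)
  qed
  have "matnorm n X \<le> C"
    unfolding matnorm_def using R0 by (intro cSup_least RC) auto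
  have n0: "0 \<le> matnorm n X"
    unfolding matnorm_def by (rule cSup_upper[OF R0 bdd_aboveI[OF RC]])
  have "matnorm n (\<lambda>i j. M (X i j)) \<le> K * matnorm n X" using cb XC by (simp add: cb_mult_def)
  also have "\<dots> \<le> \<bar>K\<bar> * C" using n0 \<open>matnorm n X \<le> C\<close> by (intro mult_mono) auto
  finally have MC: "matnorm n (\<lambda>i j. M (X i j)) \<le> \<bar>K\<bar> * C" .
  define \<xi> where "\<xi> = (\<lambda>j s. if s = h j then w j else 0)"
  have \<xi>1: "((\<lambda>s. (cmod (\<xi> j s))\<^sup>2) has_sum (cmod (w j))\<^sup>2) UNIV" for j
    by (rule has_sum_single[of "h j"]) (auto simp: \<xi>_def)
  have \<xi>l2: "\<xi> j \<in> l2" for j unfolding l2_iff by (rule has_sum_imp_summable[OF \<xi>1])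
  have v\<xi>: "vecnorm2 n \<xi> \<le> 1" using w by (simp add: vecnorm2_def infsumI[OF \<xi>1])
  have hs: "h j * s = h j \<longleftrightarrow> s = 1" for j s by (metis ginv_mult_cancel ginv_left mult.right_neutral)
  have "vecnorm2 n (matapp n (\<lambda>i j. M (X i j)) \<xi>) = (\<Sum>i<n. \<Sum>\<^sub>\<infinity>s. (cmod (\<Sum>j<n. t' i j * \<xi> j (h j * s)))\<^sup>2)"
    unfolding MX by (rule vecnorm2_translation_matrix) (rule \<xi>l2)
  also have "\<dots> = (\<Sum>i<n. (cmod (\<Sum>j<n. t' i j * w j))\<^sup>2)"
  proof (rule sum.cong[OF refl], rule infsumI)
    fix i
    show "((\<lambda>s. (cmod (\<Sum>j<n. t' i j * \<xi> j (h j * s)))\<^sup>2) has_sum (cmod (\<Sum>j<n. t' i j * w j))\<^sup>2) UNIV"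
      by (rule has_sum_single[of 1]) (auto simp: \<xi>_def hs)
  qed
  finally have eq: "vecnorm2 n (matapp n (\<lambda>i j. M (X i j)) \<xi>) = (\<Sum>i<n. (cmod (\<Sum>j<n. t' i j * w j))\<^sup>2)" .
  have "sqrt (vecnorm2 n (matapp n (\<lambda>i j. M (X i j)) \<xi>)) \<le> matnorm n (\<lambda>i j. M (X i j))"
    unfolding matnorm_def
  proof (rule cSup_upper)
    show "sqrt (vecnorm2 n (matapp n (\<lambda>i j. M (X i j)) \<xi>)) \<in> {sqrt (vecnorm2 n (matapp n (\<lambda>i j. M (X i j)) \<xi>)) |\<xi>. (\<forall>i<n. \<xi> i \<in> l2) \<and> vecnorm2 n \<xi> \<le> 1}"
      using \<xi>l2 v\<xi> by blast
    define D where "D = (\<Sum>i<n. \<Sum>j<n. (cmod (t' i j))\<^sup>2)"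
    have D0: "D \<ge> 0" by (simp add: D_def sum_nonneg)
    show "bdd_above {sqrt (vecnorm2 n (matapp n (\<lambda>i j. M (X i j)) \<xi>)) |\<xi>. (\<forall>i<n. \<xi> i \<in> l2) \<and> vecnorm2 n \<xi> \<le> 1}"
    proof (rule bdd_aboveI[where M="sqrt D"])
      fix y assume "y \<in> {sqrt (vecnorm2 n (matapp n (\<lambda>i j. M (X i j)) \<xi>)) |\<xi>. (\<forall>i<n. \<xi> i \<in> l2) \<and> vecnorm2 n \<xi> \<le> 1}"
      then obtain \<xi> where \<xi>: "\<And>i. i < n \<Longrightarrow> \<xi> i \<in> l2" "vecnorm2 n \<xi> \<le> 1" "y = sqrt (vecnorm2 n (matapp n (\<lambda>i j. M (X i j)) \<xi>))" by blast
      have "vecnorm2 n (matapp n (\<lambda>i j. M (X i j)) \<xi>) \<le> D * vecnorm2 n \<xi>"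
        unfolding MX D_def by (rule vecnorm2_translation_matrix_le[OF matrix_crude_bound \<xi>(1)])
      also have "\<dots> \<le> D" using \<xi>(2) D0 by (simp add: mult_left_le)
      finally show "y \<le> sqrt D" unfolding \<xi>(3) by simp
    qed
  qed
  then have "sqrt (\<Sum>i<n. (cmod (\<Sum>j<n. t' i j * w j))\<^sup>2) \<le> \<bar>K\<bar> * C" using MC eq by simp
  then show ?thesis unfolding t'_def by (rule sqrt_le_D)
qed

text \<open>Transport to an arbitrary finite index set, with w scaled to norm 1. Values of
  \<open>h\<close> may repeat: later the indices are pairs of a group element and a basis index, and
  \<open>h\<close> forgets the latter, which amounts to matrix amplification.\<close>

lemma cb_mult_schur:
  fixes h :: "'i \<Rightarrow> 'g::discrete_group"
  assumes cb: "cb_mult \<phi> M K" and C: "C \<ge> 0" and I: "finite I"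
    and bd: "\<And>b. (\<Sum>i\<in>I. (cmod (\<Sum>j\<in>I. t i j * b j))\<^sup>2) \<le> C\<^sup>2 * (\<Sum>j\<in>I. (cmod (b j))\<^sup>2)"
  shows "(\<Sum>i\<in>I. (cmod (\<Sum>j\<in>I. \<phi> (h i * ginv (h j)) * t i j * w j))\<^sup>2) \<le> (\<bar>K\<bar> * C)\<^sup>2 * (\<Sum>j\<in>I. (cmod (w j))\<^sup>2)"
proof -
  define r where "r = sqrt (\<Sum>j\<in>I. (cmod (w j))\<^sup>2)"
  have r2: "r\<^sup>2 = (\<Sum>j\<in>I. (cmod (w j))\<^sup>2)" by (simp add: r_def sum_nonneg)
  show ?thesis
  proof (cases "r = 0")
    case True
    then have "(\<Sum>j\<in>I. (cmod (w j))\<^sup>2) = 0" using r2 by simp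
    then have "\<And>j. j \<in> I \<Longrightarrow> w j = 0" using I by (simp add: sum_nonneg_eq_0_iff)
    then show ?thesis by simp
  next
    case False
    then have rp: "r > 0" by (simp add: r_def sum_nonneg less_le)
    obtain p where p: "bij_betw p {0..<card I} I" using ex_bij_betw_nat_finite[OF I] by blast
    have p': "bij_betw p {..<card I} I" using p by (simp add: lessThan_atLeast0)
    have re: "(\<Sum>i<card I. f (p i)) = (\<Sum>i\<in>I. f i)" for f :: "'i \<Rightarrow> 'z::comm_monoid_add"
      by (rule sum.reindex_bij_betw[OF p'])
    \<comment> \<open>\<open>q\<close> inverts the enumeration, so that a test vector on numbers
      becomes one on I.\<close>
    define q where "q = inv_into {..<card I} p"
    have qp: "q (p i) = i" if "i < card I" for i
      using that p' by (simp add: q_def bij_betw_def)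
    have "(\<Sum>i<card I. (cmod (\<Sum>j<card I. \<phi> (h (p i) * ginv (h (p j))) * t (p i) (p j) * (w (p j) / of_real r)))\<^sup>2) \<le> (\<bar>K\<bar> * C)\<^sup>2"
    proof (rule cb_mult_schur_unit[where h="\<lambda>i. h (p i)" and t="\<lambda>i j. t (p i) (p j)" and w="\<lambda>j. w (p j) / of_real r", OF cb C])
      fix b
      have "(\<Sum>i<card I. (cmod (\<Sum>j<card I. t (p i) (p j) * b j))\<^sup>2) = (\<Sum>i<card I. (cmod (\<Sum>j<card I. t (p i) (p j) * b (q (p j))))\<^sup>2)"
        by (simp add: qp)
      also have "\<dots> = (\<Sum>i\<in>I. (cmod (\<Sum>j\<in>I. t i j * b (q j)))\<^sup>2)"
        by (subst re[of "\<lambda>j. t _ j * b (q j)"]) (rule re[of "\<lambda>i. (cmod (\<Sum>j\<in>I. t i j * b (q j)))\<^sup>2"])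
      also have "\<dots> \<le> C\<^sup>2 * (\<Sum>j\<in>I. (cmod (b (q j)))\<^sup>2)" by (rule bd)
      also have "(\<Sum>j\<in>I. (cmod (b (q j)))\<^sup>2) = (\<Sum>j<card I. (cmod (b (q (p j))))\<^sup>2)"
        by (rule re[of "\<lambda>j. (cmod (b (q j)))\<^sup>2", symmetric])
      finally show "(\<Sum>i<card I. (cmod (\<Sum>j<card I. t (p i) (p j) * b j))\<^sup>2) \<le> C\<^sup>2 * (\<Sum>j<card I. (cmod (b j))\<^sup>2)"
        by (simp add: qp)
      have "(\<Sum>j<card I. (cmod (w (p j) / of_real r))\<^sup>2) = (\<Sum>j\<in>I. (cmod (w j / of_real r))\<^sup>2)"
        by (rule re[of "\<lambda>j. (cmod (w j / of_real r))\<^sup>2"])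
      also have "\<dots> = (\<Sum>j\<in>I. (cmod (w j))\<^sup>2) / r\<^sup>2" by (simp add: norm_divide power_divide sum_divide_distrib)
      finally show "(\<Sum>j<card I. (cmod (w (p j) / of_real r))\<^sup>2) \<le> 1" using rp by (simp add: r2[symmetric])
    qed
    also have "(\<Sum>i<card I. (cmod (\<Sum>j<card I. \<phi> (h (p i) * ginv (h (p j))) * t (p i) (p j) * (w (p j) / of_real r)))\<^sup>2)
        = (\<Sum>i\<in>I. (cmod (\<Sum>j\<in>I. \<phi> (h i * ginv (h j)) * t i j * (w j / of_real r)))\<^sup>2)"
      by (subst re[of "\<lambda>j. \<phi> (h _ * ginv (h j)) * t _ j * (w j / of_real r)"])
        (rule re[of "\<lambda>i. (cmod (\<Sum>j\<in>I. \<phi> (h i * ginv (h j)) * t i j * (w j / of_real r)))\<^sup>2"])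
    also have "\<dots> = (\<Sum>i\<in>I. (cmod (\<Sum>j\<in>I. \<phi> (h i * ginv (h j)) * t i j * w j))\<^sup>2) / r\<^sup>2"
      by (simp add: sum_divide_distrib[symmetric] norm_divide power_divide)
    finally show ?thesis using rp by (simp add: divide_simps r2[symmetric])
  qed
qed

text \<open>The GNS form of \<tau>, not divided by its null space; \<open>sip_null\<close> and
  \<open>sip_null_mult\<close> take the place of the quotient.\<close>

definition sip :: "('a::cstar_alg \<Rightarrow> complex) \<Rightarrow> 'a \<Rightarrow> 'a \<Rightarrow> complex" where
  "sip \<tau> a b = \<tau> (cstar a * b)"

context
  fixes \<tau> :: "'a::cstar_alg \<Rightarrow> complex"
  assumes \<tau>: "cstate \<tau>"
begin

lemma sip_add_right: "sip \<tau> a (b + c) = sip \<tau> a b + sip \<tau> a c"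
  by (simp add: sip_def distrib_left cstate_add[OF \<tau>])

lemma sip_diff_right: "sip \<tau> a (b - c) = sip \<tau> a b - sip \<tau> a c"
  by (simp add: sip_def right_diff_distrib cstate_diff[OF \<tau>])

lemma sip_scaleC_right: "sip \<tau> a (scaleC c b) = c * sip \<tau> a b"
  by (simp add: sip_def scaleC_mult_right cstate_scaleC[OF \<tau>])

lemma sip_scaleR_right: "sip \<tau> a (r *\<^sub>R b) = of_real r * sip \<tau> a b"
  by (simp add: sip_def cstate_scaleR[OF \<tau>])

lemma sip_sum_right: "sip \<tau> a (\<Sum>i\<in>I. f i) = (\<Sum>i\<in>I. sip \<tau> a (f i))"
  by (simp add: sip_def sum_distrib_left cstate_sum[OF \<tau>])

lemma sip_cnj: "cnj (sip \<tau> a b) = sip \<tau> b a"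
  by (simp add: sip_def cstate_cstar[OF \<tau>, symmetric] cstar_mult cstar_cstar)

lemma sip_diff_left: "sip \<tau> (b - c) a = sip \<tau> b a - sip \<tau> c a"
  by (metis sip_cnj sip_diff_right complex_cnj_diff)

lemma sip_add_left: "sip \<tau> (b + c) a = sip \<tau> b a + sip \<tau> c a"
  by (metis sip_cnj sip_add_right complex_cnj_add)

lemma sip_scaleR_left: "sip \<tau> (r *\<^sub>R b) a = of_real r * sip \<tau> b a"
  by (metis sip_cnj sip_scaleR_right complex_cnj_mult complex_cnj_complex_of_real)

lemma sip_scaleC_left: "sip \<tau> (scaleC c b) a = cnj c * sip \<tau> b a"
  by (metis sip_cnj sip_scaleC_right complex_cnj_mult)

lemma sip_self_nonneg: "Re (sip \<tau> a a) \<ge> 0"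
  unfolding sip_def by (intro cstate_cpos[OF \<tau>] cpos_cstar_mult)

lemma sip_self_real: "sip \<tau> a a = of_real (Re (sip \<tau> a a))"
  unfolding sip_def by (rule cstate_selfadjoint[OF \<tau>]) (simp add: cstar_mult cstar_cstar)

text \<open>Cauchy-Schwarz against a null vector gives real part 0 for every a; replacing a by i a
  handles the imaginary part.\<close>

lemma sip_null:
  assumes "Re (sip \<tau> n n) = 0" shows "sip \<tau> a n = 0"
proof -
  have re: "Re (sip \<tau> a n) = 0" for a
  proof -
    have "(Re (sip \<tau> a n))\<^sup>2 \<le> Re (sip \<tau> a a) * Re (sip \<tau> n n)"
    proof (rule discriminant_le)
      fix t :: real
      have s: "Re (sip \<tau> n a) = Re (sip \<tau> a n)" by (metis sip_cnj cnj.sel(1))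
      have "0 \<le> Re (sip \<tau> (a + t *\<^sub>R n) (a + t *\<^sub>R n))" by (rule sip_self_nonneg)
      also have "\<dots> = Re (sip \<tau> a a) + 2 * t * Re (sip \<tau> a n) + t\<^sup>2 * Re (sip \<tau> n n)"
        by (simp add: sip_add_left sip_add_right sip_scaleR_left sip_scaleR_right s algebra_simps power2_eq_square)
      finally show "0 \<le> \<dots>" .
    qed (rule sip_self_nonneg)
    then show ?thesis by (simp add: assms)
  qed
  show ?thesis using re[of a] re[of "scaleC \<i> a"] by (simp add: sip_scaleC_left complex_eq_iff)
qed

lemma sip_null_mult:
  assumes "Re (sip \<tau> n n) = 0" shows "Re (sip \<tau> (x * n) (x * n)) = 0"
proof -
  have "0 \<le> Re (\<tau> ((norm x)\<^sup>2 *\<^sub>R (cstar n * n) - csq (x * n)))"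
    by (intro cstate_cpos[OF \<tau>] cpos_conj_le)
  then show ?thesis using assms sip_self_nonneg[of "x * n"]
    by (simp add: sip_def cstate_diff[OF \<tau>] cstate_scaleR[OF \<tau>])
qed

definition orthon :: "(nat \<Rightarrow> 'a) \<Rightarrow> nat \<Rightarrow> bool" where
  "orthon e m \<longleftrightarrow> (\<forall>i<m. \<forall>j<m. sip \<tau> (e i) (e j) = (if i = j then 1 else 0))"

definition proj :: "(nat \<Rightarrow> 'a) \<Rightarrow> nat \<Rightarrow> 'a \<Rightarrow> 'a" where
  "proj e m v = (\<Sum>i<m. scaleC (sip \<tau> (e i) v) (e i))"

lemma sip_orthon_combination:
  assumes "orthon e m" "i < m"
  shows "sip \<tau> (e i) (\<Sum>j<m. scaleC (b j) (e j)) = b i"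
proof -
  have "sip \<tau> (e i) (\<Sum>j<m. scaleC (b j) (e j)) = (\<Sum>j<m. if i = j then b j else 0)"
    unfolding sip_sum_right using assms by (intro sum.cong) (auto simp: sip_scaleC_right orthon_def)
  then show ?thesis using assms by simp
qed

lemma bessel_identity:
  assumes e: "orthon e m"
  shows "Re (sip \<tau> (v - proj e m v) (v - proj e m v)) = Re (sip \<tau> v v) - (\<Sum>i<m. (cmod (sip \<tau> (e i) v))\<^sup>2)"
proof -
  define P where "P = proj e m v"
  have z: "sip \<tau> (e i) (v - P) = 0" if "i < m" for i
    using sip_orthon_combination[OF e that] by (simp add: P_def proj_def sip_diff_right)
  have z': "sip \<tau> (v - P) (e i) = 0" if "i < m" for i
    using z[OF that] sip_cnj[of "e i" "v - P"] by simp
  have 1: "sip \<tau> (v - P) P = 0"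
    using z' by (subst P_def, subst proj_def) (simp add: sip_sum_right sip_scaleC_right)
  have "sip \<tau> v P = (\<Sum>i<m. sip \<tau> (e i) v * sip \<tau> v (e i))"
    by (simp add: P_def proj_def sip_sum_right sip_scaleC_right)
  also have "\<dots> = (\<Sum>i<m. of_real ((cmod (sip \<tau> (e i) v))\<^sup>2))"
    by (rule sum.cong) (simp_all add: complex_norm_square sip_cnj[symmetric, of v] del: of_real_power)
  finally have "Re (sip \<tau> v P) = (\<Sum>i<m. (cmod (sip \<tau> (e i) v))\<^sup>2)" by simp
  moreover have "Re (sip \<tau> P v) = Re (sip \<tau> v P)" by (metis sip_cnj cnj.sel(1))
  moreover have "sip \<tau> (v - P) (v - P) = sip \<tau> v v - sip \<tau> P v"
    using 1 by (simp add: sip_diff_right sip_diff_left)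
  ultimately show ?thesis by (simp add: P_def)
qed

lemma bessel_inequality:
  assumes "orthon e m" shows "(\<Sum>i<m. (cmod (sip \<tau> (e i) v))\<^sup>2) \<le> Re (sip \<tau> v v)"
  using bessel_identity[OF assms, of v] sip_self_nonneg[of "v - proj e m v"] by simp

lemma sip_self_combination:
  assumes e: "orthon e m" and v: "v = (\<Sum>j<m. scaleC (b j) (e j))"
  shows "Re (sip \<tau> v v) = (\<Sum>j<m. (cmod (b j))\<^sup>2)"
proof -
  have c: "sip \<tau> (e i) v = b i" if "i < m" for i unfolding v by (rule sip_orthon_combination[OF e that])
  then have "proj e m v = v" unfolding proj_def by (simp add: v)
  moreover have "sip \<tau> 0 0 = 0" by (simp add: sip_def cstate_zero[OF \<tau>])
  ultimately show ?thesis using bessel_identity[OF e, of v] c by simp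
qed

text \<open>Orthonormalisation for a degenerate form: the vectors of V agree with their projections
  up to null vectors, and a vector with null residual adds no basis element.\<close>

lemma gram_schmidt:
  assumes "finite V"
  shows "\<exists>e m. orthon e m \<and> (\<forall>v\<in>V. Re (sip \<tau> (v - proj e m v) (v - proj e m v)) = 0)"
  using assms
proof (induction V rule: finite_induct)
  case empty
  show ?case by (rule exI, rule exI[of _ 0]) (simp add: orthon_def)
next
  case (insert v V)
  then obtain e m where e: "orthon e m" and V: "\<And>u. u \<in> V \<Longrightarrow> Re (sip \<tau> (u - proj e m u) (u - proj e m u)) = 0"
    by blast
  define w where "w = v - proj e m v"
  show ?case
  proof (cases "Re (sip \<tau> w w) = 0")
    case True
    then show ?thesis using e V by (intro exI[of _ e] exI[of _ m]) (auto simp: w_def)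
  next
    case False
    define r where "r = Re (sip \<tau> w w)"
    have ww: "sip \<tau> w w = of_real r" unfolding r_def by (rule sip_self_real)
    have rp: "r > 0" using False sip_self_nonneg[of w] by (simp add: r_def)
    define u where "u = (1 / sqrt r) *\<^sub>R w"
    define e' where "e' = e(m := u)"
    have ew: "sip \<tau> (e i) w = 0" if "i < m" for i
      using sip_orthon_combination[OF e that] by (simp add: w_def proj_def sip_diff_right)
    have eu: "sip \<tau> (e i) u = 0" if "i < m" for i using ew[OF that] by (simp add: u_def sip_scaleR_right)
    have ue: "sip \<tau> u (e i) = 0" if "i < m" for i using eu[OF that] sip_cnj[of "e i" u] by simp
    have uu: "sip \<tau> u u = 1"
    proof -
      have "sip \<tau> u u = of_real (1 / sqrt r * (1 / sqrt r) * r)"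
        unfolding u_def sip_scaleR_right sip_scaleR_left ww
        by (simp only: of_real_mult mult.assoc)
      also have "1 / sqrt r * (1 / sqrt r) * r = 1" using rp by simp
      finally show ?thesis by simp
    qed
    have o': "orthon e' (Suc m)"
      using e eu ue uu by (auto simp: orthon_def e'_def less_Suc_eq)
    have up: "sip \<tau> u (proj e m x) = 0" for x
      by (simp add: proj_def sip_sum_right sip_scaleC_right ue)
    have pr: "proj e' (Suc m) x = proj e m x + scaleC (sip \<tau> u x) u" for x
      by (simp add: proj_def e'_def)
    have "Re (sip \<tau> (x - proj e' (Suc m) x) (x - proj e' (Suc m) x)) = 0" if "x \<in> insert v V" for x
    proof (cases "x \<in> V")
      case True
      have "sip \<tau> u x = sip \<tau> u (x - proj e m x)" by (simp add: sip_diff_right up)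
      also have "\<dots> = 0" by (rule sip_null[OF V[OF True]])
      finally show ?thesis using V[OF True] by (simp add: pr)
    next
      case False
      then have x: "x = v" using that by simp
      \<comment> \<open>u = w / sqrt r is orthogonal to the old projection, so the new component of
        v is sqrt r times u, that is w, and the residual vanishes.\<close>
      have "sip \<tau> u v = sip \<tau> u w" by (simp add: w_def sip_diff_right up)
      also have "\<dots> = of_real (1 / sqrt r * r)"
        by (simp add: u_def sip_scaleR_left ww)
      also have "1 / sqrt r * r = sqrt r" using rp by (simp add: real_div_sqrt)
      finally have "scaleC (sip \<tau> u v) u = w" using rp by (simp add: scaleC_of_real u_def)
      then have "x - proj e' (Suc m) x = 0" by (simp add: x pr w_def)
      then show ?thesis by (simp add: sip_def cstate_zero[OF \<tau>])
    qed
    then show ?thesis using o' by blast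
  qed
qed

end

section \<open>Reduction of matrices over the algebra to scalar matrices\<close>

lemma sum_Times: "sum f (A \<times> B) = (\<Sum>x\<in>A. \<Sum>y\<in>B. f (x, y))"
  by (simp add: sum.cartesian_product)

text \<open>The GNS construction of a state that attains the norm, compressed to a finite-dimensional
  subspace, reduces the matrix over the algebra to a matrix of scalars.\<close>

lemma schur_matrix:
  fixes x :: "'g::discrete_group \<Rightarrow> 'g \<Rightarrow> 'a::cstar_alg"
  assumes cb: "cb_mult \<phi> M K" and F: "finite F" and C: "C \<ge> 0"
    and bd: "\<And>\<tau> v. cstate \<tau> \<Longrightarrow> (\<Sum>h\<in>F. Re (sip \<tau> (\<Sum>k\<in>F. x h k * v k) (\<Sum>k\<in>F. x h k * v k)))
        \<le> C\<^sup>2 * (\<Sum>k\<in>F. Re (sip \<tau> (v k) (v k)))"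
    and y: "\<And>h. y h = (\<Sum>k\<in>F. scaleC (\<phi> (h * ginv k)) (x h k * v k))"
  shows "norm (\<Sum>h\<in>F. csq (y h)) \<le> (\<bar>K\<bar> * C)\<^sup>2 * norm (\<Sum>k\<in>F. csq (v k))"
proof -
  have "cpos (\<Sum>h\<in>F. csq (y h))" by (intro cpos_sum cpos_cstar_mult)
  then obtain \<tau> where \<tau>: "cstate \<tau>" and eq: "\<tau> (\<Sum>h\<in>F. csq (y h)) = of_real (norm (\<Sum>h\<in>F. csq (y h)))"
    by (rule exists_cstate)
  \<comment> \<open>The subspace contains all inputs v k and all outputs y h up to null vectors, so
    the compression is exact on both.\<close>
  have "finite (v ` F \<union> y ` F)" using F by simp
  from gram_schmidt[OF \<tau> this] obtain e m where e: "orthon \<tau> e m"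
    and nul: "\<forall>u\<in>v ` F \<union> y ` F. Re (sip \<tau> (u - proj \<tau> e m u) (u - proj \<tau> e m u)) = 0" by blast
  define t where "t = (\<lambda>p q. sip \<tau> (e (snd p)) (x (fst p) (fst q) * e (snd q)))"
  define w where "w = (\<lambda>q. sip \<tau> (e (snd q)) (v (fst q)))"
  let ?I = "F \<times> {..<m}"
  have I: "finite ?I" using F by simp
  have "(\<Sum>p\<in>?I. (cmod (\<Sum>q\<in>?I. \<phi> (fst p * ginv (fst q)) * t p q * w q))\<^sup>2) \<le> (\<bar>K\<bar> * C)\<^sup>2 * (\<Sum>q\<in>?I. (cmod (w q))\<^sup>2)"
  proof (rule cb_mult_schur[OF cb C I])
    fix b :: "'g \<times> nat \<Rightarrow> complex"
    define u where "u = (\<lambda>k. \<Sum>j<m. scaleC (b (k, j)) (e j))"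
    have "(\<Sum>q\<in>?I. t (h, i) q * b q) = sip \<tau> (e i) (\<Sum>k\<in>F. x h k * u k)" for h i
      by (simp add: sum_Times t_def u_def sum_distrib_left scaleC_mult_right sip_sum_right[OF \<tau>]
          sip_scaleC_right[OF \<tau>] mult.commute)
    then have "(\<Sum>p\<in>?I. (cmod (\<Sum>q\<in>?I. t p q * b q))\<^sup>2) = (\<Sum>h\<in>F. \<Sum>i<m. (cmod (sip \<tau> (e i) (\<Sum>k\<in>F. x h k * u k)))\<^sup>2)"
      by (subst sum_Times) simp
    \<comment> \<open>Compression does not raise the bound: Bessel's inequality on the output side,
      and Parseval for the combinations u k on the input side.\<close>
    also have "\<dots> \<le> (\<Sum>h\<in>F. Re (sip \<tau> (\<Sum>k\<in>F. x h k * u k) (\<Sum>k\<in>F. x h k * u k)))"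
      by (intro sum_mono bessel_inequality[OF \<tau> e])
    also have "\<dots> \<le> C\<^sup>2 * (\<Sum>k\<in>F. Re (sip \<tau> (u k) (u k)))" by (rule bd[OF \<tau>])
    also have "(\<Sum>k\<in>F. Re (sip \<tau> (u k) (u k))) = (\<Sum>k\<in>F. \<Sum>j<m. (cmod (b (k, j)))\<^sup>2)"
      by (rule sum.cong[OF refl], rule sip_self_combination[OF \<tau> e]) (simp add: u_def)
    finally show "(\<Sum>p\<in>?I. (cmod (\<Sum>q\<in>?I. t p q * b q))\<^sup>2) \<le> C\<^sup>2 * (\<Sum>q\<in>?I. (cmod (b q))\<^sup>2)"
      by (simp add: sum_Times)
  qed
  also have "(\<Sum>q\<in>?I. (cmod (w q))\<^sup>2) \<le> norm (\<Sum>k\<in>F. csq (v k))"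
  proof -
    have "(\<Sum>q\<in>?I. (cmod (w q))\<^sup>2) = (\<Sum>k\<in>F. \<Sum>j<m. (cmod (sip \<tau> (e j) (v k)))\<^sup>2)"
      by (simp add: sum_Times w_def)
    also have "\<dots> \<le> (\<Sum>k\<in>F. Re (sip \<tau> (v k) (v k)))" by (intro sum_mono bessel_inequality[OF \<tau> e])
    also have "\<dots> = Re (\<tau> (\<Sum>k\<in>F. csq (v k)))" by (simp add: sip_def cstate_sum[OF \<tau>])
    also have "\<dots> \<le> norm (\<Sum>k\<in>F. csq (v k))" by (rule cstate_Re_le[OF \<tau>])
    finally show ?thesis .
  qed
  also have "(\<Sum>p\<in>?I. (cmod (\<Sum>q\<in>?I. \<phi> (fst p * ginv (fst q)) * t p q * w q))\<^sup>2) = norm (\<Sum>h\<in>F. csq (y h))"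
  proof -
    \<comment> \<open>v k differs from its projection by a null vector, and multiplication by x h k
      keeps it null, so the compressed matrix acts on the coefficients of v as x acts on v.\<close>
    have exp: "(\<Sum>j<m. t (h, i) (k, j) * w (k, j)) = sip \<tau> (e i) (x h k * v k)" if k: "k \<in> F" for h i k
    proof -
      have "sip \<tau> (e i) (x h k * v k) - sip \<tau> (e i) (x h k * proj \<tau> e m (v k))
          = sip \<tau> (e i) (x h k * (v k - proj \<tau> e m (v k)))"
        by (simp add: right_diff_distrib sip_diff_right[OF \<tau>])
      also have "\<dots> = 0" using nul k by (intro sip_null[OF \<tau> sip_null_mult[OF \<tau>]]) blast
      finally have "sip \<tau> (e i) (x h k * v k) = sip \<tau> (e i) (x h k * proj \<tau> e m (v k))" by simp
      also have "\<dots> = (\<Sum>j<m. t (h, i) (k, j) * w (k, j))"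
        by (simp add: proj_def[OF \<tau>] sum_distrib_left scaleC_mult_right sip_sum_right[OF \<tau>] sip_scaleC_right[OF \<tau>] t_def w_def mult.commute)
      finally show ?thesis by simp
    qed
    have "(\<Sum>q\<in>?I. \<phi> (h * ginv (fst q)) * t (h, i) q * w q) = sip \<tau> (e i) (y h)" for h i
    proof -
      have "(\<Sum>q\<in>?I. \<phi> (h * ginv (fst q)) * t (h, i) q * w q)
          = (\<Sum>k\<in>F. \<phi> (h * ginv k) * (\<Sum>j<m. t (h, i) (k, j) * w (k, j)))"
        by (simp add: sum_Times sum_distrib_left mult.assoc)
      also have "\<dots> = sip \<tau> (e i) (y h)"
        by (simp add: exp y sip_sum_right[OF \<tau>] sip_scaleC_right[OF \<tau>])
      finally show ?thesis .
    qed
    then have "(\<Sum>p\<in>?I. (cmod (\<Sum>q\<in>?I. \<phi> (fst p * ginv (fst q)) * t p q * w q))\<^sup>2)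
        = (\<Sum>h\<in>F. \<Sum>i<m. (cmod (sip \<tau> (e i) (y h)))\<^sup>2)"
      by (subst sum_Times) simp
    \<comment> \<open>Equality in Bessel's inequality, because each y h lies in the subspace up to a
      null vector.\<close>
    also have "\<dots> = (\<Sum>h\<in>F. Re (sip \<tau> (y h) (y h)))"
      using bessel_identity[OF \<tau> e] nul by (intro sum.cong) auto
    also have "\<dots> = Re (\<tau> (\<Sum>h\<in>F. csq (y h)))" by (simp add: sip_def cstate_sum[OF \<tau>])
    finally show ?thesis by (simp add: eq)
  qed
  finally show ?thesis by (simp add: mult_left_mono)
qed

context twisted_system
begin

lemma coefm_scaleC: "coefm (scaleC c a) g h = scaleC c (coefm a g h)"
  by (simp add: coefm_def scaleC_mult_left act_simps)

text \<open>\<open>L f\<close> as a matrix over \<open>A\<close>: the entry in row h and column k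
  comes from g = h k^-1. F has to contain the columns at which row h meets both f and z.\<close>

lemma hcoord_L:
  assumes f: "finsupp f" and F: "finite F"
    and sub: "\<And>g. f g \<noteq> 0 \<Longrightarrow> hcoord z (ginv g * h) \<noteq> 0 \<Longrightarrow> ginv g * h \<in> F"
  shows "hcoord (L f z) h = (\<Sum>k\<in>F. coefm (f (h * ginv k)) (h * ginv k) h * hcoord z k)"
proof -
  have "hcoord (L f z) h = (\<Sum>g | f g \<noteq> 0. coefm (f g) g h * hcoord z (ginv g * h))"
    by (simp add: L_def hcoord_W)
  also have "\<dots> = (\<Sum>g\<in>{g. f g \<noteq> 0 \<and> ginv g * h \<in> F}. coefm (f g) g h * hcoord z (ginv g * h))"
    using f sub by (intro sum.mono_neutral_right) (auto, metis mult_zero_right)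
  also have "\<dots> = (\<Sum>k\<in>{k\<in>F. f (h * ginv k) \<noteq> 0}. coefm (f (h * ginv k)) (h * ginv k) h * hcoord z k)"
    by (rule sum.reindex_bij_witness[where i="\<lambda>k. h * ginv k" and j="\<lambda>g. ginv g * h"])
      (auto simp: ginv_mult mult.assoc ginv_left)
  also have "\<dots> = (\<Sum>k\<in>F. coefm (f (h * ginv k)) (h * ginv k) h * hcoord z k)"
    using F by (intro sum.mono_neutral_left) (auto simp: coefm_def)
  finally show ?thesis .
qed

text \<open>The norm is tested on finitely many rows H. F adds to H all columns that the support of
  f reaches from H, so the truncated matrix gives those rows exactly; its bound under a state comes
  from \<open>cstate_hip_operator_le\<close> for \<open>L f\<close> on vectors supported in
  F.\<close>

lemma norm_L_multiplier_le:
  assumes cb: "cb_mult \<phi> M K" and f: "finsupp f" and C: "C \<ge> 0"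
    and bd: "\<And>z. norm (L f z) \<le> C * norm z"
  shows "norm (L (\<lambda>g. scaleC (\<phi> g) (f g)) z) \<le> \<bar>K\<bar> * C * norm z"
proof (rule norm_hmod_leI)
  show "0 \<le> \<bar>K\<bar> * C * norm z" using C by simp
  fix H :: "'g set" assume H: "finite H"
  let ?E = "(\<lambda>(g, h). ginv g * h) ` ({g. f g \<noteq> 0} \<times> H)"
  define F where "F = H \<union> ?E"
  have F: "finite F" using H f by (simp add: F_def)
  define x where "x = (\<lambda>h k. coefm (f (h * ginv k)) (h * ginv k) h)"
  define v where "v = hcoord z"
  define y where "y = (\<lambda>h. \<Sum>k\<in>F. scaleC (\<phi> (h * ginv k)) (x h k * v k))"
  have f': "finite {g. scaleC (\<phi> g) (f g) \<noteq> 0}"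
    by (rule finite_subset[OF _ f]) auto
  have yL: "hcoord (L (\<lambda>g. scaleC (\<phi> g) (f g)) z) h = y h" if h: "h \<in> H" for h
  proof -
    have "ginv g * h \<in> F" if "scaleC (\<phi> g) (f g) \<noteq> 0" for g
    proof -
      have "f g \<noteq> 0" using that by auto
      then show ?thesis using h by (force simp: F_def)
    qed
    then show ?thesis
      by (subst hcoord_L[OF f' F]) (simp_all add: y_def x_def v_def coefm_scaleC scaleC_mult_left)
  qed
  \<comment> \<open>The Schur step works with the square matrix over F; its extra rows only enlarge
    the sum.\<close>
  have "norm (\<Sum>h\<in>H. csq (y h)) \<le> norm (\<Sum>h\<in>F. csq (y h))"
  proof (rule cpos_mono_norm)
    have "(\<Sum>h\<in>F. csq (y h)) - (\<Sum>h\<in>H. csq (y h)) = (\<Sum>h\<in>F - H. csq (y h))"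
      using F by (simp add: F_def sum_diff)
    then show "cpos ((\<Sum>h\<in>F. csq (y h)) - (\<Sum>h\<in>H. csq (y h)))"
      by (simp add: cpos_sum cpos_cstar_mult)
  qed (intro cpos_sum cpos_cstar_mult)
  also have "\<dots> \<le> (\<bar>K\<bar> * C)\<^sup>2 * norm (\<Sum>k\<in>F. csq (v k))"
  proof (rule schur_matrix[OF cb F C])
    show "y h = (\<Sum>k\<in>F. scaleC (\<phi> (h * ginv k)) (x h k * v k))" for h by (simp add: y_def)
    fix \<tau> :: "'a \<Rightarrow> complex" and u :: "'g \<Rightarrow> 'a" assume \<tau>: "cstate \<tau>"
    define z' where "z' = Hmod (\<lambda>k. if k \<in> F then u k else 0)"
    have z': "hcoord z' k = (if k \<in> F then u k else 0)" for k
      unfolding z'_def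
      by (subst hcoord_Hmod, rule sq_summable_finite_support, rule finite_subset[OF _ F]) auto
    have Lz: "hcoord (L f z') h = (\<Sum>k\<in>F. x h k * u k)" for h
      by (subst hcoord_L[OF f F]) (auto simp: z' x_def split: if_splits)
    have hz: "hip z' z' = (\<Sum>k\<in>F. csq (u k))"
    proof (rule hip_eqI)
      have "((\<lambda>k. csq (hcoord z' k)) has_sum (\<Sum>k\<in>F. csq (u k))) F"
        using F by (intro has_sum_finiteI) (auto simp: z')
      then show "((\<lambda>k. csq (hcoord z' k)) has_sum (\<Sum>k\<in>F. csq (u k))) UNIV"
        by (rule has_sum_cong_neutral[THEN iffD1, rotated -1]) (auto simp: z')
    qed
    have "(\<Sum>h\<in>F. Re (sip \<tau> (\<Sum>k\<in>F. x h k * u k) (\<Sum>k\<in>F. x h k * u k)))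
      = Re (\<tau> (\<Sum>h\<in>F. csq (hcoord (L f z') h)))"
      by (simp add: sip_def cstate_sum[OF \<tau>] Lz)
    \<comment> \<open>Dropping the rows outside F can only decrease the value of the state.\<close>
    also have "\<dots> \<le> Re (\<tau> (hip (L f z') (L f z')))"
      using cstate_cpos[OF \<tau> cpos_hip_minus_finite[OF F, of "L f z'"]] by (simp add: cstate_diff[OF \<tau>])
    also have "\<dots> \<le> C\<^sup>2 * Re (\<tau> (hip z' z'))"
      by (rule cstate_hip_operator_le[OF hadj_L bd C \<tau>])
    also have "Re (\<tau> (hip z' z')) = (\<Sum>k\<in>F. Re (sip \<tau> (u k) (u k)))"
      by (simp add: hz sip_def cstate_sum[OF \<tau>])
    finally show "(\<Sum>h\<in>F. Re (sip \<tau> (\<Sum>k\<in>F. x h k * u k) (\<Sum>k\<in>F. x h k * u k)))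
        \<le> C\<^sup>2 * (\<Sum>k\<in>F. Re (sip \<tau> (u k) (u k)))" .
  qed
  also have "\<dots> \<le> (\<bar>K\<bar> * C)\<^sup>2 * (norm z)\<^sup>2"
    unfolding v_def by (intro mult_left_mono norm_finite_gram_le F) simp
  finally show "norm (\<Sum>g\<in>H. cstar (hcoord (L (\<lambda>g. scaleC (\<phi> g) (f g)) z) g) * hcoord (L (\<lambda>g. scaleC (\<phi> g) (f g)) z) g)
      \<le> (\<bar>K\<bar> * C * norm z)\<^sup>2"
    by (simp add: yL power_mult_distrib)
qed

end

section \<open>The multipliers and the theorem\<close>

lemma le_of_forall_epsilon:
  fixes a b c :: real
  assumes "\<And>\<epsilon>. \<epsilon> > 0 \<Longrightarrow> a \<le> b + \<epsilon> * c"
  shows "a \<le> b"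
proof (rule field_le_epsilon)
  fix e :: real assume e: "e > 0"
  have "a \<le> b + e / (\<bar>c\<bar> + 1) * c" using e by (intro assms) simp
  also have "e / (\<bar>c\<bar> + 1) * c \<le> e"
  proof -
    have "e * c \<le> e * (\<bar>c\<bar> + 1)" using e by (intro mult_left_mono) auto
    then show ?thesis by (simp add: divide_simps)
  qed
  finally show "a \<le> b + e" by simp
qed

context twisted_system
begin

section \<open>Explicit multipliers and their norms\<close>

lemma Cr_preserves: "x \<in> \<C> \<Longrightarrow> preserves x"
  using Cr_approximable by blast

lemma Cr_bounded_linear: "x \<in> \<C> \<Longrightarrow> bounded_linear (tr x)"
  using Cr_approximable[of x] hadj_bounded_linear unfolding approximable_def by blast

lemma norm_tr_le: "x \<in> \<C> \<Longrightarrow> norm (tr x z) \<le> \<nu> x * norm z"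
  using onorm[OF Cr_bounded_linear, of x z] opnorm_tr[OF Cr_preserves Cr_bounded_linear, of x] by simp

lemma opnorm_nonneg: "x \<in> \<C> \<Longrightarrow> \<nu> x \<ge> 0"
  using opnorm_tr[OF Cr_preserves Cr_bounded_linear, of x] onorm_pos_le[OF Cr_bounded_linear, of x] by simp

lemma opnorm_leI:
  assumes "x \<in> \<C>" "c \<ge> 0" "\<And>z. norm (tr x z) \<le> c * norm z" shows "\<nu> x \<le> c"
  using opnorm_tr[OF Cr_preserves Cr_bounded_linear, OF assms(1,1)] onorm_bound[OF assms(2,3)] by simp

lemma op_diff_Cr: "x \<in> \<C> \<Longrightarrow> y \<in> \<C> \<Longrightarrow> op_diff x y \<in> \<C>"
  unfolding op_diff_eq by (intro Cr.add Cr.scale)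

lemma tr_op_diff_Cr: "x \<in> \<C> \<Longrightarrow> y \<in> \<C> \<Longrightarrow> tr (op_diff x y) z = tr x z - tr y z"
  by (simp add: tr_op_diff Cr_preserves)

lemma opnorm_op_diff_self: "x \<in> \<C> \<Longrightarrow> \<nu> (op_diff x x) = 0"
  by (intro antisym opnorm_leI opnorm_nonneg) (auto simp: op_diff_Cr tr_op_diff_Cr)

lemma Lam_dense:
  assumes "x \<in> \<C>" "\<epsilon> > 0"
  obtains f where "finsupp f" "\<nu> (op_diff x (\<Lambda> f)) \<le> \<epsilon>"
proof -
  obtain Y where Y: "Y \<in> LC" "\<And>z. norm (tr x z - Y z) \<le> \<epsilon> * norm z"
    using Cr_approximable[OF assms(1)] assms(2) unfolding approximable_def by meson
  obtain f where f: "finsupp f" "Y = L f" using Y(1) by (auto simp: LC_def Cc_def)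
  have "\<nu> (op_diff x (\<Lambda> f)) \<le> \<epsilon>"
    using assms Y(2) Lam_Cr[OF f(1)]
    by (intro opnorm_leI op_diff_Cr) (auto simp: tr_op_diff_Cr, simp add: Lam_eq f(2))
  then show thesis using f(1) that by blast
qed

lemma norm_L_le:
  assumes "finite F" "{g. f g \<noteq> 0} \<subseteq> F"
  shows "norm (L f z) \<le> (\<Sum>g\<in>F. norm (f g)) * norm z"
  unfolding L_superset[OF assms] sum_distrib_right
  by (rule order_trans[OF norm_sum]) (intro sum_mono norm_W_le)

lemma hat_op_add: "hat (op_add x y) g = hat x g + hat y g"
  by (simp add: hat_def op_add_def)

lemma hat_op_scale: "hat (op_scale c x) g = scaleC c (hat x g)"
  by (simp add: hat_def op_scale_def)

text \<open>Fourier coefficients exist for every x, so for finitely supported \<phi> the multiplier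
  is a finite sum, given directly on the whole algebra.\<close>

definition mulop :: "('g \<Rightarrow> complex) \<Rightarrow> ('g, 'a) op \<Rightarrow> ('g, 'a) op" where
  "mulop \<phi> x = \<Lambda> (\<lambda>g. scaleC (\<phi> g) (hat x g))"

context
  fixes \<phi> :: "'g \<Rightarrow> complex"
  assumes \<phi>: "finsupp \<phi>"
begin

lemma finite_support_mul: "finite {g. scaleC (\<phi> g) (f g :: 'a) \<noteq> 0}"
  by (rule finite_subset[OF _ \<phi>]) auto

lemma mulop_Cr: "mulop \<phi> x \<in> \<C>"
  unfolding mulop_def by (intro Lam_Cr finite_support_mul)

lemma tr_mulop: "tr (mulop \<phi> x) z = (\<Sum>g | \<phi> g \<noteq> 0. W (scaleC (\<phi> g) (hat x g)) g z)"
  unfolding mulop_def Lam_eq tr_untr by (rule L_superset[OF \<phi>]) auto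

lemma mulop_add:
  assumes "x \<in> \<C>" "y \<in> \<C>"
  shows "mulop \<phi> (op_add x y) = op_add (mulop \<phi> x) (mulop \<phi> y)"
proof (rule tr_inject)
  show "tr (mulop \<phi> (op_add x y)) = tr (op_add (mulop \<phi> x) (mulop \<phi> y))"
    by (simp add: fun_eq_iff tr_op_add Cr_preserves mulop_Cr tr_mulop hat_op_add scaleC_add_right W_add sum.distrib)
qed (auto intro: preserves_op_add Cr_preserves mulop_Cr)

lemma mulop_scale: "mulop \<phi> (op_scale c x) = op_scale c (mulop \<phi> x)"
proof (rule tr_inject)
  have hs: "hscale c (\<Sum>i\<in>I. z i) = (\<Sum>i\<in>I. hscale c (z i))" for I :: "'g set" and z
    by (rule hmod_eqI) (simp add: scaleC_sum_right)
  show "tr (mulop \<phi> (op_scale c x)) = tr (op_scale c (mulop \<phi> x))"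
    by (simp add: fun_eq_iff tr_op_scale Cr_preserves mulop_Cr tr_mulop hat_op_scale hs W_scaleC[symmetric]
        scaleC_scaleC mult.commute)
qed (auto intro: preserves_op_scale Cr_preserves mulop_Cr)

lemma mulop_diff:
  assumes "x \<in> \<C>" "y \<in> \<C>"
  shows "mulop \<phi> (op_diff x y) = op_diff (mulop \<phi> x) (mulop \<phi> y)"
  unfolding op_diff_eq using assms by (simp add: mulop_add mulop_scale Cr.scale)

lemma mulop_Lam: "finsupp f \<Longrightarrow> mulop \<phi> (\<Lambda> f) = \<Lambda> (\<lambda>g. scaleC (\<phi> g) (f g))"
  by (simp add: mulop_def hat_Lam)

lemma norm_hat_le: "x \<in> \<C> \<Longrightarrow> norm (hat x g) \<le> \<nu> x * norm e0"
  using norm_hcoord_le[of "tr x e0" g] norm_tr_le[of x e0] by (simp add: hat_eq Cr_preserves)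

text \<open>The constant depends on \<phi> and is not uniform along the net, but it gives
  continuity, which carries identities and the sharp estimate from finitely supported operators to
  all x.\<close>

lemma opnorm_mulop_crude:
  assumes x: "x \<in> \<C>"
  shows "\<nu> (mulop \<phi> x) \<le> (\<Sum>g | \<phi> g \<noteq> 0. cmod (\<phi> g)) * norm e0 * \<nu> x"
proof (rule opnorm_leI[OF mulop_Cr])
  let ?c = "(\<Sum>g | \<phi> g \<noteq> 0. cmod (\<phi> g)) * norm e0 * \<nu> x"
  show "0 \<le> ?c" using opnorm_nonneg[OF x] by (simp add: sum_nonneg)
  fix z
  have "norm (tr (mulop \<phi> x) z) \<le> (\<Sum>g | \<phi> g \<noteq> 0. norm (scaleC (\<phi> g) (hat x g))) * norm z"
    unfolding mulop_def Lam_eq tr_untr by (rule norm_L_le[OF \<phi>]) auto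
  also have "\<dots> \<le> ?c * norm z"
  proof (intro mult_right_mono)
    have "(\<Sum>g | \<phi> g \<noteq> 0. norm (scaleC (\<phi> g) (hat x g))) \<le> (\<Sum>g | \<phi> g \<noteq> 0. cmod (\<phi> g) * (\<nu> x * norm e0))"
      unfolding norm_scaleC by (intro sum_mono mult_left_mono norm_hat_le x) simp
    then show "(\<Sum>g | \<phi> g \<noteq> 0. norm (scaleC (\<phi> g) (hat x g))) \<le> ?c"
      unfolding sum_distrib_right[symmetric] by (simp only: mult_ac)
  qed simp
  finally show "norm (tr (mulop \<phi> x) z) \<le> ?c * norm z" .
qed

text \<open>Compare x with \<Lambda>(f) at distance \<epsilon>: the sharp estimate applies to
  \<open>L f\<close> with constant \<open>\<nu> x\<close> + \<epsilon>, the crude one to the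
  difference, and \<epsilon> is arbitrary.\<close>

lemma opnorm_mulop:
  assumes cb: "cb_mult \<phi> M K" and x: "x \<in> \<C>"
  shows "\<nu> (mulop \<phi> x) \<le> \<bar>K\<bar> * \<nu> x"
proof (rule opnorm_leI[OF mulop_Cr])
  show "0 \<le> \<bar>K\<bar> * \<nu> x" using opnorm_nonneg[OF x] by simp
  fix z
  let ?c = "(\<Sum>g | \<phi> g \<noteq> 0. cmod (\<phi> g)) * norm e0"
  show "norm (tr (mulop \<phi> x) z) \<le> \<bar>K\<bar> * \<nu> x * norm z"
  proof (rule le_of_forall_epsilon[where c="(\<bar>K\<bar> + ?c) * norm z"])
    fix \<epsilon> :: real assume e: "\<epsilon> > 0"
    obtain f where f: "finsupp f" "\<nu> (op_diff x (\<Lambda> f)) \<le> \<epsilon>"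
      by (rule Lam_dense[OF x e])
    note LC = Lam_Cr[OF f(1)]
    have d: "norm (tr x u - L f u) \<le> \<epsilon> * norm u" for u
    proof -
      have "norm (tr x u - L f u) \<le> \<nu> (op_diff x (\<Lambda> f)) * norm u"
        using norm_tr_le[OF op_diff_Cr[OF x LC], of u] unfolding tr_op_diff_Cr[OF x LC] by (simp add: Lam_eq)
      also have "\<dots> \<le> \<epsilon> * norm u" using f(2) by (simp add: mult_right_mono)
      finally show ?thesis .
    qed
    have "norm (L f u) \<le> (\<nu> x + \<epsilon>) * norm u" for u
      using d[of u] norm_tr_le[OF x, of u] norm_triangle_ineq4[of "tr x u" "tr x u - L f u"] by (simp add: algebra_simps)
    then have 1: "norm (L (\<lambda>g. scaleC (\<phi> g) (f g)) z) \<le> \<bar>K\<bar> * (\<nu> x + \<epsilon>) * norm z"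
      using e opnorm_nonneg[OF x] by (intro norm_L_multiplier_le[OF cb f(1)]) auto
    have "\<nu> (mulop \<phi> (op_diff x (\<Lambda> f))) \<le> ?c * \<nu> (op_diff x (\<Lambda> f))"
      by (rule opnorm_mulop_crude[OF op_diff_Cr[OF x LC]])
    also have "\<dots> \<le> ?c * \<epsilon>" using f(2) by (intro mult_left_mono) (auto simp: sum_nonneg)
    finally have "norm (tr (mulop \<phi> (op_diff x (\<Lambda> f))) z) \<le> ?c * \<epsilon> * norm z"
      using norm_tr_le[OF mulop_Cr, of "op_diff x (\<Lambda> f)" z] by (meson mult_right_mono norm_ge_zero order_trans)
    then have 2: "norm (tr (mulop \<phi> x) z - L (\<lambda>g. scaleC (\<phi> g) (f g)) z) \<le> ?c * \<epsilon> * norm z"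
      by (simp add: mulop_diff[OF x LC] tr_op_diff_Cr mulop_Cr mulop_Lam[OF f(1)] Lam_Cr[OF finite_support_mul])
        (simp add: Lam_eq)
    have "norm (tr (mulop \<phi> x) z) \<le> ?c * \<epsilon> * norm z + \<bar>K\<bar> * (\<nu> x + \<epsilon>) * norm z"
      using norm_triangle_ineq[of "tr (mulop \<phi> x) z - L (\<lambda>g. scaleC (\<phi> g) (f g)) z" "L (\<lambda>g. scaleC (\<phi> g) (f g)) z"] 1 2
      by simp
    also have "\<dots> = \<bar>K\<bar> * \<nu> x * norm z + \<epsilon> * ((\<bar>K\<bar> + ?c) * norm z)" by (simp add: algebra_simps)
    finally show "norm (tr (mulop \<phi> x) z) \<le> \<bar>K\<bar> * \<nu> x * norm z + \<epsilon> * ((\<bar>K\<bar> + ?c) * norm z)" .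
  qed
qed

lemma MA_map_mulop: "MA_map \<alpha> \<sigma> (\<lambda>g. scaleC (\<phi> g)) (mulop \<phi>)"
  unfolding MA_map_def
proof (intro conjI ballI allI)
  show "\<exists>K. \<forall>x\<in>\<C>. \<nu> (mulop \<phi> x) \<le> K * \<nu> x"
    using opnorm_mulop_crude by blast
  show "mulop \<phi> (\<Lambda> f) = \<Lambda> (mult_fun (\<lambda>g. scaleC (\<phi> g)) f)" if "f \<in> Cc" for f
    using that by (simp add: mulop_Lam Cc_def mult_fun_def)
qed (auto simp: scaleC_add_right scaleC_scaleC mult.commute mulop_Cr mulop_add mulop_scale)

text \<open>\<open>Mop\<close> selects some witness, so every witness has to be identified: two
  bounded maps that agree on finitely supported operators agree on the closure.\<close>

lemma MA_map_unique:
  assumes M: "MA_map \<alpha> \<sigma> (\<lambda>g. scaleC (\<phi> g)) M" and x: "x \<in> \<C>"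
  shows "M x = mulop \<phi> x"
proof (rule tr_inject)
  have MC: "M y \<in> \<C>" if "y \<in> \<C>" for y using M that by (simp add: MA_map_def)
  have Md: "M (op_diff y y') = op_diff (M y) (M y')" if "y \<in> \<C>" "y' \<in> \<C>" for y y'
    using M that unfolding op_diff_eq MA_map_def by (simp add: Cr.scale)
  obtain K where K: "\<And>y. y \<in> \<C> \<Longrightarrow> \<nu> (M y) \<le> K * \<nu> y" using M unfolding MA_map_def by blast
  define c where "c = (\<Sum>g | \<phi> g \<noteq> 0. cmod (\<phi> g)) * norm e0"
  have c0: "c \<ge> 0" by (simp add: c_def sum_nonneg)
  show "tr (M x) = tr (mulop \<phi> x)"
  proof
    fix z
    have "norm (tr (M x) z - tr (mulop \<phi> x) z) \<le> 0"
    proof (rule le_of_forall_epsilon[where c="(\<bar>K\<bar> + c) * norm z"])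
      fix \<epsilon> :: real assume e: "\<epsilon> > 0"
      obtain f where f: "finsupp f" "\<nu> (op_diff x (\<Lambda> f)) \<le> \<epsilon>"
        by (rule Lam_dense[OF x e])
      note LC = Lam_Cr[OF f(1)]
      note D = op_diff_Cr[OF x LC]
      have eq: "M (\<Lambda> f) = mulop \<phi> (\<Lambda> f)"
        using M MA_map_mulop f(1) by (simp add: MA_map_def Cc_def)
      have "\<nu> (M (op_diff x (\<Lambda> f))) \<le> \<bar>K\<bar> * \<epsilon>"
        using K[OF D] f(2) opnorm_nonneg[OF D] by (meson abs_ge_self abs_ge_zero mult_mono order_trans)
      then have 1: "norm (tr (M x) z - tr (M (\<Lambda> f)) z) \<le> \<bar>K\<bar> * \<epsilon> * norm z"
        using norm_tr_le[OF MC[OF D], of z] unfolding Md[OF x LC] tr_op_diff_Cr[OF MC[OF x] MC[OF LC]]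
        by (meson mult_right_mono norm_ge_zero order_trans)
      have "\<nu> (mulop \<phi> (op_diff x (\<Lambda> f))) \<le> c * \<epsilon>"
        using opnorm_mulop_crude[OF D] f(2) c0 unfolding c_def[symmetric] by (meson mult_left_mono order_trans)
      then have 2: "norm (tr (mulop \<phi> x) z - tr (M (\<Lambda> f)) z) \<le> c * \<epsilon> * norm z"
        using norm_tr_le[OF mulop_Cr, of "op_diff x (\<Lambda> f)" z]
        unfolding mulop_diff[OF x LC] tr_op_diff_Cr[OF mulop_Cr mulop_Cr] eq
        by (meson mult_right_mono norm_ge_zero order_trans)
      show "norm (tr (M x) z - tr (mulop \<phi> x) z) \<le> 0 + \<epsilon> * ((\<bar>K\<bar> + c) * norm z)"
        using 1 2 norm_triangle_ineq4[of "tr (M x) z - tr (M (\<Lambda> f)) z" "tr (mulop \<phi> x) z - tr (M (\<Lambda> f)) z"]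
        by (simp add: algebra_simps)
    qed
    then show "tr (M x) z = tr (mulop \<phi> x) z" by simp
  qed
  show "preserves (M x)" by (rule Cr_preserves[OF MC[OF x]])
  show "preserves (mulop \<phi> x)" by (rule Cr_preserves[OF mulop_Cr])
qed

lemma Mop_eq: "x \<in> \<C> \<Longrightarrow> Mop \<alpha> \<sigma> (\<lambda>g. scaleC (\<phi> g)) x = mulop \<phi> x"
  unfolding Mop_def by (rule MA_map_unique[OF someI[of "MA_map \<alpha> \<sigma> (\<lambda>g. scaleC (\<phi> g))", OF MA_map_mulop]])

text \<open>The partial Fourier sums over finite sets containing the support of \<phi> already equal
  the operator.\<close>

lemma mulop_CF: "mulop \<phi> x \<in> CF \<alpha> \<sigma>"
proof -
  have fp: "fourier_partial \<alpha> \<sigma> (mulop \<phi> x) F = mulop \<phi> x" if "finite F" "{g. \<phi> g \<noteq> 0} \<subseteq> F" for F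
  proof -
    have "fourier_partial \<alpha> \<sigma> (mulop \<phi> x) F = untr (\<lambda>z. \<Sum>g\<in>F. W (scaleC (\<phi> g) (hat x g)) g z)"
      unfolding fourier_partial_def sum_mult_lam by (simp add: mulop_def hat_Lam[OF finite_support_mul])
    also have "(\<lambda>z. \<Sum>g\<in>F. W (scaleC (\<phi> g) (hat x g)) g z) = L (\<lambda>g. scaleC (\<phi> g) (hat x g))"
      using that by (intro ext L_superset[symmetric]) auto
    finally show ?thesis by (simp add: mulop_def Lam_eq)
  qed
  show ?thesis
    unfolding CF_def using \<phi> by (auto simp: mulop_Cr fp opnorm_op_diff_self intro!: exI[of _ "{g. \<phi> g \<noteq> 0}"])
qed

lemma scaleC_MCF: "(\<lambda>g. scaleC (\<phi> g)) \<in> MCF \<alpha> \<sigma>"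
  unfolding MCF_def MA_def using MA_map_mulop by (auto simp: Mop_eq mulop_CF)

lemma finite_G_support_scaleC: "finite_G_support (\<lambda>g. scaleC (\<phi> g) :: 'a \<Rightarrow> 'a)"
  unfolding finite_G_support_def by (rule finite_subset[OF _ \<phi>]) (auto simp: fun_eq_iff)

lemma tnorm_scaleC_le:
  assumes cb: "cb_mult \<phi> M K" shows "tnorm \<alpha> \<sigma> (\<lambda>g. scaleC (\<phi> g)) \<le> \<bar>K\<bar>"
  unfolding tnorm_def
proof (rule cSup_least)
  \<comment> \<open>A member of the unit ball is exhibited, since bounding a supremum requires a
    nonempty set.\<close>
  have "lmul \<alpha> 0 \<in> \<C>" by (rule Cr.gen_A)
  then have "op_diff (lmul \<alpha> 0) (lmul \<alpha> 0) \<in> \<C>" "\<nu> (op_diff (lmul \<alpha> 0) (lmul \<alpha> 0)) \<le> 1"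
    by (simp_all add: op_diff_Cr opnorm_op_diff_self)
  then show "{\<nu> (Mop \<alpha> \<sigma> (\<lambda>g. scaleC (\<phi> g)) x) |x. x \<in> \<C> \<and> \<nu> x \<le> 1} \<noteq> {}" by blast
  fix r assume "r \<in> {\<nu> (Mop \<alpha> \<sigma> (\<lambda>g. scaleC (\<phi> g)) x) |x. x \<in> \<C> \<and> \<nu> x \<le> 1}"
  then obtain x where x: "x \<in> \<C>" "\<nu> x \<le> 1" "r = \<nu> (mulop \<phi> x)" by (auto simp: Mop_eq)
  have "r \<le> \<bar>K\<bar> * \<nu> x" using opnorm_mulop[OF cb x(1)] x(3) by simp
  also have "\<dots> \<le> \<bar>K\<bar>" using x(2) by (simp add: mult_left_le)
  finally show "r \<le> \<bar>K\<bar>" .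
qed

text \<open>Insert \<Lambda>(f): replacing x by it costs |K| \<epsilon> after the multiplier and
  \<epsilon> without it, and on \<Lambda>(f) the multiplier differs from the identity by a sum over
  the support of f.\<close>

lemma opnorm_mulop_diff_le:
  assumes cb: "cb_mult \<phi> M K" and x: "x \<in> \<C>"
    and f: "finsupp f" "\<nu> (op_diff x (\<Lambda> f)) \<le> \<epsilon>"
  shows "\<nu> (op_diff (mulop \<phi> x) x) \<le> (\<bar>K\<bar> + 1) * \<epsilon> + (\<Sum>g | f g \<noteq> 0. cmod (\<phi> g - 1) * norm (f g))"
    (is "_ \<le> _ + ?s")
proof (rule opnorm_leI[OF op_diff_Cr[OF mulop_Cr x]])
  note LC = Lam_Cr[OF f(1)]
  note D = op_diff_Cr[OF x LC]
  have e: "\<epsilon> \<ge> 0" using opnorm_nonneg[OF D] f(2) by simp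
  show "0 \<le> (\<bar>K\<bar> + 1) * \<epsilon> + ?s" using e by (simp add: sum_nonneg)
  fix z
  have "\<nu> (mulop \<phi> (op_diff x (\<Lambda> f))) \<le> \<bar>K\<bar> * \<epsilon>"
    using opnorm_mulop[OF cb D] f(2) by (meson abs_ge_zero mult_left_mono order_trans)
  then have 1: "norm (tr (mulop \<phi> x) z - tr (mulop \<phi> (\<Lambda> f)) z) \<le> \<bar>K\<bar> * \<epsilon> * norm z"
    using norm_tr_le[OF mulop_Cr, of "op_diff x (\<Lambda> f)" z]
    unfolding mulop_diff[OF x LC] tr_op_diff_Cr[OF mulop_Cr mulop_Cr]
    by (meson mult_right_mono norm_ge_zero order_trans)
  have 2: "norm (tr x z - L f z) \<le> \<epsilon> * norm z"
  proof -
    have "norm (tr x z - L f z) \<le> \<nu> (op_diff x (\<Lambda> f)) * norm z"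
      using norm_tr_le[OF D, of z] unfolding tr_op_diff_Cr[OF x LC] by (simp add: Lam_eq)
    then show ?thesis using f(2) by (meson mult_right_mono norm_ge_zero order_trans)
  qed
  have "tr (mulop \<phi> (\<Lambda> f)) z - L f z = (\<Sum>g | f g \<noteq> 0. W (scaleC (\<phi> g - 1) (f g)) g z)"
  proof -
    have "tr (mulop \<phi> (\<Lambda> f)) z = (\<Sum>g | f g \<noteq> 0. W (scaleC (\<phi> g) (f g)) g z)"
      unfolding mulop_Lam[OF f(1)] unfolding Lam_eq tr_untr by (rule L_superset[OF f(1)]) auto
    moreover have "scaleC (\<phi> g - 1) (f g) = scaleC (\<phi> g) (f g) - f g" for g
      using scaleC_add_left[of "\<phi> g" "-1" "f g"] by (simp add: scaleC_uminus_left)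
    ultimately show ?thesis by (simp add: L_def W_diff sum_subtractf)
  qed
  then have 3: "norm (tr (mulop \<phi> (\<Lambda> f)) z - L f z) \<le> ?s * norm z"
    unfolding sum_distrib_right
    by (simp only:) (rule order_trans[OF norm_sum], rule sum_mono, rule order_trans[OF norm_W_le], simp add: norm_scaleC)
  have "norm (tr (op_diff (mulop \<phi> x) x) z) \<le> norm (tr (mulop \<phi> x) z - tr (mulop \<phi> (\<Lambda> f)) z)
      + norm (tr (mulop \<phi> (\<Lambda> f)) z - L f z) + norm (tr x z - L f z)"
    unfolding tr_op_diff_Cr[OF mulop_Cr x]
    using norm_triangle_ineq4[of "tr (mulop \<phi> x) z - L f z" "tr x z - L f z"]
      norm_triangle_ineq[of "tr (mulop \<phi> x) z - tr (mulop \<phi> (\<Lambda> f)) z" "tr (mulop \<phi> (\<Lambda> f)) z - L f z"]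
    by simp
  then show "norm (tr (op_diff (mulop \<phi> x) x) z) \<le> ((\<bar>K\<bar> + 1) * \<epsilon> + ?s) * norm z"
    using 1 2 3 by (simp add: algebra_simps)
qed

end

end

theorem theorem5p7:
  fixes \<alpha> :: "'g::discrete_group \<Rightarrow> 'a::cstar_alg \<Rightarrow> 'a"
    and \<sigma> :: "'g \<Rightarrow> 'g \<Rightarrow> 'a"
  assumes "twisted \<alpha> \<sigma>"
    and "weakly_amenable TYPE('g)"
  shows "bounded_fejer \<alpha> \<sigma>"
proof -
  interpret twisted_system \<alpha> \<sigma> by unfold_locales (rule assms)
  obtain F :: "('g \<Rightarrow> complex) filter" and K where F: "F \<noteq> bot"
    and ev: "\<forall>\<^sub>F \<phi> in F. finsupp \<phi> \<and> (\<exists>M. cb_mult \<phi> M K)"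
    and lim: "\<And>g. ((\<lambda>\<phi>. \<phi> g) \<longlongrightarrow> 1) F"
    using assms(2) unfolding weakly_amenable_def by blast
  define T :: "('g \<Rightarrow> complex) \<Rightarrow> 'g \<Rightarrow> 'a \<Rightarrow> 'a" where "T = (\<lambda>\<phi> g. scaleC (\<phi> g))"
  have "((\<lambda>\<phi>. opnorm \<alpha> (op_diff (Mop \<alpha> \<sigma> (T \<phi>) x) x)) \<longlongrightarrow> 0) F" if x: "x \<in> Cr \<alpha> \<sigma>" for x
  proof (rule tendstoI)
    fix d :: real assume d: "d > 0"
    \<comment> \<open>Half of d goes to the approximation of x, uniformly in \<phi> because
      \<open>K\<close> is, and half to the finite sum, which tends to 0 by pointwise
      convergence.\<close>
    define \<epsilon> where "\<epsilon> = d / (2 * (\<bar>K\<bar> + 1))"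
    have e: "\<epsilon> > 0" "(\<bar>K\<bar> + 1) * \<epsilon> = d / 2" using d by (auto simp: \<epsilon>_def field_simps)
    obtain f where f: "finsupp f" "opnorm \<alpha> (op_diff x (Lam \<alpha> \<sigma> f)) \<le> \<epsilon>"
      by (rule Lam_dense[OF x e(1)])
    have "((\<lambda>\<phi>. \<Sum>g\<in>{g. f g \<noteq> 0}. cmod (\<phi> g - 1) * norm (f g)) \<longlongrightarrow> (\<Sum>g | f g \<noteq> 0. cmod (1 - 1) * norm (f g))) F"
      by (intro tendsto_intros lim)
    then have "\<forall>\<^sub>F \<phi> in F. (\<Sum>g | f g \<noteq> 0. cmod (\<phi> g - 1) * norm (f g)) < d / 2"
      by (rule order_tendstoD) (use d in simp)
    with ev show "\<forall>\<^sub>F \<phi> in F. dist (opnorm \<alpha> (op_diff (Mop \<alpha> \<sigma> (T \<phi>) x) x)) 0 < d"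
    proof eventually_elim
      case (elim \<phi>)
      then obtain M where \<phi>: "finsupp \<phi>" and cb: "cb_mult \<phi> M K" by blast
      have "opnorm \<alpha> (op_diff (mulop \<phi> x) x) < d"
        using opnorm_mulop_diff_le[OF \<phi> cb x f] e(2) elim by simp
      then show ?case
        using opnorm_nonneg[OF op_diff_Cr[OF mulop_Cr[OF \<phi>] x]] by (simp add: T_def Mop_eq[OF \<phi> x])
    qed
  qed
  moreover have "\<forall>\<^sub>F \<phi> in F. T \<phi> \<in> MCF \<alpha> \<sigma> \<and> finite_G_support (T \<phi>)"
    using ev by eventually_elim (simp add: T_def scaleC_MCF finite_G_support_scaleC)
  moreover have "\<forall>\<^sub>F \<phi> in F. tnorm \<alpha> \<sigma> (T \<phi>) \<le> \<bar>K\<bar>"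
    using ev by eventually_elim (auto simp: T_def intro: tnorm_scaleC_le)
  \<comment> \<open>The net of multipliers is the image under T of the net of functions, so its
    filter is \<open>filtermap T F\<close>.\<close>
  ultimately show ?thesis
    unfolding bounded_fejer_def using F
    by (intro exI[of _ "filtermap T F"] conjI ballI exI[of _ "\<bar>K\<bar>"])
      (auto simp: filtermap_bot_iff eventually_filtermap filterlim_filtermap)
qed

end
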